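(* Let $\theta=(\{\theta_s\}_{s\in S},\{X_s\}_{s\in S})$ be a topologically free action of an inverse semigroup $S$ on a locally compact, Hausdorff, zero-dimensional space $X$, and let $\mathcal O$ be an $S\ltimes X$-sheaf of fields. If $S\ltimes X$ is Hausdorff, then $\theta$ is minimal if, and only if, $\Gamma_c(S\ltimes X,\mathcal O)$ is simple.
   Context: "Compact" includes Hausdorff. Zero-dimensional: having a basis of compact open sets. An action $\theta$ of an inverse semigroup $S$ on $X$ is a semigroup homomorphism $s\mapsto\theta_s$ to the inverse semigroup of homeomorphisms between open subsets of $X$, where $\theta_s:X_{s^*}\to X_s$, and such that $\bigcup_{s\in S}X_s=X$. $\theta$ is topologically free if for every $s\in S$ the interior of $\{x\in X_{s^*}\mid\theta_s(x)=x\}$ equals $\{x\in X_{s^*}\mid \text{there is an idempotent } e\in E(S) \text{ with } e\le s \text{ and } x\in X_e\}$. $\theta$ is minimal if the only open subsets $U\subseteq X$ that are invariant ($\theta_s(U\cap X_{s^*})\subseteq U$ for all $s\in S$) are $\emptyset$ and $X$. Groupoid of germs $S\ltimes X$: unit space $X$; arrows are classes $[s,x]$ of pairs $(s,x)\in S\times X$ with $x\in X_{s^*}$, where $(s,x)\sim(t,y)$ iff $x=y$ and there is $u\le s,t$ with $x\in X_{u^*}$; $\boldsymbol d([s,x])=x$, $\boldsymbol r([s,x])=\theta_s(x)$, $[s,\theta_t(x)][t,x]=[st,x]$, $[s,x]^{-1}=[s^*,\theta_s(x)]$; basic open sets $(s,U)=\{[s,x]:x\in U\}$ for $U\subseteq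 X_{s^*}$ open. It is an ample groupoid: a topological groupoid with locally compact Hausdorff unit space having a basis of compact open sets and with $\boldsymbol r$ a local homeomorphism. For an ample groupoid $\mathscr G$: a bisection is a subset on which $\boldsymbol d$ and $\boldsymbol r$ are injective. A $\mathscr G$-sheaf $(E,p,\alpha)$ is a space $E$, a local homeomorphism $p:E\to\mathscr G^{(0)}$ and a continuous map $\alpha:\mathscr G\times_{\boldsymbol d,p}E\to E$, $(\gamma,e)\mapsto\alpha_\gamma(e)$, with $\alpha_{p(e)}(e)=e$, $p(\alpha_\gamma(e))=\boldsymbol r(\gamma)$, and $\alpha_\beta(\alpha_\gamma(e))=\alpha_{\beta\gamma}(e)$ whenever defined. A $\mathscr G$-sheaf of rings $\mathcal O=(E,p,\alpha)$ is a $\mathscr G$-sheaf with a unital ring structure on each stalk $\mathcal O_x=p^{-1}(x)$ such that fiberwise addition and multiplication $E\times_{p,p}E\to E$ and the unit section $x\mapsto1_x$ are continuous, and each $\alpha_\gamma:\mathcal O_{\boldsymbol d(\gamma)}\to\mathcal O_{\boldsymbol r(\gamma)}$ is a (unital) ring homomorphism; it is a sheaf of fields if all stalks are fields. $\Gamma_c(\mathscr G,\mathcal O)$ is the additive group generated by all maps $f:\mathscr G\to E$ with $p\circ f=\boldsymbol r$ for which there is a compact open bisection $U$ with $f|_U$ continuous and $f=0$ off $U$; it is a ring under pointwise addition and convolution $(f*g)(\gamma)=\sum_{\beta\rho=\gamma}f(\beta)\alpha_\beta(g(\rho))$. A ring is simple if its only two-sided ideals are $\{0\}$ and itself. *)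

theory Defs
  imports "HOL-Analysis.Analysis" "HOL-Algebra.Ideal" "HOL-Algebra.Generated_Groups"
begin

section \<open>Inverse semigroups\<close>

class inverse_semigroup = semigroup_mult +
  assumes ex1_generalized_inverse: "\<exists>!t. s * t * s = s \<and> t * s * t = t"

definition star :: "'s::inverse_semigroup \<Rightarrow> 's" where
  "star s = (THE t. s * t * s = s \<and> t * s * t = t)"

definition idempotent :: "'s::inverse_semigroup \<Rightarrow> bool" where
  "idempotent e \<longleftrightarrow> e * e = e"

text \<open>The natural partial order.\<close>
definition natural_le :: "'s::inverse_semigroup \<Rightarrow> 's \<Rightarrow> bool" where
  "natural_le s t \<longleftrightarrow> (\<exists>e. idempotent e \<and> s = t * e)"

lemma star_eqI: "s * t * s = s \<Longrightarrow> t * s * t = t \<Longrightarrow> star s = t"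
  unfolding star_def using ex1_generalized_inverse[of s] by (intro the1_equality) auto

lemma star_left: "s * star s * s = s" and star_right: "star s * s * star s = star s"
  using theI'[OF ex1_generalized_inverse[of s]] unfolding star_def by auto

lemma star_star: "star (star s) = s"
  by (rule star_eqI) (rule star_right star_left)+

lemma star_idempotent: "idempotent e \<Longrightarrow> star e = e"
  by (rule star_eqI) (auto simp: idempotent_def)

lemma idempotent_star_mult: "idempotent (star s * s)"
  by (simp add: idempotent_def star_right flip: mult.assoc)

lemma idempotent_mult_star: "idempotent (s * star s)"
  by (simp add: idempotent_def star_left flip: mult.assoc)

lemma idempotent_mult:
  assumes "idempotent e" "idempotent f" shows "idempotent (e * f)"
proof -
  have ee: "e * e = e" and ff: "f * f = f" using assms by (auto simp: idempotent_def)
  have ee': "e * (e * z) = e * z" and ff': "f * (f * z) = f * z" for z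
    by (simp_all add: ee ff flip: mult.assoc)
  define x where "x = star (e * f)"
  have x1: "e * f * x * (e * f) = e * f" and x2: "x * (e * f) * x = x"
    unfolding x_def by (rule star_left star_right)+
  have "star (e * f) = f * x * e"
  proof (rule star_eqI)
    show "e * f * (f * x * e) * (e * f) = e * f"
      using x1 by (simp add: mult.assoc ee' ff')
    have "f * x * e * (e * f) * (f * x * e) = f * (x * (e * f) * x) * e"
      by (simp add: mult.assoc ee' ff')
    then show "f * x * e * (e * f) * (f * x * e) = f * x * e"
      by (simp add: x2)
  qed
  then have fxe: "x = f * x * e" by (simp add: x_def)
  have "x * x = f * (x * (e * f) * x) * e"
    by (subst (1) fxe, subst (2) fxe) (simp add: mult.assoc)
  also have "\<dots> = x" using fxe x2 by simp
  finally have "idempotent x" by (simp add: idempotent_def)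
  then have "star x = x" by (rule star_idempotent)
  then have "x = e * f" unfolding x_def by (simp add: star_star)
  with \<open>idempotent x\<close> show ?thesis by simp
qed

lemma idempotent_commute:
  assumes "idempotent e" "idempotent f" shows "e * f = f * e"
proof -
  have ee: "e * e = e" and ff: "f * f = f" using assms by (auto simp: idempotent_def)
  have ee': "e * (e * z) = e * z" and ff': "f * (f * z) = f * z" for z
    by (simp_all add: ee ff flip: mult.assoc)
  have ef: "e * f * (e * f) = e * f" and fe: "f * e * (f * e) = f * e"
    using idempotent_mult assms by (auto simp: idempotent_def)
  have "star (e * f) = f * e"
    using ef fe by (intro star_eqI) (simp_all add: mult.assoc ee' ff')
  moreover have "star (e * f) = e * f"
    by (rule star_idempotent) (rule idempotent_mult[OF assms])
  ultimately show ?thesis by simp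
qed

lemma idempotent_conj:
  assumes "idempotent e" shows "idempotent (star t * e * t)"
proof -
  have "star t * e * t * (star t * e * t) = star t * (e * (t * star t)) * e * t"
    by (simp add: mult.assoc)
  also have "\<dots> = star t * ((t * star t) * e) * e * t"
    using idempotent_commute[OF assms idempotent_mult_star[of t]] by simp
  also have "\<dots> = (star t * t * star t) * (e * e) * t"
    by (simp add: mult.assoc)
  also have "\<dots> = star t * e * t"
    using assms by (simp add: star_right idempotent_def)
  finally show ?thesis by (simp add: idempotent_def)
qed

lemma natural_le_refl: "natural_le s s"
  unfolding natural_le_def
  by (intro exI[of _ "star s * s"]) (simp add: idempotent_star_mult star_left flip: mult.assoc)

lemma natural_le_trans: "natural_le s t \<Longrightarrow> natural_le t u \<Longrightarrow> natural_le s u"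
  unfolding natural_le_def by (auto simp: mult.assoc intro: idempotent_mult)

lemma idempotent_mult_right:
  assumes "idempotent e" shows "e * t = t * (star t * e * t)"
proof -
  have "t * (star t * e * t) = (t * star t) * e * t" by (simp add: mult.assoc)
  also have "\<dots> = e * (t * star t) * t"
    using idempotent_commute[OF assms idempotent_mult_star[of t]] by simp
  also have "\<dots> = e * (t * star t * t)" by (simp add: mult.assoc)
  finally show ?thesis by (simp add: star_left)
qed

lemma natural_le_mult:
  assumes "natural_le u s" "natural_le v t" shows "natural_le (u * v) (s * t)"
proof -
  obtain e f where e: "idempotent e" "u = s * e" and f: "idempotent f" "v = t * f"
    using assms by (auto simp: natural_le_def)
  have "u * v = s * (e * t) * f" using e f by (simp add: mult.assoc)
  also have "\<dots> = s * t * ((star t * e * t) * f)"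
    by (subst idempotent_mult_right[OF e(1)]) (simp add: mult.assoc)
  finally show ?thesis
    unfolding natural_le_def using idempotent_mult[OF idempotent_conj[OF e(1)] f(1)] by blast
qed

lemma natural_le_star:
  assumes "natural_le u s" shows "natural_le (star u) (star s)"
proof -
  obtain e where e: "idempotent e" "u = s * e" using assms by (auto simp: natural_le_def)
  have ee: "e * (e * z) = e * z" for z
    using e(1) by (simp add: idempotent_def flip: mult.assoc)
  have c: "star s * (s * (e * z)) = e * (star s * (s * z))" for z
    using idempotent_commute[OF e(1) idempotent_star_mult[of s]] by (simp flip: mult.assoc)
  have s3: "star s * (s * star s) = star s" by (simp add: star_right flip: mult.assoc)
  have "star u = e * star s" unfolding e(2)
  proof (rule star_eqI)
    have "s * e * (e * star s) * (s * e) = s * ((e * e) * (star s * s)) * e"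
      by (simp add: mult.assoc)
    also have "\<dots> = s * (star s * s * e) * e"
      using idempotent_commute[OF e(1) idempotent_star_mult[of s]] e(1)
      by (simp add: idempotent_def)
    also have "\<dots> = (s * star s * s) * (e * e)" by (simp add: mult.assoc)
    finally show "s * e * (e * star s) * (s * e) = s * e"
      using e(1) by (simp add: star_left idempotent_def)
    show "e * star s * (s * e) * (e * star s) = e * star s"
      by (simp add: mult.assoc ee c s3)
  qed
  also have "\<dots> = star s * (star (star s) * e * star s)"
    by (rule idempotent_mult_right[OF e(1)])
  finally show ?thesis
    unfolding natural_le_def using idempotent_conj[OF e(1), of "star s"] by blast
qed


section \<open>Actions on topological spaces\<close>

text \<open>Compact includes Hausdorff; the ambient space need not be Hausdorff.\<close>
definition compact_open_in :: "'x topology \<Rightarrow> 'x set \<Rightarrow> bool" where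
  "compact_open_in X K \<longleftrightarrow>
     openin X K \<and> compactin X K \<and> Hausdorff_space (subtopology X K)"

definition zero_dimensional :: "'x topology \<Rightarrow> bool" where
  "zero_dimensional X \<longleftrightarrow> openin X = arbitrary union_of (compact_open_in X)"

text \<open>
  Here \<open>D s\<close> is the open set \<open>X\<^sub>s\<close>, so that \<open>\<theta> s\<close> is a partial homeomorphism with domain
  \<open>D (star s)\<close> and range \<open>D s\<close>; the values of \<open>\<theta> s\<close> outside \<open>D (star s)\<close> are irrelevant.
  The last two assumptions say that \<open>\<theta> (s * t)\<close> is the composition of the partial maps
  \<open>\<theta> s\<close> and \<open>\<theta> t\<close> on its largest possible domain.
\<close>
locale inverse_semigroup_action =
  fixes X :: "'x topology"
    and D :: "'s::inverse_semigroup \<Rightarrow> 'x set"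
    and \<theta> :: "'s \<Rightarrow> 'x \<Rightarrow> 'x"
  assumes open_D: "openin X (D s)"
    and homeo: "homeomorphic_map (subtopology X (D (star s))) (subtopology X (D s)) (\<theta> s)"
    and covers: "(\<Union>s. D s) = topspace X"
    and dom_mult: "D (star (s * t)) = {x \<in> D (star t). \<theta> t x \<in> D (star s)}"
    and act_mult: "x \<in> D (star (s * t)) \<Longrightarrow> \<theta> (s * t) x = \<theta> s (\<theta> t x)"

definition topologically_free ::
  "'x topology \<Rightarrow> ('s::inverse_semigroup \<Rightarrow> 'x set) \<Rightarrow> ('s \<Rightarrow> 'x \<Rightarrow> 'x) \<Rightarrow> bool" where
  "topologically_free X D \<theta> \<longleftrightarrow>
     (\<forall>s. X interior_of {x \<in> D (star s). \<theta> s x = x}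
        = {x \<in> D (star s). \<exists>e. idempotent e \<and> natural_le e s \<and> x \<in> D e})"

definition minimal_action ::
  "'x topology \<Rightarrow> ('s::inverse_semigroup \<Rightarrow> 'x set) \<Rightarrow> ('s \<Rightarrow> 'x \<Rightarrow> 'x) \<Rightarrow> bool" where
  "minimal_action X D \<theta> \<longleftrightarrow>
     (\<forall>U. openin X U \<and> (\<forall>s. \<theta> s ` (U \<inter> D (star s)) \<subseteq> U) \<longrightarrow> U = {} \<or> U = topspace X)"


section \<open>The groupoid of germs\<close>

text \<open>
  The unit space is kept as a separate space \<open>objs\<close>, embedded into the arrows by \<open>unit\<close>.
\<close>
record ('g, 'x) topological_groupoid =
  arrows :: "'g topology"
  objs :: "'x topology"
  src :: "'g \<Rightarrow> 'x"
  rng :: "'g \<Rightarrow> 'x"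
  comp :: "'g \<Rightarrow> 'g \<Rightarrow> 'g"
  unit :: "'x \<Rightarrow> 'g"
  ginv :: "'g \<Rightarrow> 'g"

definition germ_rel ::
  "('s::inverse_semigroup \<Rightarrow> 'x set) \<Rightarrow> (('s \<times> 'x) \<times> ('s \<times> 'x)) set" where
  "germ_rel D = {((s, x), (t, y)). x \<in> D (star s) \<and> y \<in> D (star t) \<and> x = y
                   \<and> (\<exists>u. natural_le u s \<and> natural_le u t \<and> x \<in> D (star u))}"

definition germ :: "('s::inverse_semigroup \<Rightarrow> 'x set) \<Rightarrow> 's \<Rightarrow> 'x \<Rightarrow> ('s \<times> 'x) set" where
  "germ D s x = germ_rel D `` {(s, x)}"

text \<open>
  The structure maps are specified on representatives; the lemmas at the end of this section
  record that they are well defined.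
\<close>
definition germ_groupoid ::
  "'x topology \<Rightarrow> ('s::inverse_semigroup \<Rightarrow> 'x set) \<Rightarrow> ('s \<Rightarrow> 'x \<Rightarrow> 'x)
     \<Rightarrow> (('s \<times> 'x) set, 'x) topological_groupoid" where
  "germ_groupoid X D \<theta> =
    \<lparr> arrows = topology_generated_by
        {germ D s ` U | s U. openin X U \<and> U \<subseteq> D (star s)},
      objs = X,
      src = (\<lambda>\<gamma>. THE x. \<exists>s. x \<in> D (star s) \<and> \<gamma> = germ D s x),
      rng = (\<lambda>\<gamma>. THE y. \<exists>s x. x \<in> D (star s) \<and> \<gamma> = germ D s x \<and> y = \<theta> s x),
      comp = (\<lambda>\<gamma> \<delta>. THE \<epsilon>. \<exists>s t x. x \<in> D (star t) \<and> \<theta> t x \<in> D (star s)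
                 \<and> \<gamma> = germ D s (\<theta> t x) \<and> \<delta> = germ D t x \<and> \<epsilon> = germ D (s * t) x),
      unit = (\<lambda>x. THE \<epsilon>. \<exists>e. idempotent e \<and> x \<in> D e \<and> \<epsilon> = germ D e x),
      ginv = (\<lambda>\<gamma>. THE \<epsilon>. \<exists>s x. x \<in> D (star s) \<and> \<gamma> = germ D s x
                 \<and> \<epsilon> = germ D (star s) (\<theta> s x)) \<rparr>"

context inverse_semigroup_action
begin

lemma D_subset: "D s \<subseteq> topspace X"
  using open_D openin_subset by blast

lemma act_bij: "bij_betw (\<theta> s) (D (star s)) (D s)"
  using homeo[of s]
    quotient_imp_surjective_map[of "subtopology X (D (star s))" "subtopology X (D s)" "\<theta> s"]
  unfolding homeomorphic_map_def bij_betw_def topspace_subtopology_subset[OF D_subset] by blast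

lemma act_idempotent: assumes "idempotent e" "x \<in> D e" shows "\<theta> e x = x"
proof -
  have s: "star e = e" using assms(1) by (rule star_idempotent)
  then have "\<theta> e (\<theta> e x) = \<theta> e x"
    using act_mult[of x e e] assms by (simp add: idempotent_def)
  moreover have "\<theta> e x \<in> D e" using act_bij[of e] assms(2) s by (auto simp: bij_betw_def)
  ultimately show ?thesis
    using act_bij[of e] assms(2) s by (auto simp: bij_betw_def inj_on_def)
qed

lemma D_mult_idempotent:
  assumes "idempotent e" shows "D (star (s * e)) = D (star s) \<inter> D e"
  using dom_mult[of s e] act_idempotent[OF assms] star_idempotent[OF assms] by auto

lemma act_natural_le:
  assumes "natural_le u s" "x \<in> D (star u)" shows "x \<in> D (star s)" "\<theta> u x = \<theta> s x"
proof -
  obtain e where e: "idempotent e" "u = s * e" using assms by (auto simp: natural_le_def)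
  then have x: "x \<in> D (star s)" "x \<in> D e"
    using D_mult_idempotent[OF e(1), of s] assms(2) by auto
  show "x \<in> D (star s)" by (rule x)
  show "\<theta> u x = \<theta> s x" using act_mult[of x s e] act_idempotent[OF e(1) x(2)] e assms(2) by simp
qed

lemma equiv_germ_rel: "equiv {(s, x). x \<in> D (star s)} (germ_rel D)"
proof (rule equivI)
  show "germ_rel D \<subseteq> {(s, x). x \<in> D (star s)} \<times> {(s, x). x \<in> D (star s)}"
    by (auto simp: germ_rel_def)
  show "refl_on {(s, x). x \<in> D (star s)} (germ_rel D)"
    by (auto simp: refl_on_def germ_rel_def intro: natural_le_refl)
  show "sym (germ_rel D)" by (auto simp: sym_def germ_rel_def)
  show "trans (germ_rel D)"
  proof (rule transI, clarsimp simp: germ_rel_def)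
    fix s t w u v x
    assume u: "natural_le u s" "natural_le u t" "x \<in> D (star u)"
      and v: "natural_le v t" "natural_le v w" "x \<in> D (star v)"
    obtain e f where e: "idempotent e" "u = t * e" and f: "idempotent f" "v = t * f"
      using u v by (auto simp: natural_le_def)
    have x: "x \<in> D e" "x \<in> D f" "x \<in> D (star t)"
      using u(3) v(3) D_mult_idempotent e f by auto
    have "natural_le (u * f) u" "natural_le (v * e) v"
      using e f by (auto simp: natural_le_def)
    moreover have "v * e = u * f" using e f idempotent_commute[OF e(1) f(1)] by (simp add: mult.assoc)
    moreover have "x \<in> D (star (u * f))" using D_mult_idempotent[OF f(1)] u x by auto
    ultimately show "\<exists>u. natural_le u s \<and> natural_le u w \<and> x \<in> D (star u)"
      using natural_le_trans[OF _ u(1)] natural_le_trans[OF _ v(2)] by auto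
  qed
qed

lemma germ_eq_iff:
  assumes "x \<in> D (star s)" "y \<in> D (star t)"
  shows "germ D s x = germ D t y \<longleftrightarrow>
    x = y \<and> (\<exists>u. natural_le u s \<and> natural_le u t \<and> x \<in> D (star u))"
  unfolding germ_def using assms eq_equiv_class_iff[OF equiv_germ_rel, of "(s, x)" "(t, y)"]
  by (auto simp: germ_rel_def)

lemma topspace_germ_groupoid:
  "topspace (arrows (germ_groupoid X D \<theta>)) = {(s, x). x \<in> D (star s)} // germ_rel D"
proof -
  have "topspace (arrows (germ_groupoid X D \<theta>))
      = \<Union>{germ D s ` U | s U. openin X U \<and> U \<subseteq> D (star s)}"
    by (simp add: germ_groupoid_def)
  also have "\<dots> = (\<Union>s. germ D s ` D (star s))"
    using open_D by blast
  finally show ?thesis by (auto simp: quotient_def germ_def)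
qed

lemma src_germ: "x \<in> D (star s) \<Longrightarrow> src (germ_groupoid X D \<theta>) (germ D s x) = x"
  by (auto simp: germ_groupoid_def germ_eq_iff)

lemma rng_germ:
  assumes "x \<in> D (star s)"
  shows "rng (germ_groupoid X D \<theta>) (germ D s x) = \<theta> s x"
proof -
  have "\<theta> t x' = \<theta> s x" if t: "x' \<in> D (star t)" "germ D s x = germ D t x'" for t x'
  proof -
    obtain u where "natural_le u s" "natural_le u t" "x \<in> D (star u)" "x' = x"
      using t(2) germ_eq_iff[OF assms t(1)] by blast
    then show ?thesis using act_natural_le(2)[of u s x] act_natural_le(2)[of u t x] by simp
  qed
  with assms show ?thesis
    unfolding germ_groupoid_def topological_groupoid.simps by (intro the_equality) blast+
qed

lemma comp_germ:
  assumes "x \<in> D (star t)" "\<theta> t x \<in> D (star s)"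
  shows "comp (germ_groupoid X D \<theta>) (germ D s (\<theta> t x)) (germ D t x) = germ D (s * t) x"
proof -
  have "germ D (s' * t') x' = germ D (s * t) x"
    if A: "x' \<in> D (star t')" "\<theta> t' x' \<in> D (star s')"
      and B: "germ D s (\<theta> t x) = germ D s' (\<theta> t' x')" "germ D t x = germ D t' x'"
    for s' t' x'
  proof -
    obtain v where v: "natural_le v t" "natural_le v t'" "x \<in> D (star v)" "x' = x"
      using B(2) germ_eq_iff[OF assms(1) A(1)] by blast
    obtain u where u: "natural_le u s" "natural_le u s'" "\<theta> t x \<in> D (star u)"
      using B(1) germ_eq_iff[OF assms(2) A(2)] by blast
    have "x \<in> D (star (u * v))"
      using u v act_natural_le(2)[OF v(1,3)] by (simp add: dom_mult)
    moreover have "x \<in> D (star (s * t))" "x \<in> D (star (s' * t'))"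
      using A assms v(4) by (simp_all add: dom_mult)
    ultimately show ?thesis
      using natural_le_mult[OF u(1) v(1)] natural_le_mult[OF u(2) v(2)] v(4)
      by (subst germ_eq_iff) auto
  qed
  with assms show ?thesis
    unfolding germ_groupoid_def topological_groupoid.simps by (intro the_equality) blast+
qed

lemma unit_germ:
  assumes "idempotent e" "x \<in> D e"
  shows "unit (germ_groupoid X D \<theta>) x = germ D e x"
proof -
  have "germ D f x = germ D e x" if f: "idempotent f" "x \<in> D f" for f
  proof -
    have "natural_le (e * f) e" "natural_le (e * f) f"
      using assms f idempotent_commute by (auto simp: natural_le_def)
    moreover have "x \<in> D (star (e * f))"
      using D_mult_idempotent[OF f(1)] star_idempotent[OF assms(1)] assms(2) f(2) by auto
    ultimately show ?thesis
      using assms f by (subst germ_eq_iff) (auto simp: star_idempotent)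
  qed
  with assms show ?thesis
    unfolding germ_groupoid_def topological_groupoid.simps by (intro the_equality) blast+
qed

lemma ginv_germ:
  assumes "x \<in> D (star s)"
  shows "ginv (germ_groupoid X D \<theta>) (germ D s x) = germ D (star s) (\<theta> s x)"
proof -
  have "germ D (star t) (\<theta> t x') = germ D (star s) (\<theta> s x)"
    if t: "x' \<in> D (star t)" "germ D s x = germ D t x'" for t x'
  proof -
    obtain u where u: "natural_le u s" "natural_le u t" "x \<in> D (star u)" "x' = x"
      using t(2) germ_eq_iff[OF assms t(1)] by blast
    have \<theta>: "\<theta> s x = \<theta> u x" "\<theta> t x = \<theta> u x"
      using act_natural_le(2)[OF u(1,3)] act_natural_le(2)[OF u(2,3)] by simp_all
    have "\<theta> u x \<in> D u" "\<theta> u x \<in> D s" "\<theta> u x \<in> D t"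
      using bij_betw_apply[OF act_bij u(3)] bij_betw_apply[OF act_bij assms]
        bij_betw_apply[OF act_bij t(1)] u(4) \<theta> by simp_all
    then show ?thesis
      unfolding \<theta> u(4) using natural_le_star[OF u(1)] natural_le_star[OF u(2)]
      by (subst germ_eq_iff) (auto simp: star_star)
  qed
  with assms show ?thesis
    unfolding germ_groupoid_def topological_groupoid.simps by (intro the_equality) blast+
qed

end


section \<open>Sheaves of rings on a groupoid\<close>

definition local_homeomorphism :: "'e topology \<Rightarrow> 'x topology \<Rightarrow> ('e \<Rightarrow> 'x) \<Rightarrow> bool" where
  "local_homeomorphism E X p \<longleftrightarrow>
     (\<forall>e \<in> topspace E. \<exists>U V. openin E U \<and> e \<in> U \<and> openin X V
        \<and> homeomorphic_map (subtopology E U) (subtopology X V) p)"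

record ('g, 'x, 'e) gsheaf =
  total :: "'e topology"
  proj :: "'e \<Rightarrow> 'x"
  act :: "'g \<Rightarrow> 'e \<Rightarrow> 'e"

locale groupoid_sheaf =
  fixes G :: "('g, 'x) topological_groupoid"
    and \<O> :: "('g, 'x, 'e, 'm) gsheaf_scheme"
  assumes proj_local_homeo: "local_homeomorphism (total \<O>) (objs G) (proj \<O>)"
    and act_continuous:
      "continuous_map
         (subtopology (prod_topology (arrows G) (total \<O>)) {(\<gamma>, e). src G \<gamma> = proj \<O> e})
         (total \<O>) (\<lambda>(\<gamma>, e). act \<O> \<gamma> e)"
    and act_unit: "e \<in> topspace (total \<O>) \<Longrightarrow> act \<O> (unit G (proj \<O> e)) e = e"
    and proj_act: "\<lbrakk>\<gamma> \<in> topspace (arrows G); e \<in> topspace (total \<O>); src G \<gamma> = proj \<O> e\<rbrakk>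
      \<Longrightarrow> proj \<O> (act \<O> \<gamma> e) = rng G \<gamma>"
    and act_act: "\<lbrakk>\<beta> \<in> topspace (arrows G); \<gamma> \<in> topspace (arrows G); e \<in> topspace (total \<O>);
        src G \<beta> = rng G \<gamma>; src G \<gamma> = proj \<O> e\<rbrakk>
      \<Longrightarrow> act \<O> \<beta> (act \<O> \<gamma> e) = act \<O> (comp G \<beta> \<gamma>) e"

text \<open>The fiberwise operations are only meaningful for arguments in a common stalk.\<close>
record ('g, 'x, 'e) ring_gsheaf = "('g, 'x, 'e) gsheaf" +
  fadd :: "'e \<Rightarrow> 'e \<Rightarrow> 'e"
  fmult :: "'e \<Rightarrow> 'e \<Rightarrow> 'e"
  fzero :: "'x \<Rightarrow> 'e"
  fone :: "'x \<Rightarrow> 'e"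

definition stalk :: "('g, 'x, 'e, 'm) ring_gsheaf_scheme \<Rightarrow> 'x \<Rightarrow> 'e ring" where
  "stalk \<O> x = \<lparr> carrier = {e \<in> topspace (total \<O>). proj \<O> e = x},
     monoid.mult = fmult \<O>, one = fone \<O> x, zero = fzero \<O> x, add = fadd \<O> \<rparr>"

locale groupoid_sheaf_of_rings = groupoid_sheaf G \<O>
  for G :: "('g, 'x) topological_groupoid"
    and \<O> :: "('g, 'x, 'e, 'm) ring_gsheaf_scheme" +
  assumes stalk_ring: "x \<in> topspace (objs G) \<Longrightarrow> Ring.ring (stalk \<O> x)"
    and fadd_continuous:
      "continuous_map
         (subtopology (prod_topology (total \<O>) (total \<O>)) {(a, b). proj \<O> a = proj \<O> b})
         (total \<O>) (\<lambda>(a, b). fadd \<O> a b)"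
    and fmult_continuous:
      "continuous_map
         (subtopology (prod_topology (total \<O>) (total \<O>)) {(a, b). proj \<O> a = proj \<O> b})
         (total \<O>) (\<lambda>(a, b). fmult \<O> a b)"
    and fone_continuous: "continuous_map (objs G) (total \<O>) (fone \<O>)"
    and act_ring_hom: "\<gamma> \<in> topspace (arrows G)
      \<Longrightarrow> act \<O> \<gamma> \<in> ring_hom (stalk \<O> (src G \<gamma>)) (stalk \<O> (rng G \<gamma>))"

locale groupoid_sheaf_of_fields = groupoid_sheaf_of_rings G \<O>
  for G :: "('g, 'x) topological_groupoid"
    and \<O> :: "('g, 'x, 'e, 'm) ring_gsheaf_scheme" +
  assumes stalk_field: "x \<in> topspace (objs G) \<Longrightarrow> Ring.field (stalk \<O> x)"


section \<open>The convolution ring\<close>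

definition bisection :: "('g, 'x) topological_groupoid \<Rightarrow> 'g set \<Rightarrow> bool" where
  "bisection G U \<longleftrightarrow> U \<subseteq> topspace (arrows G) \<and> inj_on (src G) U \<and> inj_on (rng G) U"

text \<open>
  The sum over all factorizations \<open>\<gamma> = \<beta>\<rho>\<close> is taken over its nonzero terms, which are finitely
  many for the functions considered below (\<^const>\<open>finsum\<close> needs a finite index set).
\<close>
definition convolution ::
  "('g, 'x) topological_groupoid \<Rightarrow> ('g, 'x, 'e, 'm) ring_gsheaf_scheme
     \<Rightarrow> ('g \<Rightarrow> 'e) \<Rightarrow> ('g \<Rightarrow> 'e) \<Rightarrow> 'g \<Rightarrow> 'e" where
  "convolution G \<O> f g = (\<lambda>\<gamma> \<in> topspace (arrows G).
     finsum (stalk \<O> (rng G \<gamma>)) (\<lambda>(\<beta>, \<rho>). fmult \<O> (f \<beta>) (act \<O> \<beta> (g \<rho>)))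
       {(\<beta>, \<rho>). \<beta> \<in> topspace (arrows G) \<and> \<rho> \<in> topspace (arrows G)
          \<and> src G \<beta> = rng G \<rho> \<and> comp G \<beta> \<rho> = \<gamma>
          \<and> fmult \<O> (f \<beta>) (act \<O> \<beta> (g \<rho>)) \<noteq> fzero \<O> (rng G \<gamma>)})"

text \<open>
  All (not necessarily continuous) maps \<open>f\<close> with \<open>proj \<circ> f = rng\<close>.  Only the additive structure
  of this record is meaningful as it stands: convolution is not well behaved on arbitrary maps.
  The \<open>one\<close> field is left unspecified because \<open>\<Gamma>\<^sub>c\<close> is in general a ring without identity.
\<close>
definition range_sections ::
  "('g, 'x) topological_groupoid \<Rightarrow> ('g, 'x, 'e, 'm) ring_gsheaf_scheme \<Rightarrow> ('g \<Rightarrow> 'e) ring" where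
  "range_sections G \<O> =
    \<lparr> carrier = {f \<in> topspace (arrows G) \<rightarrow>\<^sub>E topspace (total \<O>).
                   \<forall>\<gamma> \<in> topspace (arrows G). proj \<O> (f \<gamma>) = rng G \<gamma>},
      monoid.mult = convolution G \<O>,
      one = undefined,
      zero = (\<lambda>\<gamma> \<in> topspace (arrows G). fzero \<O> (rng G \<gamma>)),
      add = (\<lambda>f g. \<lambda>\<gamma> \<in> topspace (arrows G). fadd \<O> (f \<gamma>) (g \<gamma>)) \<rparr>"

definition bisection_sections ::
  "('g, 'x) topological_groupoid \<Rightarrow> ('g, 'x, 'e, 'm) ring_gsheaf_scheme \<Rightarrow> ('g \<Rightarrow> 'e) set" where
  "bisection_sections G \<O> = {f \<in> carrier (range_sections G \<O>).
     \<exists>U. compact_open_in (arrows G) U \<and> bisection G U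
       \<and> continuous_map (subtopology (arrows G) U) (total \<O>) f
       \<and> (\<forall>\<gamma> \<in> topspace (arrows G) - U. f \<gamma> = fzero \<O> (rng G \<gamma>))}"

definition Gamma_c ::
  "('g, 'x) topological_groupoid \<Rightarrow> ('g, 'x, 'e, 'm) ring_gsheaf_scheme \<Rightarrow> ('g \<Rightarrow> 'e) ring" where
  "Gamma_c G \<O> = (range_sections G \<O>)
     \<lparr> carrier := generate (add_monoid (range_sections G \<O>)) (bisection_sections G \<O>) \<rparr>"


section \<open>Simple rings without identity\<close>

text \<open>
  The library's \<open>ideal\<close> presupposes an identity element, which \<^const>\<open>Gamma_c\<close> has only over a
  compact unit space.  The zero ring counts as simple.
\<close>
definition two_sided_ideal :: "'a set \<Rightarrow> ('a, 'm) ring_scheme \<Rightarrow> bool" where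
  "two_sided_ideal I R \<longleftrightarrow> additive_subgroup I R
     \<and> (\<forall>a \<in> I. \<forall>r \<in> carrier R. r \<otimes>\<^bsub>R\<^esub> a \<in> I \<and> a \<otimes>\<^bsub>R\<^esub> r \<in> I)"

definition simple_ring :: "('a, 'm) ring_scheme \<Rightarrow> bool" where
  "simple_ring R \<longleftrightarrow> (\<forall>I. two_sided_ideal I R \<longrightarrow> I = {\<zero>\<^bsub>R\<^esub>} \<or> I = carrier R)"

end

theory Submission
  imports Defs
begin

text \<open>
  \<open>\<Gamma>\<^sub>c\<close> is spanned by sections supported on a single set of germs \<open>[s, x]\<close>, \<open>x \<in> K\<close>, with \<open>K\<close> compact
  open, and the product of two of these is again of this form.  An open invariant set \<open>U\<close> gives the
  ideal of sections vanishing off the germs with range in \<open>U\<close>, which is proper and nonzero if \<open>U\<close> is.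
  Conversely, a nonzero ideal contains a section that is nonzero at a unit.  As the groupoid is
  Hausdorff, its restriction to the units is continuous, hence invertible nearby.  By topological
  freeness the section vanishes off the units over some smaller open set; cutting down to that set and
  inverting gives an element \<open>1\<^sub>K\<close> of the ideal with \<open>K \<noteq> {}\<close>.  The union of all such \<open>K\<close> is open and
  invariant, so by minimality it is \<open>X\<close>, and then every spanning section lies in the ideal.
\<close>

section \<open>The groupoid of germs\<close>

text \<open>The ring has no identity in general, so the sections
  \<open>germ_section e K (fone \<O>)\<close>, \<open>e\<close> idempotent, serve as local units: on
  the left they cut a section down by range, on the right by source. An element of the ring is only
  a finite sum of sections over bisections, whose supports may overlap and cancel. Statements about
  it are therefore put in a form that passes to negatives and sums, and \<open>Gamma_induct\<close>
  reduces them to one \<open>s\<close> and one compact open \<open>K\<close>. Continuity that the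
  axioms do not grant directly (zero, negatives, inverses in the stalks) always comes from one
  principle: two lifts through a local homeomorphism that agree at a point agree nearby. It turns an
  identity at one point, such as ba = 1 in a stalk, into an identity of local sections. The points
  \<open>x\<close> of \<open>K\<close> at which [s, x] is a unit form an open set; Hausdorffness of
  the arrows makes it closed as well, and only then is the restriction of a generator to the units
  continuous. The open set supplied by topological freeness may miss the point where the section was
  found to be nonzero, so invertibility has to be secured on a whole neighbourhood
  beforehand.\<close>

context inverse_semigroup_action
begin

section \<open>Algebraic structure of the groupoid of germs\<close>

abbreviation germs ("\<G>") where "\<G> \<equiv> germ_groupoid X D \<theta>"
abbreviation arrow_set ("\<A>") where "\<A> \<equiv> topspace (arrows \<G>)"

lemma objs_germs [simp]: "objs \<G> = X"
  by (simp add: germ_groupoid_def)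

lemma germ_in_arrows [simp]: "x \<in> D (star s) \<Longrightarrow> germ D s x \<in> \<A>"
  unfolding topspace_germ_groupoid quotient_def germ_def by auto

lemma arrowE:
  assumes "\<gamma> \<in> \<A>"
  obtains s x where "x \<in> D (star s)" "\<gamma> = germ D s x"
  using assms unfolding topspace_germ_groupoid quotient_def germ_def by auto

lemma act_in_D: "x \<in> D (star s) \<Longrightarrow> \<theta> s x \<in> D s"
  using act_bij[of s] by (auto simp: bij_betw_def)

lemma D_mult_star: "D (s * star s) = D s"
proof -
  have "D (star (s * star s)) = {x \<in> D s. \<theta> (star s) x \<in> D (star s)}"
    using dom_mult[of s "star s"] by (simp add: star_star)
  then show ?thesis
    using act_in_D[of _ "star s"] star_idempotent[OF idempotent_mult_star[of s]]
    by (auto simp: star_star)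
qed

lemma D_star_mult: "D (star s * s) = D (star s)"
  using D_mult_star[of "star s"] by (simp add: star_star)

lemma act_star_act [simp]: "x \<in> D (star s) \<Longrightarrow> \<theta> (star s) (\<theta> s x) = x"
  using act_mult[of x "star s" s] act_idempotent[OF idempotent_star_mult[of s], of x]
    star_idempotent[OF idempotent_star_mult[of s]] D_star_mult by simp

lemma act_act_star [simp]: "x \<in> D s \<Longrightarrow> \<theta> s (\<theta> (star s) x) = x"
  using act_star_act[of x "star s"] by (simp add: star_star)

text \<open>The covering axiom only places \<open>x\<close> in some X_s. Since s s* is idempotent
  with the same domain X_s (\<open>D_mult_star\<close>), it can be taken as \<open>e\<close>. Units
  of the groupoid are specified through idempotents, so all facts about \<open>unit\<close> start
  here.\<close>

lemma exists_idempotent: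
  assumes "x \<in> topspace X"
  obtains e where "idempotent e" "x \<in> D e"
  using assms covers D_mult_star idempotent_mult_star by (metis UN_iff)

lemma src_in [simp]: "\<gamma> \<in> \<A> \<Longrightarrow> src \<G> \<gamma> \<in> topspace X"
  by (elim arrowE) (use D_subset in \<open>auto simp: src_germ\<close>)

lemma rng_in [simp]: "\<gamma> \<in> \<A> \<Longrightarrow> rng \<G> \<gamma> \<in> topspace X"
  by (elim arrowE) (use D_subset act_in_D in \<open>auto simp: rng_germ\<close>)

lemma unit_closed [simp]: "x \<in> topspace X \<Longrightarrow> unit \<G> x \<in> \<A>"
  by (erule exists_idempotent) (auto simp: unit_germ star_idempotent)

lemma src_unit [simp]: "x \<in> topspace X \<Longrightarrow> src \<G> (unit \<G> x) = x"
  by (erule exists_idempotent) (auto simp: unit_germ src_germ star_idempotent)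

lemma rng_unit [simp]: "x \<in> topspace X \<Longrightarrow> rng \<G> (unit \<G> x) = x"
  by (erule exists_idempotent) (auto simp: unit_germ rng_germ star_idempotent act_idempotent)

text \<open>The source of a germ is part of its data, so matching source and range forces the two
  representatives to meet at the same point; this is exactly the shape that \<open>comp_germ\<close>
  can evaluate.\<close>

lemma composableE:
  assumes "\<beta> \<in> \<A>" "\<rho> \<in> \<A>" "src \<G> \<beta> = rng \<G> \<rho>"
  obtains s t x where "x \<in> D (star t)" "\<theta> t x \<in> D (star s)"
    "\<beta> = germ D s (\<theta> t x)" "\<rho> = germ D t x"
proof -
  obtain t x where t: "x \<in> D (star t)" "\<rho> = germ D t x" using assms(2) by (elim arrowE)
  obtain s y where s: "y \<in> D (star s)" "\<beta> = germ D s y" using assms(1) by (elim arrowE)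
  have "y = \<theta> t x" using assms(3) s t by (simp add: src_germ rng_germ)
  then show thesis using s t that by blast
qed

lemma comp_closed [simp]:
  assumes "\<beta> \<in> \<A>" "\<rho> \<in> \<A>" "src \<G> \<beta> = rng \<G> \<rho>"
  shows "comp \<G> \<beta> \<rho> \<in> \<A>"
  by (rule composableE[OF assms]) (simp add: comp_germ dom_mult)

lemma src_comp [simp]:
  assumes "\<beta> \<in> \<A>" "\<rho> \<in> \<A>" "src \<G> \<beta> = rng \<G> \<rho>"
  shows "src \<G> (comp \<G> \<beta> \<rho>) = src \<G> \<rho>"
  by (rule composableE[OF assms]) (simp add: comp_germ dom_mult src_germ)

lemma rng_comp [simp]:
  assumes "\<beta> \<in> \<A>" "\<rho> \<in> \<A>" "src \<G> \<beta> = rng \<G> \<rho>"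
  shows "rng \<G> (comp \<G> \<beta> \<rho>) = rng \<G> \<beta>"
  by (rule composableE[OF assms]) (simp add: comp_germ dom_mult rng_germ act_mult)

lemma comp_assoc:
  assumes "\<beta> \<in> \<A>" "\<gamma> \<in> \<A>" "\<rho> \<in> \<A>" "src \<G> \<beta> = rng \<G> \<gamma>" "src \<G> \<gamma> = rng \<G> \<rho>"
  shows "comp \<G> (comp \<G> \<beta> \<gamma>) \<rho> = comp \<G> \<beta> (comp \<G> \<gamma> \<rho>)"
proof -
  obtain u x where u: "x \<in> D (star u)" "\<rho> = germ D u x"
    using assms(3) by (elim arrowE)
  obtain t where t: "\<theta> u x \<in> D (star t)" "\<gamma> = germ D t (\<theta> u x)"
    using assms(2,5) u by (elim arrowE) (auto simp: src_germ rng_germ)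
  obtain s where s: "\<theta> t (\<theta> u x) \<in> D (star s)" "\<beta> = germ D s (\<theta> t (\<theta> u x))"
    using assms(1,4) u t by (elim arrowE) (auto simp: src_germ rng_germ)
  have tu: "x \<in> D (star (t * u))" "\<theta> (t * u) x = \<theta> t (\<theta> u x)"
    using u t by (simp_all add: dom_mult act_mult)
  show ?thesis
    using u t s tu comp_germ[of x "t * u" s] comp_germ[of x u "s * t"]
    by (simp add: comp_germ dom_mult mult.assoc)
qed

lemma ginv_closed [simp]: "\<gamma> \<in> \<A> \<Longrightarrow> ginv \<G> \<gamma> \<in> \<A>"
  by (elim arrowE) (simp add: ginv_germ act_in_D star_star)

lemma src_ginv [simp]: "\<gamma> \<in> \<A> \<Longrightarrow> src \<G> (ginv \<G> \<gamma>) = rng \<G> \<gamma>"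
  by (elim arrowE) (simp add: ginv_germ act_in_D star_star src_germ rng_germ)

lemma rng_ginv [simp]: "\<gamma> \<in> \<A> \<Longrightarrow> rng \<G> (ginv \<G> \<gamma>) = src \<G> \<gamma>"
  by (elim arrowE) (simp add: ginv_germ act_in_D star_star src_germ rng_germ)

lemma comp_ginv_left [simp]: "\<gamma> \<in> \<A> \<Longrightarrow> comp \<G> (ginv \<G> \<gamma>) \<gamma> = unit \<G> (src \<G> \<gamma>)"
proof (elim arrowE)
  fix s x assume "x \<in> D (star s)" "\<gamma> = germ D s x"
  then show ?thesis
    by (simp add: ginv_germ comp_germ act_in_D star_star src_germ
      unit_germ[OF idempotent_star_mult[of s]] D_star_mult)
qed

lemma comp_ginv_right [simp]:
  assumes "\<gamma> \<in> \<A>" shows "comp \<G> \<gamma> (ginv \<G> \<gamma>) = unit \<G> (rng \<G> \<gamma>)"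
proof -
  obtain s x where s: "x \<in> D (star s)" "\<gamma> = germ D s x"
    using assms by (elim arrowE)
  then show ?thesis
    using comp_germ[of "\<theta> s x" "star s" s]
    by (simp add: ginv_germ act_in_D star_star rng_germ
      unit_germ[OF idempotent_mult_star[of s]] D_mult_star)
qed

lemma comp_unit_left [simp]:
  assumes "\<gamma> \<in> \<A>" shows "comp \<G> (unit \<G> (rng \<G> \<gamma>)) \<gamma> = \<gamma>"
proof -
  obtain s x where s: "x \<in> D (star s)" "\<gamma> = germ D s x"
    using assms by (elim arrowE)
  then show ?thesis
    by (simp add: rng_germ unit_germ[OF idempotent_mult_star[of s]] act_in_D D_mult_star
      comp_germ star_idempotent[OF idempotent_mult_star] star_left)
qed

lemma comp_unit_right [simp]:
  assumes "\<gamma> \<in> \<A>" shows "comp \<G> \<gamma> (unit \<G> (src \<G> \<gamma>)) = \<gamma>"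
proof -
  obtain s x where s: "x \<in> D (star s)" "\<gamma> = germ D s x"
    using assms by (elim arrowE)
  then show ?thesis
    using comp_germ[of x "star s * s" s] act_idempotent[OF idempotent_star_mult[of s], of x]
    by (simp add: src_germ unit_germ[OF idempotent_star_mult[of s]] D_star_mult
      star_idempotent[OF idempotent_star_mult] star_left flip: mult.assoc)
qed

text \<open>Cancellation by the inverse of \<beta>. It shows that a factorization of \<gamma> is
  determined by its left factor, which may be any arrow with the range of \<gamma>; the convolution
  sum can thus be indexed by a range fibre.\<close>

lemma left_factor_iff:
  assumes "\<beta> \<in> \<A>" "\<gamma> \<in> \<A>" "rng \<G> \<beta> = rng \<G> \<gamma>"
  shows "\<rho> \<in> \<A> \<and> src \<G> \<beta> = rng \<G> \<rho> \<and> comp \<G> \<beta> \<rho> = \<gamma> \<longleftrightarrow> \<rho> = comp \<G> (ginv \<G> \<beta>) \<gamma>"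
proof
  assume A: "\<rho> \<in> \<A> \<and> src \<G> \<beta> = rng \<G> \<rho> \<and> comp \<G> \<beta> \<rho> = \<gamma>"
  then have "comp \<G> (ginv \<G> \<beta>) (comp \<G> \<beta> \<rho>) = \<rho>"
    using assms(1) by (subst comp_assoc[symmetric]) simp_all
  with A show "\<rho> = comp \<G> (ginv \<G> \<beta>) \<gamma>" by simp
next
  assume "\<rho> = comp \<G> (ginv \<G> \<beta>) \<gamma>"
  then show "\<rho> \<in> \<A> \<and> src \<G> \<beta> = rng \<G> \<rho> \<and> comp \<G> \<beta> \<rho> = \<gamma>"
    using assms by (simp flip: comp_assoc)
qed

text \<open>Anything below an idempotent is idempotent, so a common lower bound of \<open>s\<close>
  and an idempotent is the required \<open>e\<close>. The right-hand side is the condition in the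
  definition of topological freeness, which thereby becomes a statement about units of the
  groupoid.\<close>

lemma germ_eq_unit_iff:
  assumes "x \<in> D (star s)"
  shows "germ D s x = unit \<G> x \<longleftrightarrow> (\<exists>e. idempotent e \<and> natural_le e s \<and> x \<in> D e)"
proof
  assume A: "germ D s x = unit \<G> x"
  obtain f where f: "idempotent f" "x \<in> D f"
    using assms D_subset exists_idempotent by blast
  then obtain u where u: "natural_le u s" "natural_le u f" "x \<in> D (star u)"
    using A assms by (auto simp: unit_germ germ_eq_iff star_idempotent)
  then have "idempotent u"
    using f idempotent_mult by (auto simp: natural_le_def)
  then show "\<exists>e. idempotent e \<and> natural_le e s \<and> x \<in> D e"
    using u star_idempotent by metis
next
  assume "\<exists>e. idempotent e \<and> natural_le e s \<and> x \<in> D e"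
  then obtain e where e: "idempotent e" "natural_le e s" "x \<in> D (star e)"
    by (auto simp: star_idempotent)
  then have "germ D s x = germ D e x"
    using natural_le_refl unfolding germ_eq_iff[OF assms e(3)] by blast
  then show "germ D s x = unit \<G> x"
    using e by (simp add: unit_germ star_idempotent)
qed

section \<open>Topology of the arrows and of the partial homeomorphisms\<close>

lemma openin_germ_image:
  "openin X U \<Longrightarrow> U \<subseteq> D (star s) \<Longrightarrow> openin (arrows \<G>) (germ D s ` U)"
  unfolding germ_groupoid_def by (auto intro!: topology_generated_by_Basis)

text \<open>Two germs [s, x] and [t, x] agree exactly when \<open>x\<close> lies in the domain of
  some common lower bound \<open>u\<close>, and each such domain is open; hence preimages of the
  generating sets are open. With \<open>openin_germ_image\<close> this makes the map from
  \<open>x\<close> to [s, x] an open embedding, inverted by \<open>src\<close>.\<close>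

lemma continuous_germ: "continuous_map (subtopology X (D (star s))) (arrows \<G>) (germ D s)"
  unfolding germ_groupoid_def topological_groupoid.simps
proof (rule continuous_on_generated_topo)
  fix C assume "C \<in> {germ D s ` U |s U. openin X U \<and> U \<subseteq> D (star s)}"
  then obtain t V where V: "C = germ D t ` V" "openin X V" "V \<subseteq> D (star t)" by auto
  have "germ D s -` C \<inter> topspace (subtopology X (D (star s)))
      = (\<Union>u \<in> {u. natural_le u s \<and> natural_le u t}. V \<inter> D (star u))"
  proof (intro equalityI subsetI)
    fix x assume "x \<in> germ D s -` C \<inter> topspace (subtopology X (D (star s)))"
    then obtain y where x: "x \<in> D (star s)" and y: "y \<in> V" "germ D s x = germ D t y"
      using V(1) by auto
    then show "x \<in> (\<Union>u \<in> {u. natural_le u s \<and> natural_le u t}. V \<inter> D (star u))"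
      using germ_eq_iff[OF x, of y t] V(3) by auto
  next
    fix x assume "x \<in> (\<Union>u \<in> {u. natural_le u s \<and> natural_le u t}. V \<inter> D (star u))"
    then obtain u where u: "natural_le u s" "natural_le u t" "x \<in> V" "x \<in> D (star u)" by blast
    then have x: "x \<in> D (star s)" "x \<in> D (star t)" using act_natural_le(1) by blast+
    then have "germ D s x = germ D t x" using u by (auto simp: germ_eq_iff)
    then show "x \<in> germ D s -` C \<inter> topspace (subtopology X (D (star s)))"
      using x(1) u(3) V(1) D_subset by auto
  qed
  moreover have "openin X \<dots>" using V open_D by blast
  ultimately have "openin X (germ D s -` C \<inter> topspace (subtopology X (D (star s))))" by simp
  then show "openin (subtopology X (D (star s)))
      (germ D s -` C \<inter> topspace (subtopology X (D (star s))))"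
    by (simp add: openin_open_subtopology open_D le_infI2)
next
  show "germ D s ` topspace (subtopology X (D (star s)))
      \<subseteq> \<Union> {germ D s ` U |s U. openin X U \<and> U \<subseteq> D (star s)}"
    using open_D[of "star s"] by auto
qed

lemma openin_germ_vimage:
  assumes "openin (arrows \<G>) C" shows "openin X {x \<in> D (star s). germ D s x \<in> C}"
proof -
  have "topspace (subtopology X (D (star s))) = D (star s)" using D_subset by auto
  then show ?thesis
    using openin_continuous_map_preimage[OF continuous_germ assms, of s]
    by (simp add: openin_open_subtopology open_D)
qed

lemma continuous_src: "continuous_map (arrows \<G>) X (src \<G>)"
proof (subst continuous_map_def, intro conjI allI impI)
  show "src \<G> \<in> \<A> \<rightarrow> topspace X" by simp
  fix U assume U: "openin X U"
  have "{\<gamma> \<in> \<A>. src \<G> \<gamma> \<in> U} = (\<Union>s. germ D s ` (U \<inter> D (star s)))"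
  proof (intro equalityI subsetI)
    fix \<gamma> assume "\<gamma> \<in> {\<gamma> \<in> \<A>. src \<G> \<gamma> \<in> U}"
    then obtain s x where "x \<in> D (star s)" "\<gamma> = germ D s x" "x \<in> U"
      by (auto simp: src_germ elim!: arrowE)
    then show "\<gamma> \<in> (\<Union>s. germ D s ` (U \<inter> D (star s)))" by blast
  qed (auto simp: src_germ)
  moreover have "openin (arrows \<G>) \<dots>"
    using U open_D openin_germ_image by blast
  ultimately show "openin (arrows \<G>) {\<gamma> \<in> \<A>. src \<G> \<gamma> \<in> U}" by simp
qed

text \<open>On X_e with \<open>e\<close> idempotent the unit map is the map from \<open>x\<close> to
  [e, x], and these open sets cover the space.\<close>

lemma continuous_unit: "continuous_map X (arrows \<G>) (unit \<G>)"
proof (subst continuous_map_def, intro conjI allI impI)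
  show "unit \<G> \<in> topspace X \<rightarrow> \<A>" by simp
  fix U assume U: "openin (arrows \<G>) U"
  have "x \<in> topspace X" if "x \<in> D e" for x e using D_subset that by blast
  then have "{x \<in> topspace X. unit \<G> x \<in> U}
      = (\<Union>e \<in> {e. idempotent e}. {x \<in> D (star e). germ D e x \<in> U})"
    by (auto simp: star_idempotent unit_germ elim!: exists_idempotent)
  moreover have "openin X \<dots>"
    using U openin_germ_vimage by blast
  ultimately show "openin X {x \<in> topspace X. unit \<G> x \<in> U}" by simp
qed

lemma continuous_act: "continuous_map (subtopology X (D (star s))) X (\<theta> s)"
  using homeomorphic_imp_continuous_map[OF homeo[of s]] continuous_map_into_fulltopology by blast

lemma openin_act_vimage:
  assumes "openin X U" shows "openin X {x \<in> D (star s). \<theta> s x \<in> U}"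
proof -
  have "topspace (subtopology X (D (star s))) = D (star s)" using D_subset by auto
  then show ?thesis
    using openin_continuous_map_preimage[OF continuous_act assms, of s]
    by (simp add: openin_open_subtopology open_D)
qed

text \<open>Turns an image under \<theta>_s into a preimage under the inverse partial map, so that
  openness of images follows from continuity.\<close>

lemma act_image_eq:
  assumes "K \<subseteq> D (star s)" shows "\<theta> s ` K = {x \<in> D s. \<theta> (star s) x \<in> K}"
proof (intro equalityI subsetI)
  fix x assume "x \<in> {x \<in> D s. \<theta> (star s) x \<in> K}"
  then show "x \<in> \<theta> s ` K" by (intro image_eqI[of _ _ "\<theta> (star s) x"]) simp_all
qed (use assms act_in_D in \<open>auto simp: subset_iff\<close>)

lemma openin_act_image: "openin X K \<Longrightarrow> K \<subseteq> D (star s) \<Longrightarrow> openin X (\<theta> s ` K)"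
  using openin_act_vimage[of K "star s"] by (simp add: act_image_eq star_star)

lemma compactin_act_image:
  assumes "compactin X K" "K \<subseteq> D (star s)" shows "compactin X (\<theta> s ` K)"
  using assms image_compactin[OF _ continuous_act, of s K] by (simp add: compactin_subtopology)

lemma compactin_germ_image:
  assumes "compactin X K" "K \<subseteq> D (star s)" shows "compactin (arrows \<G>) (germ D s ` K)"
  using assms image_compactin[OF _ continuous_germ, of s K] by (simp add: compactin_subtopology)

lemma src_image_germ:
  assumes "K \<subseteq> D (star s)" shows "src \<G> ` germ D s ` K = K"
proof -
  have "src \<G> ` germ D s ` K = (\<lambda>x. x) ` K"
    unfolding image_image by (rule image_cong) (use assms src_germ in auto)
  then show ?thesis by simp
qed

end

section \<open>Compact open sets and local homeomorphisms\<close>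

lemma compact_open_in_Hausdorff:
  "Hausdorff_space Y \<Longrightarrow> compact_open_in Y K \<longleftrightarrow> openin Y K \<and> compactin Y K"
  by (auto simp: compact_open_in_def Hausdorff_space_subtopology)

lemma compact_open_in_Int:
  "Hausdorff_space Y \<Longrightarrow> compact_open_in Y K \<Longrightarrow> compact_open_in Y L \<Longrightarrow> compact_open_in Y (K \<inter> L)"
  by (auto simp: compact_open_in_Hausdorff compactin_Int)

lemma compact_open_in_diff:
  assumes "Hausdorff_space Y" "compact_open_in Y K" "compact_open_in Y L"
  shows "compact_open_in Y (K - L)"
proof -
  have "closedin Y L" using assms compactin_imp_closedin by (auto simp: compact_open_in_Hausdorff)
  moreover have "K - L = K \<inter> (topspace Y - L)"
    using assms openin_subset by (fastforce simp: compact_open_in_def)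
  ultimately show ?thesis
    using assms by (auto simp: compact_open_in_Hausdorff openin_diff
      intro!: compact_Int_closedin)
qed

text \<open>Compactness gives a finite cover by the sets \<open>N x\<close>, and in a Hausdorff
  space differences of compact open sets are compact open, so the cover can be made disjoint. The
  hypothesis \<open>local\<close> quantifies over all compact open subsets \<open>C\<close> of
  \<open>N\<close> because the disjoint pieces are not known in advance.\<close>

lemma compact_open_in_induct [consumes 2, case_names empty disjoint_union local]:
  assumes Y: "Hausdorff_space Y" and K: "compact_open_in Y K"
    and empty: "P {}"
    and disj: "\<And>A B. \<lbrakk>compact_open_in Y A; compact_open_in Y B; A \<subseteq> K; B \<subseteq> K; A \<inter> B = {}; P A; P B\<rbrakk>
      \<Longrightarrow> P (A \<union> B)"
    and local: "\<And>x. x \<in> K \<Longrightarrow> \<exists>N. compact_open_in Y N \<and> x \<in> N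
      \<and> (\<forall>C. compact_open_in Y C \<longrightarrow> C \<subseteq> N \<longrightarrow> C \<subseteq> K \<longrightarrow> P C)"
  shows "P K"
proof -
  obtain N where N: "\<And>x. x \<in> K \<Longrightarrow> compact_open_in Y (N x)" "\<And>x. x \<in> K \<Longrightarrow> x \<in> N x"
    "\<And>x C. x \<in> K \<Longrightarrow> compact_open_in Y C \<Longrightarrow> C \<subseteq> N x \<Longrightarrow> C \<subseteq> K \<Longrightarrow> P C"
    using local by metis
  have "compactin Y K" "\<And>U. U \<in> N ` K \<Longrightarrow> openin Y U" "K \<subseteq> \<Union>(N ` K)"
    using K N by (auto simp: compact_open_in_def)
  then obtain \<F> where F: "finite \<F>" "\<F> \<subseteq> N ` K" "K \<subseteq> \<Union>\<F>"
    by (meson compactinD)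
  \<comment> \<open>Strengthened from \<open>K\<close> to all compact open subsets: splitting off a
    member \<open>M\<close> of the cover leaves \<open>C - M\<close>, to which the induction
    hypothesis must apply.\<close>
  have "\<forall>C. compact_open_in Y C \<longrightarrow> C \<subseteq> \<Union>\<F> \<longrightarrow> C \<subseteq> K \<longrightarrow> P C" using F(1,2)
  proof (induction \<F> rule: finite_induct)
    case empty
    then show ?case using assms(3) by auto
  next
    case (insert M \<F>)
    then obtain x where x: "x \<in> K" "M = N x" by auto
    show ?case
    proof (intro allI impI)
      fix C assume C: "compact_open_in Y C" "C \<subseteq> \<Union>(insert M \<F>)" "C \<subseteq> K"
      have M: "compact_open_in Y M" using N x by simp
      have 1: "compact_open_in Y (C \<inter> M)" "compact_open_in Y (C - M)"
        using C M Y compact_open_in_Int compact_open_in_diff by blast+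
      have "P (C \<inter> M)" by (rule N(3)[OF x(1) 1(1)]) (use x C in auto)
      moreover have "C - M \<subseteq> \<Union>\<F>" "C - M \<subseteq> K" using C by auto
      then have "P (C - M)" using insert.IH insert.prems 1(2) by simp
      ultimately have "P ((C \<inter> M) \<union> (C - M))" using 1 C by (intro disj) auto
      then show "P C" by (simp add: Int_Diff_Un)
    qed
  qed
  then show ?thesis using K F(3) by blast
qed

section \<open>Lifts through a local homeomorphism\<close>

text \<open>Near \<open>x\<close> both lifts stay in one open set on which \<open>p\<close> is
  injective. This is the spreading principle behind zero sections, negatives and inverses.\<close>

lemma local_homeomorphism_agree:
  assumes p: "local_homeomorphism E X p"
    and \<sigma>: "continuous_map Y E \<sigma>" and \<tau>: "continuous_map Y E \<tau>"
    and eq: "\<And>y. y \<in> topspace Y \<Longrightarrow> p (\<sigma> y) = p (\<tau> y)"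
    and x: "x \<in> topspace Y" "\<sigma> x = \<tau> x"
  obtains N where "openin Y N" "x \<in> N" "\<And>y. y \<in> N \<Longrightarrow> \<sigma> y = \<tau> y"
proof -
  have "\<sigma> x \<in> topspace E" using \<sigma> x continuous_map_image_subset_topspace by blast
  then obtain U V where U: "openin E U" "\<sigma> x \<in> U"
    "homeomorphic_map (subtopology E U) (subtopology X V) p"
    using p unfolding local_homeomorphism_def by blast
  have inj: "inj_on p U"
    using homeomorphic_imp_injective_map[OF U(3)] openin_subset[OF U(1)]
    by (simp add: Int_absorb1)
  show thesis
  proof (rule that)
    show "openin Y ({y \<in> topspace Y. \<sigma> y \<in> U} \<inter> {y \<in> topspace Y. \<tau> y \<in> U})"
      using U(1) \<sigma> \<tau> by (auto intro: openin_continuous_map_preimage)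
    show "x \<in> {y \<in> topspace Y. \<sigma> y \<in> U} \<inter> {y \<in> topspace Y. \<tau> y \<in> U}"
      using U(2) x by auto
    fix y assume "y \<in> {y \<in> topspace Y. \<sigma> y \<in> U} \<inter> {y \<in> topspace Y. \<tau> y \<in> U}"
    then show "\<sigma> y = \<tau> y" using inj_onD[OF inj] eq by auto
  qed
qed

lemma local_homeomorphism_section:
  assumes p: "local_homeomorphism E X p" and e: "e \<in> topspace E"
  obtains V \<sigma> where "openin X V" "p e \<in> V" "continuous_map (subtopology X V) E \<sigma>"
    "\<And>y. y \<in> V \<Longrightarrow> p (\<sigma> y) = y" "\<sigma> (p e) = e"
proof -
  obtain U V where U: "openin E U" "e \<in> U" "openin X V"
    "homeomorphic_map (subtopology E U) (subtopology X V) p"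
    using p e unfolding local_homeomorphism_def by blast
  then obtain \<sigma> where s: "homeomorphic_maps (subtopology E U) (subtopology X V) p \<sigma>"
    using homeomorphic_map_maps by blast
  have ts: "topspace (subtopology E U) = U" "topspace (subtopology X V) = V"
    using U openin_subset by (auto simp: Int_absorb1)
  have p: "p e \<in> V" using s U(2) ts unfolding homeomorphic_maps_def continuous_map_def by auto
  show thesis
    by (rule that[OF U(3) p, of \<sigma>])
      (use s ts U(2) in \<open>auto simp: homeomorphic_maps_def continuous_map_in_subtopology\<close>)
qed

section \<open>Sheaves of rings over the groupoid of germs\<close>

locale germ_sheaf = inverse_semigroup_action X D \<theta> + groupoid_sheaf_of_rings "germ_groupoid X D \<theta>" \<O>
  for X :: "'x topology"
    and D :: "'s::inverse_semigroup \<Rightarrow> 'x set"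
    and \<theta> :: "'s \<Rightarrow> 'x \<Rightarrow> 'x"
    and \<O> :: "(('s \<times> 'x) set, 'x, 'e, 'm) ring_gsheaf_scheme" +
  assumes Hausdorff_X: "Hausdorff_space X"
    and zero_dim: "zero_dimensional X"
    and Hausdorff_arrows: "Hausdorff_space (arrows \<G>)"
begin

abbreviation stalk_carrier ("\<S>") where "\<S> x \<equiv> carrier (stalk \<O> x)"

lemma in_stalk: "e \<in> \<S> x \<longleftrightarrow> e \<in> topspace (total \<O>) \<and> proj \<O> e = x"
  by (simp add: stalk_def)

lemma stalk_simps:
  "mult (stalk \<O> x) = fmult \<O>" "one (stalk \<O> x) = fone \<O> x"
  "zero (stalk \<O> x) = fzero \<O> x" "add (stalk \<O> x) = fadd \<O>"
  by (simp_all add: stalk_def)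

lemmas ring_stalk = stalk_ring[unfolded objs_germs]

lemma fone_closed [simp]: "x \<in> topspace X \<Longrightarrow> fone \<O> x \<in> \<S> x"
  and fzero_closed [simp]: "x \<in> topspace X \<Longrightarrow> fzero \<O> x \<in> \<S> x"
  and fadd_closed [simp]: "x \<in> topspace X \<Longrightarrow> a \<in> \<S> x \<Longrightarrow> b \<in> \<S> x \<Longrightarrow> fadd \<O> a b \<in> \<S> x"
  and fmult_closed [simp]: "x \<in> topspace X \<Longrightarrow> a \<in> \<S> x \<Longrightarrow> b \<in> \<S> x \<Longrightarrow> fmult \<O> a b \<in> \<S> x"
  and fmult_fone_left [simp]: "x \<in> topspace X \<Longrightarrow> a \<in> \<S> x \<Longrightarrow> fmult \<O> (fone \<O> x) a = a"
  and fmult_fone_right [simp]: "x \<in> topspace X \<Longrightarrow> a \<in> \<S> x \<Longrightarrow> fmult \<O> a (fone \<O> x) = a"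
  and fmult_fzero_left [simp]: "x \<in> topspace X \<Longrightarrow> a \<in> \<S> x \<Longrightarrow> fmult \<O> (fzero \<O> x) a = fzero \<O> x"
  and fmult_fzero_right [simp]: "x \<in> topspace X \<Longrightarrow> a \<in> \<S> x \<Longrightarrow> fmult \<O> a (fzero \<O> x) = fzero \<O> x"
  and fadd_fzero_left [simp]: "x \<in> topspace X \<Longrightarrow> a \<in> \<S> x \<Longrightarrow> fadd \<O> (fzero \<O> x) a = a"
  and fadd_fzero_right [simp]: "x \<in> topspace X \<Longrightarrow> a \<in> \<S> x \<Longrightarrow> fadd \<O> a (fzero \<O> x) = a"
proof -
  assume x: "x \<in> topspace X"
  interpret ring "stalk \<O> x" using ring_stalk x .
  show "fone \<O> x \<in> \<S> x" "fzero \<O> x \<in> \<S> x"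
    using one_closed zero_closed by (simp_all add: stalk_simps)
  assume a: "a \<in> \<S> x"
  show "fmult \<O> (fone \<O> x) a = a" "fmult \<O> a (fone \<O> x) = a"
    "fmult \<O> (fzero \<O> x) a = fzero \<O> x" "fmult \<O> a (fzero \<O> x) = fzero \<O> x"
    "fadd \<O> (fzero \<O> x) a = a" "fadd \<O> a (fzero \<O> x) = a"
    using l_one[OF a] r_one[OF a] l_null[OF a] r_null[OF a] l_zero[OF a] r_zero[OF a]
    by (simp_all add: stalk_simps)
  assume b: "b \<in> \<S> x"
  show "fadd \<O> a b \<in> \<S> x" "fmult \<O> a b \<in> \<S> x"
    using a_closed[OF a b] m_closed[OF a b] by (simp_all add: stalk_simps)
qed

lemma act_closed [simp]: "\<gamma> \<in> \<A> \<Longrightarrow> a \<in> \<S> (src \<G> \<gamma>) \<Longrightarrow> act \<O> \<gamma> a \<in> \<S> (rng \<G> \<gamma>)"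
  using ring_hom_closed[OF act_ring_hom] by blast

lemma act_fone [simp]: "\<gamma> \<in> \<A> \<Longrightarrow> act \<O> \<gamma> (fone \<O> (src \<G> \<gamma>)) = fone \<O> (rng \<G> \<gamma>)"
  using ring_hom_one[OF act_ring_hom] by (simp add: stalk_simps)

lemma act_fzero [simp]: "\<gamma> \<in> \<A> \<Longrightarrow> act \<O> \<gamma> (fzero \<O> (src \<G> \<gamma>)) = fzero \<O> (rng \<G> \<gamma>)"
  using ring_hom_zero[OF act_ring_hom ring_stalk ring_stalk] by (simp add: stalk_simps)

lemma act_fadd: "\<gamma> \<in> \<A> \<Longrightarrow> a \<in> \<S> (src \<G> \<gamma>) \<Longrightarrow> b \<in> \<S> (src \<G> \<gamma>)
    \<Longrightarrow> act \<O> \<gamma> (fadd \<O> a b) = fadd \<O> (act \<O> \<gamma> a) (act \<O> \<gamma> b)"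
  using ring_hom_add[OF act_ring_hom] by (simp add: stalk_simps)

lemma compact_open_nbhd:
  assumes "openin X W" "x \<in> W"
  obtains K where "compact_open_in X K" "x \<in> K" "K \<subseteq> W"
proof -
  have "(arbitrary union_of compact_open_in X) W"
    using assms(1) zero_dim by (simp add: zero_dimensional_def)
  then obtain \<U> where "\<U> \<subseteq> Collect (compact_open_in X)" "\<Union>\<U> = W"
    by (auto simp: union_of_def)
  then obtain K where "K \<in> \<U>" "x \<in> K" using assms(2) by blast
  then show thesis
    using that[of K] \<open>\<U> \<subseteq> _\<close> \<open>\<Union>\<U> = W\<close> by auto
qed

lemma continuous_fiberwise:
  assumes "continuous_map (subtopology (prod_topology (total \<O>) (total \<O>))
      {(a, b). proj \<O> a = proj \<O> b}) (total \<O>) (\<lambda>(a, b). h a b)"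
    and "continuous_map Y (total \<O>) \<sigma>" "continuous_map Y (total \<O>) \<tau>"
    and "\<And>y. y \<in> topspace Y \<Longrightarrow> proj \<O> (\<sigma> y) = proj \<O> (\<tau> y)"
  shows "continuous_map Y (total \<O>) (\<lambda>y. h (\<sigma> y) (\<tau> y))"
proof -
  have "continuous_map Y (subtopology (prod_topology (total \<O>) (total \<O>))
      {(a, b). proj \<O> a = proj \<O> b}) (\<lambda>y. (\<sigma> y, \<tau> y))"
    using assms(2-4) by (auto simp: continuous_map_in_subtopology continuous_map_paired)
  from continuous_map_compose[OF this assms(1)] show ?thesis by (simp add: o_def)
qed

lemmas continuous_fadd = continuous_fiberwise[OF fadd_continuous]
lemmas continuous_fmult = continuous_fiberwise[OF fmult_continuous]

lemma continuous_sheaf_act: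
  assumes "continuous_map Y (arrows \<G>) g" "continuous_map Y (total \<O>) \<sigma>"
    and "\<And>y. y \<in> topspace Y \<Longrightarrow> src \<G> (g y) = proj \<O> (\<sigma> y)"
  shows "continuous_map Y (total \<O>) (\<lambda>y. act \<O> (g y) (\<sigma> y))"
proof -
  have "continuous_map Y (subtopology (prod_topology (arrows \<G>) (total \<O>))
      {(\<gamma>, e). src \<G> \<gamma> = proj \<O> e}) (\<lambda>y. (g y, \<sigma> y))"
    using assms by (auto simp: continuous_map_in_subtopology continuous_map_paired)
  from continuous_map_compose[OF this act_continuous] show ?thesis by (simp add: o_def)
qed

section \<open>Local sections of the sheaf over open subsets of the unit space\<close>

definition local_section :: "'x set \<Rightarrow> ('x \<Rightarrow> 'e) \<Rightarrow> bool" where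
  "local_section V \<sigma> \<longleftrightarrow> openin X V \<and> continuous_map (subtopology X V) (total \<O>) \<sigma>
     \<and> (\<forall>y \<in> V. proj \<O> (\<sigma> y) = y)"

lemma local_section_topspace: "local_section V \<sigma> \<Longrightarrow> y \<in> V \<Longrightarrow> y \<in> topspace X"
  using openin_subset by (auto simp: local_section_def)

lemma topspace_open_subtopology: "openin Y V \<Longrightarrow> topspace (subtopology Y V) = V"
  using openin_subset by auto

lemma local_section_stalk: "local_section V \<sigma> \<Longrightarrow> y \<in> V \<Longrightarrow> \<sigma> y \<in> \<S> y"
  using local_section_topspace[of V \<sigma> y] by (auto simp: local_section_def in_stalk continuous_map_def)

lemma local_sectionI:
  assumes "openin X V" "continuous_map (subtopology X V) (total \<O>) \<sigma>" "\<And>y. y \<in> V \<Longrightarrow> \<sigma> y \<in> \<S> y"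
  shows "local_section V \<sigma>"
  using assms by (auto simp: local_section_def in_stalk)

lemma local_section_mono: "local_section V \<sigma> \<Longrightarrow> openin X W \<Longrightarrow> W \<subseteq> V \<Longrightarrow> local_section W \<sigma>"
  by (auto simp: local_section_def intro: continuous_map_from_subtopology_mono)

lemma local_section_fone: "openin X V \<Longrightarrow> local_section V (fone \<O>)"
  by (rule local_sectionI)
    (use fone_continuous[unfolded objs_germs] openin_subset[of X V] in \<open>auto intro!: continuous_map_from_subtopology fone_closed\<close>)

lemma local_section_fadd:
  "local_section V \<sigma> \<Longrightarrow> local_section V \<tau> \<Longrightarrow> local_section V (\<lambda>y. fadd \<O> (\<sigma> y) (\<tau> y))"
proof (rule local_sectionI)
  assume *: "local_section V \<sigma>" "local_section V \<tau>"
  then show V: "openin X V" by (simp add: local_section_def)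
  show "continuous_map (subtopology X V) (total \<O>) (\<lambda>y. fadd \<O> (\<sigma> y) (\<tau> y))"
    using * by (intro continuous_fadd) (auto simp: local_section_def)
  show "fadd \<O> (\<sigma> y) (\<tau> y) \<in> \<S> y" if "y \<in> V" for y
    using * that by (simp add: local_section_stalk local_section_topspace)
qed

lemma local_section_fmult:
  "local_section V \<sigma> \<Longrightarrow> local_section V \<tau> \<Longrightarrow> local_section V (\<lambda>y. fmult \<O> (\<sigma> y) (\<tau> y))"
proof (rule local_sectionI)
  assume *: "local_section V \<sigma>" "local_section V \<tau>"
  then show V: "openin X V" by (simp add: local_section_def)
  show "continuous_map (subtopology X V) (total \<O>) (\<lambda>y. fmult \<O> (\<sigma> y) (\<tau> y))"
    using * by (intro continuous_fmult) (auto simp: local_section_def)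
  show "fmult \<O> (\<sigma> y) (\<tau> y) \<in> \<S> y" if "y \<in> V" for y
    using * that by (simp add: local_section_stalk local_section_topspace)
qed

lemma local_section_agree:
  assumes "local_section V \<sigma>" "local_section V \<tau>" "x \<in> V" "\<sigma> x = \<tau> x"
  obtains N where "openin X N" "x \<in> N" "N \<subseteq> V" "\<And>y. y \<in> N \<Longrightarrow> \<sigma> y = \<tau> y"
proof -
  have V: "openin X V" "topspace (subtopology X V) = V"
    using assms(1) topspace_open_subtopology by (auto simp only: local_section_def)
  obtain N where "openin (subtopology X V) N" "x \<in> N" "\<And>y. y \<in> N \<Longrightarrow> \<sigma> y = \<tau> y"
    by (rule local_homeomorphism_agree[OF proj_local_homeo, of "subtopology X V" \<sigma> \<tau> x])
      (use assms in \<open>simp_all only: local_section_def V(2)\<close>)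
  then show thesis using that[of N] V(1) openin_open_subtopology by blast
qed

lemma local_section_exists:
  assumes "e \<in> \<S> x"
  obtains V \<sigma> where "local_section V \<sigma>" "x \<in> V" "\<sigma> x = e"
proof -
  have e: "e \<in> topspace (total \<O>)" "proj \<O> e = x" using assms by (auto simp: in_stalk)
  obtain V \<sigma> where "openin X V" "x \<in> V" "continuous_map (subtopology X V) (total \<O>) \<sigma>"
    "\<And>y. y \<in> V \<Longrightarrow> proj \<O> (\<sigma> y) = y" "\<sigma> x = e"
    using local_homeomorphism_section[OF proj_local_homeo e(1)] unfolding objs_germs e(2) by metis
  then show thesis using that[of V \<sigma>] by (auto simp: local_section_def)
qed

lemma fadd_self_imp_fzero:
  assumes "x \<in> topspace X" "a \<in> \<S> x" "fadd \<O> a a = a" shows "a = fzero \<O> x"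
proof -
  interpret ring "stalk \<O> x" using ring_stalk assms(1) .
  show ?thesis using assms add.l_cancel_one[of a a] unfolding stalk_simps by auto
qed

text \<open>The axioms give continuity of addition and of the unit section, not of zero. A local
  section \<sigma> through the zero at \<open>x\<close> satisfies \<sigma> + \<sigma> = \<sigma> at
  \<open>x\<close>, hence nearby, and in a group this forces \<sigma> = 0 there.\<close>

lemma continuous_fzero: "continuous_map X (total \<O>) (fzero \<O>)"
proof (subst continuous_map_def, intro conjI allI impI)
  show "fzero \<O> \<in> topspace X \<rightarrow> topspace (total \<O>)" using fzero_closed by (auto simp: in_stalk)
  fix U assume U: "openin (total \<O>) U"
  show "openin X {x \<in> topspace X. fzero \<O> x \<in> U}"
  proof (subst openin_subopen, intro ballI)
    fix x assume "x \<in> {x \<in> topspace X. fzero \<O> x \<in> U}"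
    then have x: "x \<in> topspace X" "fzero \<O> x \<in> U" by auto
    obtain V \<sigma> where V: "local_section V \<sigma>" "x \<in> V" "\<sigma> x = fzero \<O> x"
      using local_section_exists[OF fzero_closed[OF x(1)]] .
    obtain N where N: "openin X N" "x \<in> N" "N \<subseteq> V" "\<And>y. y \<in> N \<Longrightarrow> fadd \<O> (\<sigma> y) (\<sigma> y) = \<sigma> y"
      by (rule local_section_agree[OF local_section_fadd[OF V(1,1)] V(1,2)]) (use V(3) x in auto)
    then have z: "\<sigma> y = fzero \<O> y" if "y \<in> N" for y
      using fadd_self_imp_fzero[OF local_section_topspace[OF V(1)] local_section_stalk[OF V(1)] N(4)]
        that N(3) by blast
    have "local_section N \<sigma>" using local_section_mono[OF V(1)] N by blast
    then have "openin X {y \<in> N. \<sigma> y \<in> U}"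
      using U openin_continuous_map_preimage[of "subtopology X N" "total \<O>" \<sigma> U] N(1)
      by (simp add: local_section_def topspace_open_subtopology openin_open_subtopology
        del: topspace_subtopology)
    moreover have "{y \<in> N. \<sigma> y \<in> U} \<subseteq> {x \<in> topspace X. fzero \<O> x \<in> U}"
    proof
      fix y assume "y \<in> {y \<in> N. \<sigma> y \<in> U}"
      then show "y \<in> {x \<in> topspace X. fzero \<O> x \<in> U}"
        using z[of y] openin_subset[OF N(1)] by (simp add: subsetD)
    qed
    moreover have "x \<in> {y \<in> N. \<sigma> y \<in> U}"
      using N(2) x(2) V(3) by simp
    ultimately show "\<exists>T. openin X T \<and> x \<in> T \<and> T \<subseteq> {x \<in> topspace X. fzero \<O> x \<in> U}"
      by blast
  qed
qed

lemma local_section_fzero: "openin X V \<Longrightarrow> local_section V (fzero \<O>)"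
  by (rule local_sectionI)
    (use continuous_fzero openin_subset[of X V] in \<open>auto intro!: continuous_map_from_subtopology fzero_closed\<close>)

text \<open>Choose a local section \<tau> through the negative at \<open>x\<close>; \<sigma> +
  \<tau> and 0 agree at \<open>x\<close>, hence nearby, and additive inverses are unique. This works
  only on a smaller set \<open>N\<close>, which is why later statements are local.\<close>

lemma local_section_fneg:
  assumes "local_section V \<sigma>" "x \<in> V"
  obtains N \<tau> where "local_section N \<tau>" "x \<in> N" "N \<subseteq> V" "\<And>y. y \<in> N \<Longrightarrow> \<tau> y = a_inv (stalk \<O> y) (\<sigma> y)"
proof -
  have x: "x \<in> topspace X" "\<sigma> x \<in> \<S> x"
    using assms local_section_stalk local_section_topspace by auto
  interpret x: ring "stalk \<O> x" using ring_stalk x(1) .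
  obtain W \<tau> where W: "local_section W \<tau>" "x \<in> W" "\<tau> x = a_inv (stalk \<O> x) (\<sigma> x)"
    using local_section_exists[OF x.a_inv_closed[OF x(2)]] .
  have o: "openin X (V \<inter> W)" using assms W by (auto simp: local_section_def)
  then have s: "local_section (V \<inter> W) \<sigma>" "local_section (V \<inter> W) \<tau>"
    using assms W local_section_mono by blast+
  obtain N where N: "openin X N" "x \<in> N" "N \<subseteq> V \<inter> W" "\<And>y. y \<in> N \<Longrightarrow> fadd \<O> (\<sigma> y) (\<tau> y) = fzero \<O> y"
    by (rule local_section_agree[OF local_section_fadd[OF s] local_section_fzero[OF o], of x])
      (use assms(2) W x.r_neg[OF x(2)] in \<open>auto simp: stalk_simps\<close>)
  show thesis
  proof (rule that)
    show "local_section N \<tau>" using local_section_mono W N by blast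
    fix y assume y: "y \<in> N"
    then have "y \<in> V \<inter> W" using N(3) by blast
    then have y': "y \<in> topspace X" "\<sigma> y \<in> \<S> y" "\<tau> y \<in> \<S> y"
      using local_section_stalk[OF s(1)] local_section_stalk[OF s(2)] local_section_topspace[OF s(1)]
      by auto
    interpret y: ring "stalk \<O> y" using ring_stalk y'(1) .
    have "fadd \<O> (\<tau> y) (\<sigma> y) = fzero \<O> y"
      using N(4)[OF y] y.a_comm[OF y'(2,3)] by (simp add: stalk_simps)
    then show "\<tau> y = a_inv (stalk \<O> y) (\<sigma> y)" using y.minus_equality y' by (simp add: stalk_simps)
  qed (use N in auto)
qed

section \<open>The convolution ring\<close>

abbreviation all_sections ("\<M>") where "\<M> \<equiv> range_sections \<G> \<O>"
abbreviation convolution_ring ("\<Gamma>") where "\<Gamma> \<equiv> Gamma_c \<G> \<O>"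
abbreviation conv (infixl "\<star>" 70) where "f \<star> g \<equiv> convolution \<G> \<O> f g"

section \<open>The additive group of all range sections\<close>

lemma in_sections:
  "f \<in> carrier \<M> \<longleftrightarrow> f \<in> extensional \<A> \<and> (\<forall>\<gamma> \<in> \<A>. f \<gamma> \<in> \<S> (rng \<G> \<gamma>))"
  by (auto simp: range_sections_def in_stalk PiE_def)

lemma section_stalk [simp]: "f \<in> carrier \<M> \<Longrightarrow> \<gamma> \<in> \<A> \<Longrightarrow> f \<gamma> \<in> \<S> (rng \<G> \<gamma>)"
  by (simp add: in_sections)

lemma sections_eqI:
  assumes "f \<in> carrier \<M>" "g \<in> carrier \<M>" "\<And>\<gamma>. \<gamma> \<in> \<A> \<Longrightarrow> f \<gamma> = g \<gamma>" shows "f = g"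
  using assms by (intro extensionalityI[of f \<A> g]) (simp_all add: in_sections)

lemma zero_sections [simp]: "\<gamma> \<in> \<A> \<Longrightarrow> \<zero>\<^bsub>\<M>\<^esub> \<gamma> = fzero \<O> (rng \<G> \<gamma>)"
  by (simp add: range_sections_def)

lemma add_sections [simp]: "\<gamma> \<in> \<A> \<Longrightarrow> (f \<oplus>\<^bsub>\<M>\<^esub> g) \<gamma> = fadd \<O> (f \<gamma>) (g \<gamma>)"
  by (simp add: range_sections_def)

lemma zero_sections_closed: "\<zero>\<^bsub>\<M>\<^esub> \<in> carrier \<M>"
  unfolding in_sections by (simp add: range_sections_def)

lemma add_sections_closed: "f \<in> carrier \<M> \<Longrightarrow> g \<in> carrier \<M> \<Longrightarrow> f \<oplus>\<^bsub>\<M>\<^esub> g \<in> carrier \<M>"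
  unfolding in_sections by (simp add: range_sections_def)

lemma abelian_group_sections: "abelian_group \<M>"
proof (rule abelian_groupI)
  fix f g h assume f: "f \<in> carrier \<M>" and g: "g \<in> carrier \<M>" and h: "h \<in> carrier \<M>"
  show "f \<oplus>\<^bsub>\<M>\<^esub> g \<oplus>\<^bsub>\<M>\<^esub> h = f \<oplus>\<^bsub>\<M>\<^esub> (g \<oplus>\<^bsub>\<M>\<^esub> h)"
  proof (rule sections_eqI)
    fix \<gamma> assume \<gamma>: "\<gamma> \<in> \<A>"
    interpret ring "stalk \<O> (rng \<G> \<gamma>)" using ring_stalk \<gamma> by simp
    show "(f \<oplus>\<^bsub>\<M>\<^esub> g \<oplus>\<^bsub>\<M>\<^esub> h) \<gamma> = (f \<oplus>\<^bsub>\<M>\<^esub> (g \<oplus>\<^bsub>\<M>\<^esub> h)) \<gamma>"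
      using a_assoc[of "f \<gamma>" "g \<gamma>" "h \<gamma>"] f g h \<gamma> by (simp add: stalk_simps)
  qed (use f g h in \<open>simp_all add: add_sections_closed\<close>)
  show "f \<oplus>\<^bsub>\<M>\<^esub> g = g \<oplus>\<^bsub>\<M>\<^esub> f"
  proof (rule sections_eqI)
    fix \<gamma> assume \<gamma>: "\<gamma> \<in> \<A>"
    interpret ring "stalk \<O> (rng \<G> \<gamma>)" using ring_stalk \<gamma> by simp
    show "(f \<oplus>\<^bsub>\<M>\<^esub> g) \<gamma> = (g \<oplus>\<^bsub>\<M>\<^esub> f) \<gamma>"
      using a_comm[of "f \<gamma>" "g \<gamma>"] f g \<gamma> by (simp add: stalk_simps)
  qed (use f g in \<open>simp_all add: add_sections_closed\<close>)
next
  fix f assume f: "f \<in> carrier \<M>"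
  show "\<zero>\<^bsub>\<M>\<^esub> \<oplus>\<^bsub>\<M>\<^esub> f = f"
    by (rule sections_eqI) (use f in \<open>simp_all add: add_sections_closed zero_sections_closed\<close>)
  define g where "g = (\<lambda>\<gamma> \<in> \<A>. a_inv (stalk \<O> (rng \<G> \<gamma>)) (f \<gamma>))"
  have *: "g \<gamma> \<in> \<S> (rng \<G> \<gamma>) \<and> fadd \<O> (g \<gamma>) (f \<gamma>) = fzero \<O> (rng \<G> \<gamma>)" if \<gamma>: "\<gamma> \<in> \<A>" for \<gamma>
  proof -
    interpret ring "stalk \<O> (rng \<G> \<gamma>)" using ring_stalk \<gamma> by simp
    show ?thesis
      using l_neg[of "f \<gamma>"] f \<gamma> by (simp add: stalk_simps g_def)
  qed
  have g: "g \<in> carrier \<M>" unfolding in_sections using * by (simp add: g_def)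
  have "g \<oplus>\<^bsub>\<M>\<^esub> f = \<zero>\<^bsub>\<M>\<^esub>"
    by (rule sections_eqI) (use f g * in \<open>simp_all add: add_sections_closed zero_sections_closed\<close>)
  then show "\<exists>g\<in>carrier \<M>. g \<oplus>\<^bsub>\<M>\<^esub> f = \<zero>\<^bsub>\<M>\<^esub>" using g by blast
qed (auto simp: add_sections_closed zero_sections_closed)

sublocale sections: abelian_group \<M> by (rule abelian_group_sections)

text \<open>The additive inverse in the function group is given abstractly; evaluating -f + f = 0 at
  \<gamma> and using uniqueness of inverses in the stalk makes it pointwise.\<close>

lemma neg_sections [simp]:
  assumes "f \<in> carrier \<M>" "\<gamma> \<in> \<A>"
  shows "(\<ominus>\<^bsub>\<M>\<^esub> f) \<gamma> = a_inv (stalk \<O> (rng \<G> \<gamma>)) (f \<gamma>)"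
proof -
  interpret ring "stalk \<O> (rng \<G> \<gamma>)" using ring_stalk assms by simp
  have "(\<ominus>\<^bsub>\<M>\<^esub> f \<oplus>\<^bsub>\<M>\<^esub> f) \<gamma> = \<zero>\<^bsub>\<M>\<^esub> \<gamma>" using assms sections.l_neg by simp
  then have "fadd \<O> ((\<ominus>\<^bsub>\<M>\<^esub> f) \<gamma>) (f \<gamma>) = fzero \<O> (rng \<G> \<gamma>)"
    using assms by simp
  then show ?thesis
    using minus_equality[of "(\<ominus>\<^bsub>\<M>\<^esub> f) \<gamma>" "f \<gamma>"] assms by (simp add: stalk_simps)
qed

section \<open>Generators supported on the germs of a single semigroup element\<close>

text \<open>The bisection of germs [s, x], \<open>x\<close> in \<open>K\<close>, is parametrized by
  sources, so \<open>h\<close> is a function on \<open>K\<close>; its value at \<open>x\<close> lies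
  in the stalk over the range \<theta>_s(x), not over \<open>x\<close>. Outside the bisection the
  value is the zero of the appropriate stalk.\<close>

definition germ_section :: "'s \<Rightarrow> 'x set \<Rightarrow> ('x \<Rightarrow> 'e) \<Rightarrow> ('s \<times> 'x) set \<Rightarrow> 'e" where
  "germ_section s K h =
    (\<lambda>\<gamma> \<in> \<A>. if \<gamma> \<in> germ D s ` K then h (src \<G> \<gamma>) else fzero \<O> (rng \<G> \<gamma>))"

definition section_data :: "'s \<Rightarrow> 'x set \<Rightarrow> ('x \<Rightarrow> 'e) \<Rightarrow> bool" where
  "section_data s K h \<longleftrightarrow> compact_open_in X K \<and> K \<subseteq> D (star s)
     \<and> continuous_map (subtopology X K) (total \<O>) h \<and> (\<forall>x \<in> K. proj \<O> (h x) = \<theta> s x)"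

definition germ_sections :: "(('s \<times> 'x) set \<Rightarrow> 'e) set" where
  "germ_sections = {germ_section s K h | s K h. section_data s K h}"

lemma section_data_D: "section_data s K h \<Longrightarrow> x \<in> K \<Longrightarrow> x \<in> D (star s)"
  by (auto simp: section_data_def)

lemma section_data_stalk:
  assumes "section_data s K h" "x \<in> K" shows "h x \<in> \<S> (\<theta> s x)"
proof -
  have "x \<in> topspace X" using assms section_data_D D_subset by blast
  then show ?thesis
    using assms by (auto simp: section_data_def in_stalk continuous_map_def)
qed

lemma germ_section_germ [simp]:
  "section_data s K h \<Longrightarrow> x \<in> K \<Longrightarrow> germ_section s K h (germ D s x) = h x"
  using section_data_D by (simp add: germ_section_def src_germ)

lemma germ_section_outside [simp]:
  "\<gamma> \<in> \<A> \<Longrightarrow> \<gamma> \<notin> germ D s ` K \<Longrightarrow> germ_section s K h \<gamma> = fzero \<O> (rng \<G> \<gamma>)"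
  by (simp add: germ_section_def)

lemma germ_section_in_sections [simp]:
  assumes "section_data s K h" shows "germ_section s K h \<in> carrier \<M>"
proof -
  have "germ_section s K h \<gamma> \<in> \<S> (rng \<G> \<gamma>)" if "\<gamma> \<in> \<A>" for \<gamma>
  proof (cases "\<gamma> \<in> germ D s ` K")
    case True
    then obtain x where "x \<in> K" "\<gamma> = germ D s x" by blast
    then show ?thesis using assms section_data_stalk section_data_D by (simp add: rng_germ)
  qed (use that in simp)
  then show ?thesis unfolding in_sections by (simp add: germ_section_def)
qed

lemma inj_rng_germ:
  assumes "K \<subseteq> D (star s)" shows "inj_on (rng \<G>) (germ D s ` K)"
proof (rule inj_on_imageI)
  have "inj_on (\<theta> s) K" using act_bij[of s] assms inj_on_subset by (auto simp: bij_betw_def)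
  moreover have "(rng \<G> \<circ> germ D s) x = \<theta> s x" if "x \<in> K" for x
    using that assms by (simp add: rng_germ subsetD)
  ultimately show "inj_on (rng \<G> \<circ> germ D s) K" using inj_on_cong by blast
qed

lemma inj_src_germ:
  assumes "K \<subseteq> D (star s)" shows "inj_on (src \<G>) (germ D s ` K)"
  by (rule inj_on_imageI) (use assms in \<open>auto simp: inj_on_def src_germ subset_iff\<close>)

lemma compact_open_germ_image:
  assumes "compact_open_in X K" "K \<subseteq> D (star s)" shows "compact_open_in (arrows \<G>) (germ D s ` K)"
  using assms openin_germ_image compactin_germ_image
  by (simp add: compact_open_in_Hausdorff Hausdorff_arrows Hausdorff_X)

lemma germ_section_in_bisection_sections:
  assumes "section_data s K h" shows "germ_section s K h \<in> bisection_sections \<G> \<O>"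
proof -
  have K: "compact_open_in X K" "K \<subseteq> D (star s)" "continuous_map (subtopology X K) (total \<O>) h"
    using assms by (auto simp: section_data_def)
  let ?U = "germ D s ` K"
  have U: "?U \<subseteq> \<A>" using K by auto
  have s: "continuous_map (subtopology (arrows \<G>) ?U) (subtopology X K) (src \<G>)"
    using K continuous_src
    by (auto simp: continuous_map_in_subtopology src_germ subset_iff continuous_map_from_subtopology)
  have "continuous_map (subtopology (arrows \<G>) ?U) (total \<O>) (germ_section s K h)"
    using continuous_map_compose[OF s K(3)]
    by (rule continuous_map_eq) (use U in \<open>auto simp: germ_section_def\<close>)
  then show ?thesis
    unfolding bisection_sections_def bisection_def
    using assms compact_open_germ_image[OF K(1,2)] U inj_rng_germ[OF K(2)] inj_src_germ[OF K(2)]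
    by (intro CollectI conjI exI[of _ ?U]) simp_all
qed

lemma section_data_empty: "section_data s {} h"
  by (simp add: section_data_def compact_open_in_def subtopology_trivial_iff Hausdorff_space_def)

text \<open>Every arrow of the compact open support has a neighbourhood consisting of germs of one
  \<open>s\<close>, and on such a piece \<open>f\<close> is determined by its composite with the map
  from \<open>x\<close> to [s, x]. \<open>compact_open_in_induct\<close> assembles the support from
  disjoint pieces of this kind.\<close>

lemma bisection_sections_subset:
  "bisection_sections \<G> \<O> \<subseteq> generate (add_monoid \<M>) germ_sections"
proof
  fix f assume "f \<in> bisection_sections \<G> \<O>"
  then obtain U where f: "f \<in> carrier \<M>" and U: "compact_open_in (arrows \<G>) U"
    "continuous_map (subtopology (arrows \<G>) U) (total \<O>) f"
    "\<And>\<gamma>. \<gamma> \<in> \<A> \<Longrightarrow> \<gamma> \<notin> U \<Longrightarrow> f \<gamma> = fzero \<O> (rng \<G> \<gamma>)"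
    by (auto simp: bisection_sections_def)
  \<comment> \<open>The section \<open>f\<close> cut down to \<open>C\<close>; disjoint unions of
    supports become sums, which makes the set induction possible.\<close>
  define r where "r C = (\<lambda>\<gamma> \<in> \<A>. if \<gamma> \<in> C then f \<gamma> else fzero \<O> (rng \<G> \<gamma>))" for C
  have r: "r C \<in> carrier \<M>" for C
    unfolding in_sections using f by (simp add: r_def)
  have "r U \<in> generate (add_monoid \<M>) germ_sections"
    using Hausdorff_arrows U(1)
  proof (induction rule: compact_open_in_induct)
    case empty
    have "r {} = \<zero>\<^bsub>\<M>\<^esub>" by (rule sections_eqI) (simp_all add: r, simp add: r_def)
    then show ?case using generate.one[of "add_monoid \<M>"] by simp
  next
    case (disjoint_union A B)
    have "r (A \<union> B) = r A \<oplus>\<^bsub>\<M>\<^esub> r B"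
      by (rule sections_eqI) (use f disjoint_union(5) in \<open>simp_all add: r add_sections_closed, auto simp: r_def\<close>)
    then show ?case using generate.eng[OF disjoint_union(6,7)] by simp
  next
    case (local \<gamma>)
    have \<gamma>: "\<gamma> \<in> \<A>" using local U(1) openin_subset by (auto simp: compact_open_in_def)
    obtain s x where x: "x \<in> D (star s)" "\<gamma> = germ D s x" using \<gamma> by (elim arrowE)
    have "openin X {y \<in> D (star s). germ D s y \<in> U}"
      using U(1) openin_germ_vimage by (simp add: compact_open_in_def)
    then obtain K where K: "compact_open_in X K" "x \<in> K" "K \<subseteq> {y \<in> D (star s). germ D s y \<in> U}"
      using x local by (elim compact_open_nbhd) auto
    have KD: "K \<subseteq> D (star s)" using K(3) by blast
    show ?case
    proof (intro exI[of _ "germ D s ` K"] conjI allI impI)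
      show "compact_open_in (arrows \<G>) (germ D s ` K)"
        using compact_open_germ_image[OF K(1) KD] .
      show "\<gamma> \<in> germ D s ` K" using K x by blast
      fix C assume C: "compact_open_in (arrows \<G>) C" "C \<subseteq> germ D s ` K" "C \<subseteq> U"
      \<comment> \<open>The preimage of \<open>C\<close> under the map from \<open>y\<close> to
        [s, y]. It is open by continuity of that map and compact because it is also the image of
        \<open>C\<close> under \<open>src\<close>.\<close>
      define L where "L = {y \<in> D (star s). germ D s y \<in> C}"
      have CL: "C = germ D s ` L" using C(2) KD by (auto simp: L_def)
      have LD: "L \<subseteq> D (star s)" by (auto simp: L_def)
      have "openin X L" using C(1) openin_germ_vimage by (simp add: compact_open_in_def L_def)
      moreover have "compactin X L"
        using image_compactin[OF _ continuous_src, of C] C(1) src_image_germ[OF LD] CL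
        by (simp add: compact_open_in_def)
      ultimately have L: "compact_open_in X L" by (simp add: compact_open_in_Hausdorff Hausdorff_X)
      have "continuous_map (subtopology X L) (subtopology (arrows \<G>) U) (germ D s)"
        using continuous_map_from_subtopology_mono[OF continuous_germ LD] CL C(3)
        by (auto simp: continuous_map_in_subtopology)
      from continuous_map_compose[OF this U(2)]
      have "section_data s L (f \<circ> germ D s)"
        using L LD f by (auto simp: section_data_def rng_germ in_sections in_stalk subset_iff)
      then have "germ_section s L (f \<circ> germ D s) \<in> germ_sections" "section_data s L (f \<circ> germ D s)"
        by (auto simp: germ_sections_def)
      moreover have "germ_section s L (f \<circ> germ D s) = r C"
      proof (rule sections_eqI)
        fix \<delta> assume \<delta>: "\<delta> \<in> \<A>"
        show "germ_section s L (f \<circ> germ D s) \<delta> = r C \<delta>"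
        proof (cases "\<delta> \<in> C")
          case True
          then obtain y where "y \<in> L" "\<delta> = germ D s y" using CL by blast
          then show ?thesis using \<delta> True calculation(2) by (simp add: r_def)
        qed (use \<delta> CL in \<open>simp add: r_def\<close>)
      qed (simp_all add: r calculation(2))
      ultimately show "r C \<in> generate (add_monoid \<M>) germ_sections"
        using generate.incl by metis
    qed
  qed
  moreover have "r U = f"
    by (rule sections_eqI) (use f U(3) in \<open>simp_all add: r, simp add: r_def\<close>)
  ultimately show "f \<in> generate (add_monoid \<M>) germ_sections" by simp
qed

lemma germ_sections_subset: "germ_sections \<subseteq> carrier \<M>"
  by (auto simp: germ_sections_def)

text \<open>Replaces arbitrary compact open bisections by those of germs of a single
  \<open>s\<close> as generators, which is what makes products and supports computable.\<close>

lemma carrier_Gamma: "carrier \<Gamma> = generate (add_monoid \<M>) germ_sections"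
proof
  have B: "bisection_sections \<G> \<O> \<subseteq> carrier (add_monoid \<M>)" by (auto simp: bisection_sections_def)
  have E: "germ_sections \<subseteq> carrier (add_monoid \<M>)" using germ_sections_subset by simp
  show "carrier \<Gamma> \<subseteq> generate (add_monoid \<M>) germ_sections"
    using group.generate_subgroup_incl[OF sections.a_group bisection_sections_subset
      group.generate_is_subgroup[OF sections.a_group E]] by (simp add: Gamma_c_def)
  have "germ_sections \<subseteq> bisection_sections \<G> \<O>"
    using germ_section_in_bisection_sections by (auto simp: germ_sections_def)
  then show "generate (add_monoid \<M>) germ_sections \<subseteq> carrier \<Gamma>"
    using group.mono_generate[OF sections.a_group] by (simp add: Gamma_c_def)
qed

lemma subgroup_Gamma: "subgroup (carrier \<Gamma>) (add_monoid \<M>)"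
  unfolding carrier_Gamma
  using group.generate_is_subgroup[OF sections.a_group, of germ_sections] germ_sections_subset by simp

lemma Gamma_subset: "f \<in> carrier \<Gamma> \<Longrightarrow> f \<in> carrier \<M>"
  using subgroup.subset[OF subgroup_Gamma] by auto

lemma Gamma_simps [simp]:
  "mult \<Gamma> = convolution \<G> \<O>" "zero \<Gamma> = \<zero>\<^bsub>\<M>\<^esub>" "add \<Gamma> = add \<M>"
  by (simp_all add: Gamma_c_def range_sections_def)

lemma germ_section_in_Gamma [simp]: "section_data s K h \<Longrightarrow> germ_section s K h \<in> carrier \<Gamma>"
  unfolding carrier_Gamma by (rule generate.incl) (auto simp: germ_sections_def)

lemma Gamma_add: "f \<in> carrier \<Gamma> \<Longrightarrow> g \<in> carrier \<Gamma> \<Longrightarrow> f \<oplus>\<^bsub>\<M>\<^esub> g \<in> carrier \<Gamma>"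
  using subgroup.m_closed[OF subgroup_Gamma] by simp

lemma Gamma_zero: "\<zero>\<^bsub>\<M>\<^esub> \<in> carrier \<Gamma>"
  using subgroup.one_closed[OF subgroup_Gamma] by simp

lemma Gamma_neg: "f \<in> carrier \<Gamma> \<Longrightarrow> \<ominus>\<^bsub>\<M>\<^esub> f \<in> carrier \<Gamma>"
  using subgroup.m_inv_closed[OF subgroup_Gamma] by (simp add: a_inv_def)

lemma Gamma_induct [consumes 1, case_names zero germ neg add]:
  assumes "f \<in> carrier \<Gamma>" "P \<zero>\<^bsub>\<M>\<^esub>"
    and "\<And>s K h. section_data s K h \<Longrightarrow> P (germ_section s K h)"
    and "\<And>f. f \<in> carrier \<Gamma> \<Longrightarrow> P f \<Longrightarrow> P (\<ominus>\<^bsub>\<M>\<^esub> f)"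
    and "\<And>f g. f \<in> carrier \<Gamma> \<Longrightarrow> g \<in> carrier \<Gamma> \<Longrightarrow> P f \<Longrightarrow> P g \<Longrightarrow> P (f \<oplus>\<^bsub>\<M>\<^esub> g)"
  shows "P f"
  using assms(1) unfolding carrier_Gamma
proof (induction rule: generate.induct)
  case one
  then show ?case using assms(2) by simp
next
  case (incl h)
  then show ?case using assms(3) by (auto simp: germ_sections_def)
next
  case (inv h)
  then show ?case using assms(3,4) by (auto simp: germ_sections_def a_inv_def)
next
  case (eng f g)
  then show ?case using assms(5) by (simp add: carrier_Gamma)
qed

section \<open>Convolution as a sum over a range fibre\<close>

text \<open>The summand of the convolution at \<gamma> with the right factor eliminated: by
  \<open>left_factor_iff\<close> it can only be the product of the inverse of \<beta> with
  \<gamma>.\<close>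

definition conv_term :: "(('s \<times> 'x) set \<Rightarrow> 'e) \<Rightarrow> (('s \<times> 'x) set \<Rightarrow> 'e) \<Rightarrow> ('s \<times> 'x) set
    \<Rightarrow> ('s \<times> 'x) set \<Rightarrow> 'e" where
  "conv_term f g \<gamma> \<beta> = fmult \<O> (f \<beta>) (act \<O> \<beta> (g (comp \<G> (ginv \<G> \<beta>) \<gamma>)))"

abbreviation fibre :: "'x \<Rightarrow> ('s \<times> 'x) set set" where
  "fibre y \<equiv> {\<beta> \<in> \<A>. rng \<G> \<beta> = y}"

lemma act_stalk:
  assumes "g \<in> carrier \<M>" "\<gamma> \<in> \<A>" "\<beta> \<in> fibre (rng \<G> \<gamma>)"
  shows "act \<O> \<beta> (g (comp \<G> (ginv \<G> \<beta>) \<gamma>)) \<in> \<S> (rng \<G> \<gamma>)"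
proof -
  have "g (comp \<G> (ginv \<G> \<beta>) \<gamma>) \<in> \<S> (src \<G> \<beta>)"
    using assms section_stalk[of g "comp \<G> (ginv \<G> \<beta>) \<gamma>"] by simp
  then show ?thesis using assms act_closed[of \<beta>] by auto
qed

lemma conv_term_closed:
  assumes "f \<in> carrier \<M>" "g \<in> carrier \<M>" "\<gamma> \<in> \<A>" "\<beta> \<in> fibre (rng \<G> \<gamma>)"
  shows "conv_term f g \<gamma> \<beta> \<in> \<S> (rng \<G> \<gamma>)"
  using assms act_stalk[OF assms(2-4)] section_stalk[of f \<beta>] by (auto simp: conv_term_def)

lemma conv_term_zero:
  assumes "f \<in> carrier \<M>" "g \<in> carrier \<M>" "\<gamma> \<in> \<A>" "\<beta> \<in> fibre (rng \<G> \<gamma>)"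
    and "f \<beta> = fzero \<O> (rng \<G> \<beta>) \<or> g (comp \<G> (ginv \<G> \<beta>) \<gamma>) = fzero \<O> (src \<G> \<beta>)"
  shows "conv_term f g \<gamma> \<beta> = fzero \<O> (rng \<G> \<gamma>)"
  using assms(5)
proof
  assume "f \<beta> = fzero \<O> (rng \<G> \<beta>)"
  then show ?thesis using assms(3,4) act_stalk[OF assms(2-4)] by (simp add: conv_term_def)
next
  assume "g (comp \<G> (ginv \<G> \<beta>) \<gamma>) = fzero \<O> (src \<G> \<beta>)"
  then show ?thesis
    using assms(3,4) section_stalk[OF assms(1), of \<beta>] by (auto simp: conv_term_def)
qed

text \<open>The definition sums over precisely the nonzero terms, an index set that changes with
  \<open>f\<close> and \<open>g\<close>. Any finite set containing all nonzero terms may be used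
  instead, so that sums for different functions can be compared over a common index set.\<close>

lemma convolution_eq_finsum:
  assumes f: "f \<in> carrier \<M>" and g: "g \<in> carrier \<M>" and \<gamma>: "\<gamma> \<in> \<A>"
    and F: "finite F" "F \<subseteq> fibre (rng \<G> \<gamma>)"
    and zero: "\<And>\<beta>. \<beta> \<in> fibre (rng \<G> \<gamma>) - F \<Longrightarrow> conv_term f g \<gamma> \<beta> = fzero \<O> (rng \<G> \<gamma>)"
  shows "(f \<star> g) \<gamma> = finsum (stalk \<O> (rng \<G> \<gamma>)) (conv_term f g \<gamma>) F"
proof -
  interpret ring "stalk \<O> (rng \<G> \<gamma>)" using ring_stalk \<gamma> by simp
  define B where "B = {\<beta> \<in> fibre (rng \<G> \<gamma>). conv_term f g \<gamma> \<beta> \<noteq> fzero \<O> (rng \<G> \<gamma>)}"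
  define P where "P = {(\<beta>, \<rho>). \<beta> \<in> \<A> \<and> \<rho> \<in> \<A> \<and> src \<G> \<beta> = rng \<G> \<rho> \<and> comp \<G> \<beta> \<rho> = \<gamma>
    \<and> fmult \<O> (f \<beta>) (act \<O> \<beta> (g \<rho>)) \<noteq> fzero \<O> (rng \<G> \<gamma>)}"
  \<comment> \<open>The first projection inverts \<open>k\<close>, since the right factor is forced;
    hence the nonzero factorizations are reindexed by their left factors in
    \<open>B\<close>.\<close>
  define k where "k \<beta> = (\<beta>, comp \<G> (ginv \<G> \<beta>) \<gamma>)" for \<beta>
  have P: "P = k ` B"
  proof (intro equalityI subsetI)
    fix z assume "z \<in> P"
    then obtain \<beta> \<rho> where z: "z = (\<beta>, \<rho>)" "\<beta> \<in> \<A>" "\<rho> \<in> \<A> \<and> src \<G> \<beta> = rng \<G> \<rho> \<and> comp \<G> \<beta> \<rho> = \<gamma>"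
      "fmult \<O> (f \<beta>) (act \<O> \<beta> (g \<rho>)) \<noteq> fzero \<O> (rng \<G> \<gamma>)" by (auto simp: P_def)
    then have r: "rng \<G> \<beta> = rng \<G> \<gamma>" using rng_comp[of \<beta> \<rho>] by simp
    then have "\<rho> = comp \<G> (ginv \<G> \<beta>) \<gamma>" using z(3) left_factor_iff[OF z(2) \<gamma> r] by simp
    then show "z \<in> k ` B" using z r by (auto simp: B_def k_def conv_term_def)
  next
    fix z assume "z \<in> k ` B"
    then obtain \<beta> where b: "\<beta> \<in> \<A>" "rng \<G> \<beta> = rng \<G> \<gamma>" "conv_term f g \<gamma> \<beta> \<noteq> fzero \<O> (rng \<G> \<gamma>)"
      "z = k \<beta>" by (auto simp: B_def)
    then show "z \<in> P" using left_factor_iff[OF b(1) \<gamma> b(2)] by (simp add: P_def k_def conv_term_def)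
  qed
  have "(f \<star> g) \<gamma> = finsum (stalk \<O> (rng \<G> \<gamma>)) (\<lambda>(\<beta>, \<rho>). fmult \<O> (f \<beta>) (act \<O> \<beta> (g \<rho>))) P"
    using \<gamma> by (simp add: convolution_def P_def)
  also have "\<dots> = finsum (stalk \<O> (rng \<G> \<gamma>)) (\<lambda>\<beta>. case k \<beta> of (\<beta>, \<rho>) \<Rightarrow> fmult \<O> (f \<beta>) (act \<O> \<beta> (g \<rho>))) B"
    unfolding P
  proof (rule finsum_reindex)
    show "inj_on k B" by (auto simp: inj_on_def k_def)
    show "(\<lambda>(\<beta>, \<rho>). fmult \<O> (f \<beta>) (act \<O> \<beta> (g \<rho>))) \<in> k ` B \<rightarrow> \<S> (rng \<G> \<gamma>)"
      using conv_term_closed[OF f g \<gamma>] by (auto simp: B_def k_def conv_term_def)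
  qed
  also have "\<dots> = finsum (stalk \<O> (rng \<G> \<gamma>)) (conv_term f g \<gamma>) B"
    by (simp add: k_def conv_term_def[abs_def])
  also have "\<dots> = finsum (stalk \<O> (rng \<G> \<gamma>)) (conv_term f g \<gamma>) F"
  proof (rule add.finprod_mono_neutral_cong_left)
    show "finite F" by (rule F)
    show "B \<subseteq> F" using zero by (auto simp: B_def)
    show "conv_term f g \<gamma> \<beta> = \<zero>\<^bsub>stalk \<O> (rng \<G> \<gamma>)\<^esub>" if "\<beta> \<in> F - B" for \<beta>
      using that F(2) by (auto simp: B_def stalk_simps)
    show "conv_term f g \<gamma> \<in> F \<rightarrow> \<S> (rng \<G> \<gamma>)"
      using conv_term_closed[OF f g \<gamma>] F(2) by blast
  qed auto
  finally show ?thesis .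
qed

lemma convolution_eq_zero:
  assumes "f \<in> carrier \<M>" "g \<in> carrier \<M>" "\<gamma> \<in> \<A>"
    and "\<And>\<beta>. \<beta> \<in> \<A> \<Longrightarrow> rng \<G> \<beta> = rng \<G> \<gamma> \<Longrightarrow>
      f \<beta> = fzero \<O> (rng \<G> \<beta>) \<or> g (comp \<G> (ginv \<G> \<beta>) \<gamma>) = fzero \<O> (src \<G> \<beta>)"
  shows "(f \<star> g) \<gamma> = fzero \<O> (rng \<G> \<gamma>)"
proof -
  interpret ring "stalk \<O> (rng \<G> \<gamma>)" using ring_stalk assms by simp
  show ?thesis
    using convolution_eq_finsum[OF assms(1-3), of "{}"] conv_term_zero[OF assms(1-3)] assms(4)
    by (simp add: stalk_simps)
qed

lemma convolution_eq_single:
  assumes "f \<in> carrier \<M>" "g \<in> carrier \<M>" "\<beta> \<in> \<A>" "\<rho> \<in> \<A>" "src \<G> \<beta> = rng \<G> \<rho>"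
    and "\<And>\<alpha>. \<alpha> \<in> \<A> \<Longrightarrow> rng \<G> \<alpha> = rng \<G> \<beta> \<Longrightarrow> \<alpha> \<noteq> \<beta> \<Longrightarrow>
      f \<alpha> = fzero \<O> (rng \<G> \<alpha>) \<or> g (comp \<G> (ginv \<G> \<alpha>) (comp \<G> \<beta> \<rho>)) = fzero \<O> (src \<G> \<alpha>)"
  shows "(f \<star> g) (comp \<G> \<beta> \<rho>) = fmult \<O> (f \<beta>) (act \<O> \<beta> (g \<rho>))"
proof -
  define \<gamma> where "\<gamma> = comp \<G> \<beta> \<rho>"
  have \<gamma>: "\<gamma> \<in> \<A>" "rng \<G> \<gamma> = rng \<G> \<beta>" using assms by (simp_all add: \<gamma>_def)
  interpret ring "stalk \<O> (rng \<G> \<gamma>)" using ring_stalk \<gamma> assms by simp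
  have b: "\<beta> \<in> fibre (rng \<G> \<gamma>)" using \<gamma> assms by simp
  have "\<rho> = comp \<G> (ginv \<G> \<beta>) \<gamma>"
    using left_factor_iff[OF assms(3) \<gamma>(1), of \<rho>] assms \<gamma> by (simp add: \<gamma>_def)
  then have t: "conv_term f g \<gamma> \<beta> = fmult \<O> (f \<beta>) (act \<O> \<beta> (g \<rho>))" by (simp add: conv_term_def)
  have "(f \<star> g) \<gamma> = finsum (stalk \<O> (rng \<G> \<gamma>)) (conv_term f g \<gamma>) {\<beta>}"
    by (rule convolution_eq_finsum[OF assms(1,2) \<gamma>(1)])
      (use b assms(6) \<gamma>(2) conv_term_zero[OF assms(1,2) \<gamma>(1)] in \<open>auto simp: \<gamma>_def\<close>)
  also have "\<dots> = conv_term f g \<gamma> \<beta>"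
    using conv_term_closed[OF assms(1,2) \<gamma>(1) b] by simp
  finally show ?thesis using t unfolding \<gamma>_def by simp
qed

lemma convolution_closed:
  assumes f: "f \<in> carrier \<M>" and g: "g \<in> carrier \<M>" shows "f \<star> g \<in> carrier \<M>"
proof -
  have "(f \<star> g) \<gamma> \<in> \<S> (rng \<G> \<gamma>)" if \<gamma>: "\<gamma> \<in> \<A>" for \<gamma>
  proof -
    interpret ring "stalk \<O> (rng \<G> \<gamma>)" using ring_stalk \<gamma> by simp
    have "fmult \<O> (f \<beta>) (act \<O> \<beta> (g \<rho>)) \<in> \<S> (rng \<G> \<gamma>)"
      if "\<beta> \<in> \<A>" "\<rho> \<in> \<A>" "src \<G> \<beta> = rng \<G> \<rho>" "comp \<G> \<beta> \<rho> = \<gamma>" for \<beta> \<rho>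
      using that \<gamma> section_stalk[OF f, of \<beta>] section_stalk[OF g, of \<rho>] act_closed[of \<beta> "g \<rho>"]
        rng_comp[of \<beta> \<rho>] by simp
    \<comment> \<open>Finiteness of the index set is not at issue here: \<open>finsum\<close> over
      an infinite set is zero by convention, which also lies in the stalk.\<close>
    then show ?thesis
      unfolding convolution_def using \<gamma> by (auto intro!: finsum_closed)
  qed
  then show ?thesis unfolding in_sections by (simp add: convolution_def)
qed

section \<open>Finite supports in fibres and distributivity\<close>

definition fibre_finite :: "(('s \<times> 'x) set \<Rightarrow> 'e) \<Rightarrow> bool" where
  "fibre_finite f \<longleftrightarrow> (\<forall>y. finite {\<beta> \<in> fibre y. f \<beta> \<noteq> fzero \<O> y})"

lemma fibre_finite_add:
  assumes "fibre_finite f" "fibre_finite g" shows "fibre_finite (f \<oplus>\<^bsub>\<M>\<^esub> g)"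
  unfolding fibre_finite_def
proof
  fix y
  have "{\<beta> \<in> fibre y. (f \<oplus>\<^bsub>\<M>\<^esub> g) \<beta> \<noteq> fzero \<O> y}
      \<subseteq> {\<beta> \<in> fibre y. f \<beta> \<noteq> fzero \<O> y} \<union> {\<beta> \<in> fibre y. g \<beta> \<noteq> fzero \<O> y}"
    by auto
  then show "finite {\<beta> \<in> fibre y. (f \<oplus>\<^bsub>\<M>\<^esub> g) \<beta> \<noteq> fzero \<O> y}"
    using assms unfolding fibre_finite_def by (meson finite_Un finite_subset)
qed

lemma a_inv_fzero:
  assumes "x \<in> topspace X" shows "a_inv (stalk \<O> x) (fzero \<O> x) = fzero \<O> x"
proof -
  interpret ring "stalk \<O> x" using ring_stalk assms .
  show ?thesis using minus_zero by (simp add: stalk_simps)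
qed

lemma germ_section_support:
  "\<gamma> \<in> \<A> \<Longrightarrow> germ_section s K h \<gamma> \<noteq> fzero \<O> (rng \<G> \<gamma>) \<Longrightarrow> \<gamma> \<in> germ D s ` K"
  by (meson germ_section_outside)

lemma fibre_finite_Gamma: "f \<in> carrier \<Gamma> \<Longrightarrow> fibre_finite f"
proof (induction rule: Gamma_induct)
  case zero
  have "{\<beta> \<in> fibre y. \<zero>\<^bsub>\<M>\<^esub> \<beta> \<noteq> fzero \<O> y} = {}" for y by auto
  then show ?case by (simp only: fibre_finite_def finite.emptyI simp_thms)
next
  case (germ s K h)
  \<comment> \<open>Since \<theta>_s is injective, at most one germ of \<open>s\<close> ends at
    \<open>y\<close>, namely the one starting at \<theta>_{s*}(y).\<close>
  have "{\<beta> \<in> fibre y. germ_section s K h \<beta> \<noteq> fzero \<O> y} \<subseteq> {germ D s (\<theta> (star s) y)}" for y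
  proof
    fix \<beta> assume b: "\<beta> \<in> {\<beta> \<in> fibre y. germ_section s K h \<beta> \<noteq> fzero \<O> y}"
    then have "\<beta> \<in> germ D s ` K" using germ_section_support[of \<beta> s K h] by auto
    then obtain x where x: "x \<in> K" "\<beta> = germ D s x" by blast
    then have "x \<in> D (star s)" using germ section_data_D by blast
    then show "\<beta> \<in> {germ D s (\<theta> (star s) y)}" using b x by (auto simp: rng_germ)
  qed
  then show ?case unfolding fibre_finite_def by (meson finite.emptyI finite.insertI finite_subset)
next
  case (neg f)
  have "{\<beta> \<in> fibre y. (\<ominus>\<^bsub>\<M>\<^esub> f) \<beta> \<noteq> fzero \<O> y} \<subseteq> {\<beta> \<in> fibre y. f \<beta> \<noteq> fzero \<O> y}" for y
    using neg Gamma_subset by (auto simp: a_inv_fzero)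
  then show ?case using neg unfolding fibre_finite_def by (meson finite_subset)
qed (rule fibre_finite_add)

lemma convolution_support:
  assumes "f \<in> carrier \<M>" "g \<in> carrier \<M>" "\<gamma> \<in> \<A>" "finite F" "F \<subseteq> fibre (rng \<G> \<gamma>)"
    and "{\<beta> \<in> fibre (rng \<G> \<gamma>). f \<beta> \<noteq> fzero \<O> (rng \<G> \<gamma>)} \<subseteq> F"
  shows "(f \<star> g) \<gamma> = finsum (stalk \<O> (rng \<G> \<gamma>)) (conv_term f g \<gamma>) F"
  by (rule convolution_eq_finsum[OF assms(1-5)])
    (use assms(6) in \<open>auto intro!: conv_term_zero[OF assms(1-3)]\<close>)

text \<open>All three convolutions are evaluated over one finite set, the union of the supports of
  \<open>f\<close> and \<open>g\<close> in the fibre; there right distributivity in the stalk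
  applies term by term.\<close>

lemma convolution_add_left:
  assumes f: "f \<in> carrier \<M>" "fibre_finite f" and g: "g \<in> carrier \<M>" "fibre_finite g" and h: "h \<in> carrier \<M>"
  shows "(f \<oplus>\<^bsub>\<M>\<^esub> g) \<star> h = f \<star> h \<oplus>\<^bsub>\<M>\<^esub> g \<star> h"
proof (rule sections_eqI)
  fix \<gamma> assume \<gamma>: "\<gamma> \<in> \<A>"
  interpret ring "stalk \<O> (rng \<G> \<gamma>)" using ring_stalk \<gamma> by simp
  define F where "F = {\<beta> \<in> fibre (rng \<G> \<gamma>). f \<beta> \<noteq> fzero \<O> (rng \<G> \<gamma>)}
    \<union> {\<beta> \<in> fibre (rng \<G> \<gamma>). g \<beta> \<noteq> fzero \<O> (rng \<G> \<gamma>)}"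
  have F: "finite F" "F \<subseteq> fibre (rng \<G> \<gamma>)"
    using f(2) g(2) by (auto simp: F_def fibre_finite_def)
  have "((f \<oplus>\<^bsub>\<M>\<^esub> g) \<star> h) \<gamma> = finsum (stalk \<O> (rng \<G> \<gamma>)) (conv_term (f \<oplus>\<^bsub>\<M>\<^esub> g) h \<gamma>) F"
    by (rule convolution_support[OF _ h \<gamma> F]) (use f g \<gamma> in \<open>auto simp: F_def add_sections_closed\<close>)
  also have "\<dots> = finsum (stalk \<O> (rng \<G> \<gamma>)) (\<lambda>\<beta>. fadd \<O> (conv_term f h \<gamma> \<beta>) (conv_term g h \<gamma> \<beta>)) F"
  proof (rule finsum_cong')
    fix \<beta> assume b: "\<beta> \<in> F"
    then have b': "\<beta> \<in> fibre (rng \<G> \<gamma>)" using F by blast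
    then have "f \<beta> \<in> \<S> (rng \<G> \<gamma>)" "g \<beta> \<in> \<S> (rng \<G> \<gamma>)"
      using section_stalk[OF f(1), of \<beta>] section_stalk[OF g(1), of \<beta>] by auto
    from l_distr[OF this act_stalk[OF h \<gamma> b']]
    show "conv_term (f \<oplus>\<^bsub>\<M>\<^esub> g) h \<gamma> \<beta> = fadd \<O> (conv_term f h \<gamma> \<beta>) (conv_term g h \<gamma> \<beta>)"
      using b' by (simp add: conv_term_def stalk_simps)
  qed (use F conv_term_closed f g h \<gamma> in auto)
  also have "\<dots> = fadd \<O> (finsum (stalk \<O> (rng \<G> \<gamma>)) (conv_term f h \<gamma>) F)
      (finsum (stalk \<O> (rng \<G> \<gamma>)) (conv_term g h \<gamma>) F)"
    using finsum_addf[of "conv_term f h \<gamma>" F "conv_term g h \<gamma>"] F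
      conv_term_closed[OF f(1) h \<gamma>] conv_term_closed[OF g(1) h \<gamma>]
    by (auto simp: stalk_simps)
  also have "\<dots> = fadd \<O> ((f \<star> h) \<gamma>) ((g \<star> h) \<gamma>)"
    using convolution_support[OF f(1) h \<gamma> F] convolution_support[OF g(1) h \<gamma> F]
    by (auto simp: F_def)
  finally show "((f \<oplus>\<^bsub>\<M>\<^esub> g) \<star> h) \<gamma> = (f \<star> h \<oplus>\<^bsub>\<M>\<^esub> g \<star> h) \<gamma>"
    using \<gamma> by simp
qed (use f g h in \<open>simp_all add: add_sections_closed convolution_closed\<close>)

text \<open>The terms are indexed by the left factor, so the support of \<open>h\<close> alone
  serves for all three sums. Additivity of the action on stalks is used before
  distributivity.\<close>

lemma convolution_add_right:
  assumes h: "h \<in> carrier \<M>" "fibre_finite h" and f: "f \<in> carrier \<M>" and g: "g \<in> carrier \<M>"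
  shows "h \<star> (f \<oplus>\<^bsub>\<M>\<^esub> g) = h \<star> f \<oplus>\<^bsub>\<M>\<^esub> h \<star> g"
proof (rule sections_eqI)
  fix \<gamma> assume \<gamma>: "\<gamma> \<in> \<A>"
  interpret ring "stalk \<O> (rng \<G> \<gamma>)" using ring_stalk \<gamma> by simp
  define F where "F = {\<beta> \<in> fibre (rng \<G> \<gamma>). h \<beta> \<noteq> fzero \<O> (rng \<G> \<gamma>)}"
  have F: "finite F" "F \<subseteq> fibre (rng \<G> \<gamma>)"
    using h(2) by (auto simp: F_def fibre_finite_def)
  note sup = convolution_support[OF h(1) _ \<gamma> F, folded F_def, OF _ subset_refl]
  have "(h \<star> (f \<oplus>\<^bsub>\<M>\<^esub> g)) \<gamma> = finsum (stalk \<O> (rng \<G> \<gamma>)) (conv_term h (f \<oplus>\<^bsub>\<M>\<^esub> g) \<gamma>) F"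
    by (rule sup) (use f g in \<open>simp add: add_sections_closed\<close>)
  also have "\<dots> = finsum (stalk \<O> (rng \<G> \<gamma>)) (\<lambda>\<beta>. fadd \<O> (conv_term h f \<gamma> \<beta>) (conv_term h g \<gamma> \<beta>)) F"
  proof (rule finsum_cong')
    fix \<beta> assume b: "\<beta> \<in> F"
    then have b': "\<beta> \<in> fibre (rng \<G> \<gamma>)" using F by blast
    define \<rho> where "\<rho> = comp \<G> (ginv \<G> \<beta>) \<gamma>"
    have r: "\<rho> \<in> \<A>" "rng \<G> \<rho> = src \<G> \<beta>" using b' \<gamma> by (simp_all add: \<rho>_def)
    have "act \<O> \<beta> (fadd \<O> (f \<rho>) (g \<rho>)) = fadd \<O> (act \<O> \<beta> (f \<rho>)) (act \<O> \<beta> (g \<rho>))"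
      using act_fadd[of \<beta> "f \<rho>" "g \<rho>"] b' r section_stalk[OF f r(1)] section_stalk[OF g r(1)] by simp
    moreover have "h \<beta> \<in> \<S> (rng \<G> \<gamma>)" using b' section_stalk[OF h(1), of \<beta>] by auto
    note r_distr[OF act_stalk[OF f \<gamma> b'] act_stalk[OF g \<gamma> b'] this]
    ultimately show "conv_term h (f \<oplus>\<^bsub>\<M>\<^esub> g) \<gamma> \<beta> = fadd \<O> (conv_term h f \<gamma> \<beta>) (conv_term h g \<gamma> \<beta>)"
      using r by (simp add: conv_term_def stalk_simps flip: \<rho>_def)
  qed (use F conv_term_closed f g h \<gamma> in auto)
  also have "\<dots> = fadd \<O> (finsum (stalk \<O> (rng \<G> \<gamma>)) (conv_term h f \<gamma>) F)
      (finsum (stalk \<O> (rng \<G> \<gamma>)) (conv_term h g \<gamma>) F)"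
    using finsum_addf[of "conv_term h f \<gamma>" F "conv_term h g \<gamma>"] F
      conv_term_closed[OF h(1) f \<gamma>] conv_term_closed[OF h(1) g \<gamma>]
    by (auto simp: stalk_simps)
  also have "\<dots> = fadd \<O> ((h \<star> f) \<gamma>) ((h \<star> g) \<gamma>)"
    using sup[OF f] sup[OF g] by simp
  finally show "(h \<star> (f \<oplus>\<^bsub>\<M>\<^esub> g)) \<gamma> = (h \<star> f \<oplus>\<^bsub>\<M>\<^esub> h \<star> g) \<gamma>"
    using \<gamma> by simp
qed (use f g h in \<open>simp_all add: add_sections_closed convolution_closed\<close>)

lemma convolution_zero_left: "f \<in> carrier \<M> \<Longrightarrow> \<zero>\<^bsub>\<M>\<^esub> \<star> f = \<zero>\<^bsub>\<M>\<^esub>"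
  by (rule sections_eqI)
    (simp_all add: convolution_closed zero_sections_closed convolution_eq_zero)

lemma convolution_zero_right: "f \<in> carrier \<M> \<Longrightarrow> f \<star> \<zero>\<^bsub>\<M>\<^esub> = \<zero>\<^bsub>\<M>\<^esub>"
  by (rule sections_eqI)
    (simp_all add: convolution_closed zero_sections_closed convolution_eq_zero)

lemma convolution_neg_left:
  assumes "f \<in> carrier \<Gamma>" "g \<in> carrier \<M>" shows "(\<ominus>\<^bsub>\<M>\<^esub> f) \<star> g = \<ominus>\<^bsub>\<M>\<^esub> (f \<star> g)"
proof -
  have f: "f \<in> carrier \<M>" "\<ominus>\<^bsub>\<M>\<^esub> f \<in> carrier \<M>" "fibre_finite f" "fibre_finite (\<ominus>\<^bsub>\<M>\<^esub> f)"
    using assms Gamma_subset Gamma_neg fibre_finite_Gamma by blast+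
  have "(\<ominus>\<^bsub>\<M>\<^esub> f) \<star> g \<oplus>\<^bsub>\<M>\<^esub> f \<star> g = \<zero>\<^bsub>\<M>\<^esub>"
    using convolution_add_left[OF f(2,4) f(1,3) assms(2)] f assms(2) sections.l_neg[OF f(1)]
    by (simp add: convolution_zero_left)
  then show ?thesis
    using sections.minus_equality[of "(\<ominus>\<^bsub>\<M>\<^esub> f) \<star> g" "f \<star> g"] f assms(2) by (simp add: convolution_closed)
qed

lemma convolution_neg_right:
  assumes "f \<in> carrier \<Gamma>" "g \<in> carrier \<M>" shows "f \<star> (\<ominus>\<^bsub>\<M>\<^esub> g) = \<ominus>\<^bsub>\<M>\<^esub> (f \<star> g)"
proof -
  have f: "f \<in> carrier \<M>" "fibre_finite f" using assms Gamma_subset fibre_finite_Gamma by blast+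
  have g: "\<ominus>\<^bsub>\<M>\<^esub> g \<in> carrier \<M>" using assms by simp
  have "f \<star> (\<ominus>\<^bsub>\<M>\<^esub> g) \<oplus>\<^bsub>\<M>\<^esub> f \<star> g = \<zero>\<^bsub>\<M>\<^esub>"
    using convolution_add_right[OF f g assms(2)] f assms(2) sections.l_neg[OF assms(2)]
    by (simp add: convolution_zero_right)
  then show ?thesis
    using sections.minus_equality[of "f \<star> (\<ominus>\<^bsub>\<M>\<^esub> g)" "f \<star> g"] f g assms(2)
    by (simp add: convolution_closed)
qed

section \<open>Products of generators\<close>

text \<open>The product of the bisections (s, K) and (t, L) is the set of germs of s t over the
  points of \<open>L\<close> that \<theta>_t sends into \<open>K\<close>. The new values are the
  only possible convolution terms.\<close>

lemma section_data_mult: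
  assumes h: "section_data s K h" and k: "section_data t L k"
  shows "section_data (s * t) {x \<in> L. \<theta> t x \<in> K}
    (\<lambda>x. fmult \<O> (h (\<theta> t x)) (act \<O> (germ D s (\<theta> t x)) (k x)))"
proof -
  let ?M = "{x \<in> L. \<theta> t x \<in> K}"
  have K: "compact_open_in X K" "K \<subseteq> D (star s)" "continuous_map (subtopology X K) (total \<O>) h"
    and L: "compact_open_in X L" "L \<subseteq> D (star t)" "continuous_map (subtopology X L) (total \<O>) k"
    using h k by (auto simp: section_data_def)
  \<comment> \<open>Rewriting the new domain as the image under \<theta>_{t*} of the intersection of
    \<open>K\<close> with \<theta>_t(L) shows that it is compact: intersections of compact sets in a
    Hausdorff space and images under partial homeomorphisms are compact.\<close>
  have M: "?M = \<theta> (star t) ` (K \<inter> \<theta> t ` L)" "K \<inter> \<theta> t ` L \<subseteq> D (star (star t))"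
  proof -
    show D: "K \<inter> \<theta> t ` L \<subseteq> D (star (star t))"
    proof
      fix y assume "y \<in> K \<inter> \<theta> t ` L"
      then obtain x where "x \<in> L" "y = \<theta> t x" by blast
      then show "y \<in> D (star (star t))" using act_in_D L(2) by (simp add: star_star subsetD)
    qed
    have "\<theta> t x \<in> \<theta> t ` L \<longleftrightarrow> x \<in> L" if "x \<in> D (star t)" for x
      using inj_on_image_mem_iff[of "\<theta> t" "D (star t)" x L] act_bij[of t] that L(2)
      by (simp add: bij_betw_def)
    then show "?M = \<theta> (star t) ` (K \<inter> \<theta> t ` L)"
      unfolding act_image_eq[OF D] star_star using L(2) by blast
  qed
  have "compact_open_in X (\<theta> t ` L)"
    using L openin_act_image compactin_act_image by (simp add: compact_open_in_Hausdorff Hausdorff_X)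
  then have "compact_open_in X (K \<inter> \<theta> t ` L)" using K compact_open_in_Int Hausdorff_X by blast
  then have 1: "compact_open_in X ?M"
    using M openin_act_image compactin_act_image by (simp add: compact_open_in_Hausdorff Hausdorff_X)
  have 2: "?M \<subseteq> D (star (s * t))" using K L by (auto simp: dom_mult)
  have tM: "topspace (subtopology X ?M) = ?M"
    using 1 topspace_open_subtopology by (auto simp only: compact_open_in_def)
  have "?M \<subseteq> D (star t)" using L(2) by blast
  then have \<theta>: "continuous_map (subtopology X ?M) (subtopology X K) (\<theta> t)"
    using continuous_map_from_subtopology_mono[OF continuous_act]
    by (auto simp: continuous_map_in_subtopology)
  have c1: "continuous_map (subtopology X ?M) (total \<O>) (\<lambda>x. h (\<theta> t x))"
    using continuous_map_compose[OF \<theta> K(3)] by (simp add: o_def)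
  have "continuous_map (subtopology X K) (arrows \<G>) (germ D s)"
    using continuous_map_from_subtopology_mono[OF continuous_germ K(2)] .
  then have c2: "continuous_map (subtopology X ?M) (arrows \<G>) (\<lambda>x. germ D s (\<theta> t x))"
    using continuous_map_compose[OF \<theta>] by (auto simp: o_def)
  have c3: "continuous_map (subtopology X ?M) (total \<O>) k"
    by (rule continuous_map_from_subtopology_mono[OF L(3)]) auto
  have v: "h (\<theta> t x) \<in> \<S> (\<theta> s (\<theta> t x))" "src \<G> (germ D s (\<theta> t x)) = \<theta> t x" "k x \<in> \<S> (\<theta> t x)"
    "act \<O> (germ D s (\<theta> t x)) (k x) \<in> \<S> (\<theta> s (\<theta> t x))" "\<theta> s (\<theta> t x) \<in> topspace X"
    if "x \<in> ?M" for x
  proof -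
    have d: "\<theta> t x \<in> D (star s)" using that K(2) by auto
    show v1: "h (\<theta> t x) \<in> \<S> (\<theta> s (\<theta> t x))" "k x \<in> \<S> (\<theta> t x)"
      using that section_data_stalk[OF h] section_data_stalk[OF k] by auto
    show v2: "src \<G> (germ D s (\<theta> t x)) = \<theta> t x" using d by (simp add: src_germ)
    show "act \<O> (germ D s (\<theta> t x)) (k x) \<in> \<S> (\<theta> s (\<theta> t x))"
      using act_closed[of "germ D s (\<theta> t x)" "k x"] v1 v2 d by (simp add: rng_germ)
    show "\<theta> s (\<theta> t x) \<in> topspace X" using d act_in_D D_subset by blast
  qed
  have c4: "continuous_map (subtopology X ?M) (total \<O>) (\<lambda>x. act \<O> (germ D s (\<theta> t x)) (k x))"
    by (rule continuous_sheaf_act[OF c2 c3]) (use v in \<open>simp add: in_stalk\<close>)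
  have c5: "continuous_map (subtopology X ?M) (total \<O>)
      (\<lambda>x. fmult \<O> (h (\<theta> t x)) (act \<O> (germ D s (\<theta> t x)) (k x)))"
    by (rule continuous_fmult[OF c1 c4]) (use v in \<open>simp add: in_stalk\<close>)
  have "proj \<O> (fmult \<O> (h (\<theta> t x)) (act \<O> (germ D s (\<theta> t x)) (k x))) = \<theta> (s * t) x"
    if "x \<in> ?M" for x
    using fmult_closed[OF v(5,1,4)[OF that]] act_mult[of x s t] 2 that by (auto simp: in_stalk)
  then show ?thesis unfolding section_data_def using 1 2 c5 by blast
qed

text \<open>Both supports are bisections, so an arrow has at most one factorization with both
  factors in the supports, and the convolution sum collapses to one term or none.\<close>

lemma germ_section_mult:
  assumes h: "section_data s K h" and k: "section_data t L k"
  shows "germ_section s K h \<star> germ_section t L k = germ_section (s * t) {x \<in> L. \<theta> t x \<in> K}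
    (\<lambda>x. fmult \<O> (h (\<theta> t x)) (act \<O> (germ D s (\<theta> t x)) (k x)))"
    (is "?f \<star> ?g = germ_section _ ?M ?hk")
proof (rule sections_eqI)
  note hk = section_data_mult[OF h k]
  show "?f \<star> ?g \<in> carrier \<M>" "germ_section (s * t) ?M ?hk \<in> carrier \<M>"
    using h k hk by (simp_all add: convolution_closed)
  have f: "?f \<in> carrier \<M>" and g: "?g \<in> carrier \<M>" using h k by simp_all
  fix \<gamma> assume \<gamma>: "\<gamma> \<in> \<A>"
  show "(?f \<star> ?g) \<gamma> = germ_section (s * t) ?M ?hk \<gamma>"
  proof (cases "\<gamma> \<in> germ D (s * t) ` ?M")
    case True
    then obtain x where x: "x \<in> L" "\<theta> t x \<in> K" "\<gamma> = germ D (s * t) x" by blast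
    have xD: "x \<in> D (star t)" "\<theta> t x \<in> D (star s)" using x h k section_data_D by blast+
    let ?\<beta> = "germ D s (\<theta> t x)" and ?\<rho> = "germ D t x"
    have \<gamma>': "\<gamma> = comp \<G> ?\<beta> ?\<rho>" using x xD by (simp add: comp_germ)
    have "(?f \<star> ?g) (comp \<G> ?\<beta> ?\<rho>) = fmult \<O> (?f ?\<beta>) (act \<O> ?\<beta> (?g ?\<rho>))"
    proof (rule convolution_eq_single[OF f g])
      fix \<alpha> assume a: "\<alpha> \<in> \<A>" "rng \<G> \<alpha> = rng \<G> ?\<beta>" "\<alpha> \<noteq> ?\<beta>"
      \<comment> \<open>The range map is injective on the bisection, so it meets the fibre of
        ?\<beta> only in ?\<beta>.\<close>
      have "\<alpha> \<notin> germ D s ` K"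
        using a inj_onD[OF inj_rng_germ[of K s] a(2)] x(2) h unfolding section_data_def by blast
      then show "?f \<alpha> = fzero \<O> (rng \<G> \<alpha>)
          \<or> ?g (comp \<G> (ginv \<G> \<alpha>) (comp \<G> ?\<beta> ?\<rho>)) = fzero \<O> (src \<G> \<alpha>)"
        using a by simp
    qed (use xD in \<open>simp_all add: src_germ rng_germ\<close>)
    also have "\<dots> = ?hk x" using x h k by simp
    also have "\<dots> = germ_section (s * t) ?M ?hk (germ D (s * t) x)"
      using x by (subst germ_section_germ[OF hk]) auto
    finally show ?thesis using \<gamma>' x(3) by simp
  next
    case False
    have "(?f \<star> ?g) \<gamma> = fzero \<O> (rng \<G> \<gamma>)"
    proof (rule convolution_eq_zero[OF f g \<gamma>], rule disjCI)
      fix \<beta> assume b: "\<beta> \<in> \<A>" "rng \<G> \<beta> = rng \<G> \<gamma>"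
      let ?\<rho> = "comp \<G> (ginv \<G> \<beta>) \<gamma>"
      have r: "?\<rho> \<in> \<A>" "src \<G> \<beta> = rng \<G> ?\<rho>" "comp \<G> \<beta> ?\<rho> = \<gamma>"
        using left_factor_iff[OF b(1) \<gamma> b(2)] by blast+
      assume "?g ?\<rho> \<noteq> fzero \<O> (src \<G> \<beta>)"
      then have "?\<rho> \<in> germ D t ` L" using germ_section_support[OF r(1), of t L k] r(2) by auto
      then obtain x where x: "x \<in> L" "?\<rho> = germ D t x" by blast
      have xD: "x \<in> D (star t)" using x k section_data_D by blast
      show "?f \<beta> = fzero \<O> (rng \<G> \<beta>)"
      proof (cases "\<beta> \<in> germ D s ` K")
        case True
        then obtain y where y: "y \<in> K" "\<beta> = germ D s y" by blast
        have yD: "y \<in> D (star s)" using y h section_data_D by blast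
        have "y = \<theta> t x" using r(2) x y xD yD by (simp add: src_germ rng_germ)
        then have "\<gamma> = germ D (s * t) x" using r(3) x y xD yD by (simp add: comp_germ)
        then show ?thesis using False x y \<open>y = _\<close> by blast
      qed (use b in simp)
    qed
    then show ?thesis using False \<gamma> by simp
  qed
qed

text \<open>Biadditivity reduces both arguments to generators in a nested induction, where
  \<open>germ_section_mult\<close> gives the product.\<close>

lemma Gamma_convolution:
  assumes f: "f \<in> carrier \<Gamma>" and g: "g \<in> carrier \<Gamma>" shows "f \<star> g \<in> carrier \<Gamma>"
  using f
proof (induction rule: Gamma_induct)
  case zero
  then show ?case using g Gamma_subset Gamma_zero by (simp add: convolution_zero_left)
next
  case (germ s K h)
  show ?case using g
  proof (induction rule: Gamma_induct)
    case zero
    then show ?case using germ Gamma_zero by (simp add: convolution_zero_right)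
  next
    case g: (germ t L k)
    then show ?case using germ section_data_mult[OF germ g] by (simp add: germ_section_mult)
  next
    case (neg g)
    then show ?case using germ Gamma_subset Gamma_neg by (simp add: convolution_neg_right)
  next
    case (add g g')
    then show ?case
      using germ Gamma_subset Gamma_add fibre_finite_Gamma by (simp add: convolution_add_right)
  qed
next
  case (neg f)
  then show ?case using g Gamma_subset Gamma_neg by (simp add: convolution_neg_left)
next
  case (add f f')
  then show ?case
    using g Gamma_subset Gamma_add fibre_finite_Gamma by (simp add: convolution_add_left)
qed

section \<open>Multiplication by sections supported on units\<close>

lemma section_data_idempotent:
  assumes "idempotent e" "compact_open_in X K" "K \<subseteq> D e" "local_section V \<tau>" "K \<subseteq> V"
  shows "section_data e K \<tau>"
proof -
  have "continuous_map (subtopology X K) (total \<O>) \<tau>"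
    using assms continuous_map_from_subtopology_mono by (auto simp: local_section_def)
  then show ?thesis
    using assms act_idempotent
    by (auto simp: section_data_def local_section_def star_idempotent subset_iff)
qed

text \<open>The left factor is supported on units, and the range fibre of \<gamma> contains only one
  unit, so a single term survives: cut down by range and multiply by \<tau> there.\<close>

lemma idempotent_section_mult:
  assumes e: "idempotent e" and \<tau>: "section_data e K \<tau>" and f: "f \<in> carrier \<M>" and \<gamma>: "\<gamma> \<in> \<A>"
  shows "(germ_section e K \<tau> \<star> f) \<gamma> =
    (if rng \<G> \<gamma> \<in> K then fmult \<O> (\<tau> (rng \<G> \<gamma>)) (f \<gamma>) else fzero \<O> (rng \<G> \<gamma>))"
proof -
  have KD: "K \<subseteq> D e" using \<tau> star_idempotent[OF e] by (simp add: section_data_def)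
  let ?u = "unit \<G> (rng \<G> \<gamma>)"
  have r: "rng \<G> \<gamma> \<in> topspace X" using \<gamma> by simp
  have supp: "\<beta> = ?u \<and> rng \<G> \<gamma> \<in> K"
    if "\<beta> \<in> \<A>" "rng \<G> \<beta> = rng \<G> \<gamma>" "germ_section e K \<tau> \<beta> \<noteq> fzero \<O> (rng \<G> \<beta>)" for \<beta>
  proof -
    have "\<beta> \<in> germ D e ` K" using that germ_section_support[of \<beta> e K \<tau>] by auto
    then obtain x where x: "x \<in> K" "\<beta> = germ D e x" by blast
    moreover have "x \<in> D e" using x KD by blast
    ultimately have "\<beta> = unit \<G> x" using e by (simp add: unit_germ)
    moreover have "x \<in> topspace X" using \<open>x \<in> D e\<close> D_subset by blast
    ultimately show ?thesis using that(2) x(1) by auto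
  qed
  show ?thesis
  proof (cases "rng \<G> \<gamma> \<in> K")
    case True
    have "(germ_section e K \<tau> \<star> f) (comp \<G> ?u \<gamma>) = fmult \<O> (germ_section e K \<tau> ?u) (act \<O> ?u (f \<gamma>))"
      by (rule convolution_eq_single) (use \<tau> f \<gamma> r supp in auto)
    moreover have "act \<O> ?u (f \<gamma>) = f \<gamma>"
      using act_unit[of "f \<gamma>"] section_stalk[OF f \<gamma>] by (simp add: in_stalk)
    moreover have "?u = germ D e (rng \<G> \<gamma>)" using True KD e by (simp add: unit_germ subsetD)
    moreover have "comp \<G> ?u \<gamma> = \<gamma>" using \<gamma> by simp
    ultimately show ?thesis using \<gamma> True \<tau> by simp
  next
    case False
    then have "(germ_section e K \<tau> \<star> f) \<gamma> = fzero \<O> (rng \<G> \<gamma>)"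
      using \<tau> f \<gamma> supp by (intro convolution_eq_zero) auto
    then show ?thesis using False by simp
  qed
qed

text \<open>The right factor of the surviving term is the unit at the source of \<gamma>, so \<beta>
  = \<gamma>. The coefficient is transported by \<gamma>, which fixes 1 because the action is
  unital; hence right multiplication only cuts down by source.\<close>

lemma mult_idempotent_section:
  assumes e: "idempotent e" and one: "section_data e K (fone \<O>)" and f: "f \<in> carrier \<M>" and \<gamma>: "\<gamma> \<in> \<A>"
  shows "(f \<star> germ_section e K (fone \<O>)) \<gamma> = (if src \<G> \<gamma> \<in> K then f \<gamma> else fzero \<O> (rng \<G> \<gamma>))"
proof -
  have KD: "K \<subseteq> D e" using one star_idempotent[OF e] by (simp add: section_data_def)
  let ?u = "unit \<G> (src \<G> \<gamma>)" and ?g = "germ_section e K (fone \<O>)"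
  have supp: "\<beta> = \<gamma> \<and> src \<G> \<gamma> \<in> K"
    if b: "\<beta> \<in> \<A>" "rng \<G> \<beta> = rng \<G> \<gamma>" and "?g (comp \<G> (ginv \<G> \<beta>) \<gamma>) \<noteq> fzero \<O> (src \<G> \<beta>)" for \<beta>
  proof -
    let ?\<rho> = "comp \<G> (ginv \<G> \<beta>) \<gamma>"
    have r: "?\<rho> \<in> \<A>" "src \<G> \<beta> = rng \<G> ?\<rho>" "comp \<G> \<beta> ?\<rho> = \<gamma>"
      using left_factor_iff[OF b(1) \<gamma> b(2)] by blast+
    have "?\<rho> \<in> germ D e ` K" using that(3) germ_section_support[OF r(1), of e K] r(2) by auto
    then obtain x where x: "x \<in> K" "?\<rho> = germ D e x" by blast
    have xD: "x \<in> D e" using x(1) KD by blast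
    then have u: "?\<rho> = unit \<G> x" using x(2) e by (simp add: unit_germ)
    have xX: "x \<in> topspace X" using xD D_subset by blast
    have "src \<G> \<beta> = x" using r(2) u xX by simp
    then have "\<gamma> = \<beta>" using r(3) u comp_unit_right[OF b(1)] by simp
    then show ?thesis using \<open>src \<G> \<beta> = x\<close> x(1) by simp
  qed
  show ?thesis
  proof (cases "src \<G> \<gamma> \<in> K")
    case True
    have "(f \<star> ?g) (comp \<G> \<gamma> ?u) = fmult \<O> (f \<gamma>) (act \<O> \<gamma> (?g ?u))"
      by (rule convolution_eq_single) (use one f \<gamma> supp in auto)
    moreover have "?u = germ D e (src \<G> \<gamma>)" using True KD e by (simp add: unit_germ subsetD)
    moreover have "comp \<G> \<gamma> ?u = \<gamma>" using \<gamma> by simp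
    ultimately show ?thesis using \<gamma> True one f by simp
  next
    case False
    then have "(f \<star> ?g) \<gamma> = fzero \<O> (rng \<G> \<gamma>)"
      using one f \<gamma> supp by (intro convolution_eq_zero) auto
    then show ?thesis using False by simp
  qed
qed

section \<open>Simplicity and minimality\<close>

text \<open>Moves the subgroup condition from the convolution ring to the ambient group of all range
  sections, where the pointwise calculations take place.\<close>

lemma two_sided_ideal_Gamma_iff:
  "two_sided_ideal I \<Gamma> \<longleftrightarrow> subgroup I (add_monoid \<M>) \<and> I \<subseteq> carrier \<Gamma>
     \<and> (\<forall>f \<in> I. \<forall>g \<in> carrier \<Gamma>. g \<star> f \<in> I \<and> f \<star> g \<in> I)"
proof -
  have *: "add_monoid \<Gamma> = (add_monoid \<M>) \<lparr> carrier := carrier \<Gamma> \<rparr>" by (simp add: Gamma_c_def)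
  have "subgroup I (add_monoid \<Gamma>) \<longleftrightarrow> subgroup I (add_monoid \<M>) \<and> I \<subseteq> carrier \<Gamma>"
    unfolding *
    using group.incl_subgroup[OF sections.a_group subgroup_Gamma, of I]
      group.subgroup_incl[OF sections.a_group _ subgroup_Gamma, of I]
      subgroup.subset[of I "(add_monoid \<M>) \<lparr> carrier := carrier \<Gamma> \<rparr>"] by auto
  then show ?thesis
    unfolding two_sided_ideal_def additive_subgroup_def Gamma_simps by blast
qed

lemma section_data_mono:
  "section_data s K h \<Longrightarrow> compact_open_in X C \<Longrightarrow> C \<subseteq> K \<Longrightarrow> section_data s C h"
  by (auto simp: section_data_def intro: continuous_map_from_subtopology_mono)

lemma germ_section_cong: "(\<And>x. x \<in> K \<Longrightarrow> h x = k x) \<Longrightarrow> K \<subseteq> D (star s)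
    \<Longrightarrow> germ_section s K h = germ_section s K k"
  by (auto simp: germ_section_def src_germ subset_iff intro!: restrict_ext)

text \<open>The characteristic function of the bisection (s, K), with the 1 taken in the stalk over
  the range. Multiplying by these transports sections along \<open>s\<close>.\<close>

lemma section_data_fone:
  assumes "compact_open_in X K" "K \<subseteq> D (star s)"
  shows "section_data s K (\<lambda>x. fone \<O> (\<theta> s x))"
proof -
  have "continuous_map (subtopology X K) (total \<O>) (fone \<O> \<circ> \<theta> s)"
    using continuous_map_compose[OF continuous_map_from_subtopology_mono[OF continuous_act assms(2)]
      fone_continuous[unfolded objs_germs]] .
  moreover have "proj \<O> (fone \<O> (\<theta> s x)) = \<theta> s x" if "x \<in> K" for x
  proof -
    have "\<theta> s x \<in> topspace X" using that assms(2) act_in_D D_subset by blast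
    then show ?thesis using fone_closed in_stalk by blast
  qed
  ultimately show ?thesis using assms by (simp add: section_data_def o_def)
qed

lemma section_data_unit:
  "idempotent e \<Longrightarrow> compact_open_in X K \<Longrightarrow> K \<subseteq> D e \<Longrightarrow> section_data e K (fone \<O>)"
  by (rule section_data_idempotent[of e K "topspace X"])
    (use D_subset in \<open>auto intro: local_section_fone\<close>)

lemma unit_section_exists:
  assumes "openin X W" "x \<in> W"
  obtains e K where "idempotent e" "x \<in> K" "K \<subseteq> W" "K \<subseteq> D e" "compact_open_in X K"
    "section_data e K (fone \<O>)"
proof -
  have "x \<in> topspace X" using assms openin_subset by blast
  then obtain e where e: "idempotent e" "x \<in> D e" by (elim exists_idempotent)
  have "openin X (W \<inter> D e)" using assms open_D by blast
  then obtain K where K: "compact_open_in X K" "x \<in> K" "K \<subseteq> W \<inter> D e"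
    using assms e by (elim compact_open_nbhd) auto
  show thesis
    by (rule that[of e K]) (use e K section_data_unit in auto)
qed

section \<open>Moving elements inside an ideal\<close>

text \<open>On a piece of \<open>L\<close> whose points \<theta>_s sends into one such
  \<open>K\<close>, left multiplication by the local unit 1_K fixes the section, so the piece lies
  in the ideal; \<open>compact_open_in_induct\<close> adds the pieces up.\<close>

lemma ideal_mem_germ_section:
  assumes I: "two_sided_ideal I \<Gamma>" and h: "section_data s L h"
    and U: "\<And>x. x \<in> L \<Longrightarrow> \<exists>e K. idempotent e \<and> section_data e K (fone \<O>) \<and> \<theta> s x \<in> K
      \<and> germ_section e K (fone \<O>) \<in> I"
  shows "germ_section s L h \<in> I"
proof -
  have Isub: "subgroup I (add_monoid \<M>)" and Iconv: "\<And>f g. f \<in> I \<Longrightarrow> g \<in> carrier \<Gamma> \<Longrightarrow> f \<star> g \<in> I"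
    using I unfolding two_sided_ideal_Gamma_iff by blast+
  have L: "compact_open_in X L" "L \<subseteq> D (star s)" using h by (simp_all add: section_data_def)
  have data: "section_data s C h" if "compact_open_in X C" "C \<subseteq> L" for C
    using section_data_mono[OF h that] .
  show ?thesis using Hausdorff_X L(1)
  proof (induction rule: compact_open_in_induct)
    case empty
    have "germ_section s {} h = \<zero>\<^bsub>\<M>\<^esub>"
      by (rule sections_eqI) (simp_all add: section_data_empty zero_sections_closed)
    then show ?case using subgroup.one_closed[OF Isub] by simp
  next
    case (disjoint_union A B)
    have AB: "compact_open_in X (A \<union> B)"
      using disjoint_union(1,2) by (simp add: compact_open_in_Hausdorff Hausdorff_X compactin_Un openin_Un)
    have ab: "section_data s A h" "section_data s B h" "section_data s (A \<union> B) h"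
      using disjoint_union AB by (auto intro: data)
    have "germ_section s (A \<union> B) h = germ_section s A h \<oplus>\<^bsub>\<M>\<^esub> germ_section s B h"
    proof (rule sections_eqI)
      fix \<gamma> assume \<gamma>: "\<gamma> \<in> \<A>"
      consider x where "x \<in> A" "\<gamma> = germ D s x" | x where "x \<in> B" "\<gamma> = germ D s x"
        | "\<gamma> \<notin> germ D s ` (A \<union> B)" by blast
      then show "germ_section s (A \<union> B) h \<gamma> = (germ_section s A h \<oplus>\<^bsub>\<M>\<^esub> germ_section s B h) \<gamma>"
      proof cases
        case (1 x)
        then have x: "x \<in> D (star s)" using ab(1) section_data_D by blast
        have "germ D s x \<notin> germ D s ` B"
        proof
          assume "germ D s x \<in> germ D s ` B"
          then obtain y where "y \<in> B" "germ D s x = germ D s y" by blast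
          then show False using 1 x disjoint_union(5) ab(2) section_data_D germ_eq_iff by blast
        qed
        then have "germ_section s B h \<gamma> = fzero \<O> (\<theta> s x)" using 1 x \<gamma> by (simp add: rng_germ)
        moreover have "h x \<in> \<S> (\<theta> s x)" "\<theta> s x \<in> topspace X"
          using 1 x ab(1) section_data_stalk act_in_D D_subset by blast+
        ultimately show ?thesis using 1 ab \<gamma> by simp
      next
        case (2 x)
        then have x: "x \<in> D (star s)" using ab(2) section_data_D by blast
        have "germ D s x \<notin> germ D s ` A"
        proof
          assume "germ D s x \<in> germ D s ` A"
          then obtain y where "y \<in> A" "germ D s x = germ D s y" by blast
          then show False using 2 x disjoint_union(5) ab(1) section_data_D germ_eq_iff by blast
        qed
        then have "germ_section s A h \<gamma> = fzero \<O> (\<theta> s x)" using 2 x \<gamma> by (simp add: rng_germ)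
        moreover have "h x \<in> \<S> (\<theta> s x)" "\<theta> s x \<in> topspace X"
          using 2 x ab(2) section_data_stalk act_in_D D_subset by blast+
        ultimately show ?thesis using 2 ab \<gamma> by simp
      next
        case 3
        then have "\<gamma> \<notin> germ D s ` A" "\<gamma> \<notin> germ D s ` B" by blast+
        then show ?thesis using 3 \<gamma> by simp
      qed
    qed (use ab in \<open>simp_all add: add_sections_closed\<close>)
    then show ?case using subgroup.m_closed[OF Isub disjoint_union(6,7)] by simp
  next
    case (local y)
    then obtain e K where K: "idempotent e" "section_data e K (fone \<O>)" "\<theta> s y \<in> K"
      "germ_section e K (fone \<O>) \<in> I" using U by blast
    show ?case
    proof (intro exI[of _ "{x \<in> L. \<theta> s x \<in> K}"] conjI allI impI)
      \<comment> \<open>This set is the domain of the product of the local unit on \<open>K\<close>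
        with the given section, so \<open>section_data_mult\<close> already provides its compact
        openness.\<close>
      show "compact_open_in X {x \<in> L. \<theta> s x \<in> K}"
        using section_data_mult[OF K(2) h] by (simp add: section_data_def)
      show "y \<in> {x \<in> L. \<theta> s x \<in> K}" using local K by simp
      fix C assume C: "compact_open_in X C" "C \<subseteq> {x \<in> L. \<theta> s x \<in> K}" "C \<subseteq> L"
      have c: "section_data s C h" using data C by blast
      have "germ_section e K (fone \<O>) \<star> germ_section s C h = germ_section s C h"
      proof (rule sections_eqI)
        fix \<gamma> assume \<gamma>: "\<gamma> \<in> \<A>"
        show "(germ_section e K (fone \<O>) \<star> germ_section s C h) \<gamma> = germ_section s C h \<gamma>"
        proof (cases "rng \<G> \<gamma> \<in> K")
          case True
          then show ?thesis
            using idempotent_section_mult[OF K(1,2) germ_section_in_sections[OF c] \<gamma>] \<gamma> c by simp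
        next
          case False
          have "\<gamma> \<notin> germ D s ` C"
          proof
            assume "\<gamma> \<in> germ D s ` C"
            then obtain x where "x \<in> C" "\<gamma> = germ D s x" by blast
            then show False using False C(2) c section_data_D by (auto simp: rng_germ)
          qed
          then show ?thesis
            using idempotent_section_mult[OF K(1,2) germ_section_in_sections[OF c] \<gamma>] \<gamma> False by simp
        qed
      qed (use c K(2) in \<open>simp_all add: convolution_closed\<close>)
      then show "germ_section s C h \<in> I" using Iconv[OF K(4) germ_section_in_Gamma[OF c]] by simp
    qed
  qed
qed

text \<open>Conjugation by a bisection: multiply 1_K on the left by the characteristic function of
  (s, M), which absorbs 1_K when \<open>M\<close> lies in \<open>K\<close>, and then on the right by
  that of the inverse bisection. The result is the local unit on \<theta>_s(M).\<close>

lemma ideal_translate: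
  assumes I: "two_sided_ideal I \<Gamma>" and e: "idempotent e" and K: "section_data e K (fone \<O>)"
    and KI: "germ_section e K (fone \<O>) \<in> I" and x: "x \<in> K" "x \<in> D (star s)"
  obtains f L where "idempotent f" "section_data f L (fone \<O>)" "\<theta> s x \<in> L"
    "germ_section f L (fone \<O>) \<in> I"
proof -
  have Iconv: "g \<star> f \<in> I" "f \<star> g \<in> I" if "f \<in> I" "g \<in> carrier \<Gamma>" for f g
    using I that unfolding two_sided_ideal_Gamma_iff by blast+
  have "openin X (K \<inter> D (star s))" using K open_D by (auto simp: section_data_def compact_open_in_def)
  then obtain M where M: "compact_open_in X M" "x \<in> M" "M \<subseteq> K \<inter> D (star s)"
    using x by (elim compact_open_nbhd) auto
  have MD: "M \<subseteq> D (star s)" using M by blast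
  let ?L = "\<theta> s ` M" and ?h = "\<lambda>x. fone \<O> (\<theta> s x)" and ?k = "\<lambda>y. fone \<O> (\<theta> (star s) y)"
  have LD: "?L \<subseteq> D s" using MD act_in_D by auto
  have L: "compact_open_in X ?L"
    using M(1) MD openin_act_image compactin_act_image by (simp add: compact_open_in_Hausdorff Hausdorff_X)
  have h: "section_data s M ?h" using section_data_fone[OF M(1) MD] .
  have k: "section_data (star s) ?L ?k"
    using section_data_fone[OF L, of "star s"] LD by (simp add: star_star)
  have "germ_section s M ?h \<star> germ_section e K (fone \<O>) = germ_section s M ?h"
  proof (rule sections_eqI)
    fix \<gamma> assume \<gamma>: "\<gamma> \<in> \<A>"
    show "(germ_section s M ?h \<star> germ_section e K (fone \<O>)) \<gamma> = germ_section s M ?h \<gamma>"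
    proof (cases "\<gamma> \<in> germ D s ` M")
      case True
      then obtain y where "y \<in> M" "\<gamma> = germ D s y" by blast
      then have "src \<G> \<gamma> \<in> K" using M(3) by (auto simp: src_germ subset_iff)
      then show ?thesis
        using mult_idempotent_section[OF e K germ_section_in_sections[OF h] \<gamma>] by simp
    next
      case False
      then show ?thesis
        using mult_idempotent_section[OF e K germ_section_in_sections[OF h] \<gamma>] \<gamma> by simp
    qed
  qed (use h K in \<open>simp_all add: convolution_closed\<close>)
  then have hI: "germ_section s M ?h \<in> I"
    using Iconv(1)[OF KI germ_section_in_Gamma[OF h]] by simp
  have inv: "\<theta> (star s) y \<in> M" if "y \<in> ?L" for y
    using that MD by auto
  have M': "{y \<in> ?L. \<theta> (star s) y \<in> M} = ?L" using inv by blast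
  have "germ_section s M ?h \<star> germ_section (star s) ?L ?k = germ_section (s * star s) ?L
      (\<lambda>y. fmult \<O> (fone \<O> (\<theta> s (\<theta> (star s) y))) (act \<O> (germ D s (\<theta> (star s) y)) (?k y)))"
    using germ_section_mult[OF h k] unfolding M' .
  also have "\<dots> = germ_section (s * star s) ?L (fone \<O>)"
  proof (rule germ_section_cong)
    show "?L \<subseteq> D (star (s * star s))"
      using LD by (simp add: star_idempotent[OF idempotent_mult_star] D_mult_star)
    fix y assume y: "y \<in> ?L"
    then have yD: "y \<in> D s" "\<theta> (star s) y \<in> D (star s)" "y \<in> topspace X"
      using LD inv MD D_subset by blast+
    then show "fmult \<O> (fone \<O> (\<theta> s (\<theta> (star s) y))) (act \<O> (germ D s (\<theta> (star s) y)) (?k y)) = fone \<O> y"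
      using act_fone[of "germ D s (\<theta> (star s) y)"] by (simp add: src_germ rng_germ)
  qed
  finally have "germ_section (s * star s) ?L (fone \<O>) \<in> I"
    using Iconv(2)[OF hI germ_section_in_Gamma[OF k]] by simp
  moreover have "section_data (s * star s) ?L (fone \<O>)"
    by (rule section_data_unit[OF idempotent_mult_star L]) (use LD in \<open>simp add: D_mult_star\<close>)
  ultimately show thesis
    using that[OF idempotent_mult_star] M(2) by blast
qed

lemma ginv_ginv [simp]: "\<gamma> \<in> \<A> \<Longrightarrow> ginv \<G> (ginv \<G> \<gamma>) = \<gamma>"
  by (elim arrowE) (simp add: ginv_germ act_in_D star_star)

text \<open>Right multiplication by the characteristic function of a bisection containing the
  inverse of \<gamma> shifts the value of \<open>f\<close> at \<gamma> to the unit at its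
  range.\<close>

lemma ideal_nonzero_on_units:
  assumes I: "two_sided_ideal I \<Gamma>" and f: "f \<in> I" and \<gamma>: "\<gamma> \<in> \<A>" "f \<gamma> \<noteq> fzero \<O> (rng \<G> \<gamma>)"
  obtains g where "g \<in> I" "g (unit \<G> (rng \<G> \<gamma>)) \<noteq> fzero \<O> (rng \<G> \<gamma>)"
proof -
  have fM: "f \<in> carrier \<M>"
    using I f Gamma_subset unfolding two_sided_ideal_Gamma_iff by blast
  have Iconv: "f \<star> g \<in> I" if "g \<in> carrier \<Gamma>" for g
    using I f that unfolding two_sided_ideal_Gamma_iff by blast
  obtain s x where x: "x \<in> D (star s)" "\<gamma> = germ D s x" using \<gamma> by (elim arrowE)
  obtain K where K: "compact_open_in X K" "x \<in> K" "K \<subseteq> D (star s)"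
    using compact_open_nbhd[OF open_D x(1)] .
  let ?L = "\<theta> s ` K" and ?k = "\<lambda>y. fone \<O> (\<theta> (star s) y)"
  have L: "compact_open_in X ?L"
    using K openin_act_image compactin_act_image by (simp add: compact_open_in_Hausdorff Hausdorff_X)
  have LD: "?L \<subseteq> D (star (star s))" using K act_in_D by (auto simp: star_star)
  have k: "section_data (star s) ?L ?k" using section_data_fone[OF L LD] .
  let ?g = "germ_section (star s) ?L ?k"
  have inv: "ginv \<G> \<gamma> = germ D (star s) (\<theta> s x)" using x by (simp add: ginv_germ)
  have "(f \<star> ?g) (comp \<G> \<gamma> (ginv \<G> \<gamma>)) = fmult \<O> (f \<gamma>) (act \<O> \<gamma> (?g (ginv \<G> \<gamma>)))"
  proof (rule convolution_eq_single[OF fM germ_section_in_sections[OF k] \<gamma>(1)], goal_cases)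
    case (3 \<alpha>)
    \<comment> \<open>The right factor belonging to \<alpha> is its inverse, which has the same
      source as the inverse of \<gamma>. As \<open>src\<close> is injective on the bisection, only
      \<alpha> = \<gamma> can contribute.\<close>
    have u: "comp \<G> (ginv \<G> \<alpha>) (comp \<G> \<gamma> (ginv \<G> \<gamma>)) = ginv \<G> \<alpha>"
      using \<gamma> 3 comp_unit_right[of "ginv \<G> \<alpha>"] by simp
    have "ginv \<G> \<alpha> \<notin> germ D (star s) ` ?L"
    proof
      assume a: "ginv \<G> \<alpha> \<in> germ D (star s) ` ?L"
      have "ginv \<G> \<gamma> \<in> germ D (star s) ` ?L" using inv K(2) by blast
      moreover have "src \<G> (ginv \<G> \<alpha>) = src \<G> (ginv \<G> \<gamma>)" using 3 \<gamma> by simp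
      ultimately have "ginv \<G> \<alpha> = ginv \<G> \<gamma>" using inj_onD[OF inj_src_germ[OF LD]] a by blast
      then have "\<alpha> = \<gamma>" using ginv_ginv 3(1) \<gamma>(1) by metis
      then show False using 3 by simp
    qed
    then show ?case using 3 u by simp
  qed (use \<gamma> in simp_all)
  also have "?g (ginv \<G> \<gamma>) = fone \<O> (src \<G> \<gamma>)"
    unfolding inv using germ_section_germ[OF k, of "\<theta> s x"] K(2) x by (simp add: src_germ)
  finally have "(f \<star> ?g) (unit \<G> (rng \<G> \<gamma>)) = f \<gamma>" using \<gamma> fM by simp
  then show thesis using that[OF Iconv[OF germ_section_in_Gamma[OF k]]] \<gamma> by simp
qed

section \<open>Elements of the ring on and off the units\<close>

text \<open>A generator restricted to the units is \<open>h\<close> on the points of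
  \<open>K\<close> where [s, y] is a unit, and zero elsewhere. Both regions are open, so each point
  has a neighbourhood inside one of them; negatives and sums are then handled by local
  sections.\<close>

lemma Gamma_on_units:
  assumes "f \<in> carrier \<Gamma>" "x \<in> topspace X"
  obtains V \<sigma> where "local_section V \<sigma>" "x \<in> V" "\<And>y. y \<in> V \<Longrightarrow> f (unit \<G> y) = \<sigma> y"
proof -
  have "\<exists>V \<sigma>. local_section V \<sigma> \<and> x \<in> V \<and> (\<forall>y \<in> V. f (unit \<G> y) = \<sigma> y)" using assms(1)
  proof (induction rule: Gamma_induct)
    case zero
    show ?case
      using assms(2) openin_subset local_section_fzero[of "topspace X"]
      by (intro exI[of _ "topspace X"] exI[of _ "fzero \<O>"]) simp
  next
    case (germ s K h)
    have K: "compact_open_in X K" "K \<subseteq> D (star s)" "continuous_map (subtopology X K) (total \<O>) h"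
      using germ by (auto simp: section_data_def)
    have KX: "K \<subseteq> topspace X" and Kcl: "closedin X K"
      using K(1) compactin_imp_closedin[OF Hausdorff_X] openin_subset[of X K]
      by (auto simp: compact_open_in_def)
    \<comment> \<open>Closed because it is where two continuous maps into the Hausdorff arrow space
      agree. Without this the zero value off \<open>F\<close> need not be a local section near a
      limit point of \<open>F\<close>.\<close>
    define F where "F = {y \<in> K. germ D s y = unit \<G> y}"
    have "closedin (subtopology X K) {y \<in> topspace (subtopology X K). germ D s y = unit \<G> y}"
      using closedin_continuous_maps_eq[OF Hausdorff_arrows
        continuous_map_from_subtopology_mono[OF continuous_germ K(2)]
        continuous_map_from_subtopology[OF continuous_unit]] .
    moreover have "{y \<in> topspace (subtopology X K). germ D s y = unit \<G> y} = F"
      using KX by (auto simp: F_def)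
    ultimately have "closedin X F" using Kcl closedin_trans_full by metis
    then have o: "openin X (topspace X - F)" by blast
    show ?case
    proof (cases "x \<in> F")
      case True
      have "F = (\<Union>e \<in> {e. idempotent e \<and> natural_le e s}. K \<inter> D e)"
        using K(2) germ_eq_unit_iff by (auto simp: F_def subset_iff)
      moreover have "openin X \<dots>" using K(1) open_D by (auto simp: compact_open_in_def)
      ultimately have F: "openin X F" by simp
      have FK: "F \<subseteq> K" by (auto simp: F_def)
      \<comment> \<open>When [s, y] is a unit its range is \<open>y\<close>, so the value of
        \<open>h\<close>, taken over \<theta>_s(y), is indeed over \<open>y\<close>.\<close>
      have hF: "h y \<in> \<S> y" if "y \<in> F" for y
      proof -
        have y: "y \<in> K" "germ D s y = unit \<G> y" "y \<in> D (star s)" "y \<in> topspace X"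
          using that K(2) KX by (auto simp: F_def)
        then have "\<theta> s y = y" using rng_germ[OF y(3)] by simp
        then show ?thesis using section_data_stalk[OF germ y(1)] by simp
      qed
      have "local_section F h"
        by (rule local_sectionI[OF F continuous_map_from_subtopology_mono[OF K(3) FK] hF])
      moreover have "germ_section s K h (unit \<G> y) = h y" if "y \<in> F" for y
        using that germ_section_germ[OF germ, of y] by (simp add: F_def)
      ultimately show ?thesis using True by blast
    next
      case False
      have "germ_section s K h (unit \<G> y) = fzero \<O> y" if y: "y \<in> topspace X - F" for y
      proof -
        have "unit \<G> y \<notin> germ D s ` K"
        proof
          assume "unit \<G> y \<in> germ D s ` K"
          then obtain z where z: "z \<in> K" "unit \<G> y = germ D s z" by blast
          then have "z \<in> D (star s)" using K(2) by blast
          then have "y = z" using z(2) src_germ[of z s] src_unit[of y] y by simp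
          then show False using z y by (simp add: F_def)
        qed
        then show ?thesis using y by simp
      qed
      then show ?thesis using local_section_fzero[OF o] assms(2) False by blast
    qed
  next
    case (neg f)
    then obtain V \<sigma> where V: "local_section V \<sigma>" "x \<in> V" "\<forall>y \<in> V. f (unit \<G> y) = \<sigma> y" by blast
    obtain N \<tau> where N: "local_section N \<tau>" "x \<in> N" "N \<subseteq> V"
      "\<And>y. y \<in> N \<Longrightarrow> \<tau> y = a_inv (stalk \<O> y) (\<sigma> y)"
      using local_section_fneg[OF V(1,2)] by metis
    have "(\<ominus>\<^bsub>\<M>\<^esub> f) (unit \<G> y) = \<tau> y" if "y \<in> N" for y
    proof -
      have "y \<in> topspace X" "y \<in> V" using local_section_topspace[OF N(1) that] that N(3) by auto
      then show ?thesis using N(4)[OF that] V(3) Gamma_subset[OF neg(1)] by simp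
    qed
    then show ?case using N by blast
  next
    case (add f g)
    then obtain V \<sigma> W \<tau> where V: "local_section V \<sigma>" "x \<in> V" "\<forall>y \<in> V. f (unit \<G> y) = \<sigma> y"
      and W: "local_section W \<tau>" "x \<in> W" "\<forall>y \<in> W. g (unit \<G> y) = \<tau> y" by blast
    have o: "openin X (V \<inter> W)" using V W by (auto simp: local_section_def)
    have s: "local_section (V \<inter> W) (\<lambda>y. fadd \<O> (\<sigma> y) (\<tau> y))"
      by (rule local_section_fadd[OF local_section_mono[OF V(1) o] local_section_mono[OF W(1) o]]) auto
    have "(f \<oplus>\<^bsub>\<M>\<^esub> g) (unit \<G> y) = fadd \<O> (\<sigma> y) (\<tau> y)" if "y \<in> V \<inter> W" for y
      using that V(3) W(3) local_section_topspace[OF s that] by simp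
    then show ?case using s V(2) W(2) by blast
  qed
  then show thesis using that by blast
qed

text \<open>Topological freeness says that a germ section is either supported on units near a given point
  or moves some nearby point; in both cases it vanishes off the units over a small open set.\<close>
lemma Gamma_off_units:
  assumes free: "topologically_free X D \<theta>" and f: "f \<in> carrier \<Gamma>" and "openin X W" "W \<noteq> {}"
  obtains V where "openin X V" "V \<noteq> {}" "V \<subseteq> W"
    "\<And>\<gamma>. \<lbrakk>\<gamma> \<in> \<A>; src \<G> \<gamma> \<in> V; rng \<G> \<gamma> \<in> V; \<gamma> \<noteq> unit \<G> (src \<G> \<gamma>)\<rbrakk> \<Longrightarrow> f \<gamma> = fzero \<O> (rng \<G> \<gamma>)"
proof -
  \<comment> \<open>\<open>W\<close> is quantified inside the induction: in the case of a sum, the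
    set found for \<open>f\<close> is passed on as the open set in which to look for
    \<open>g\<close>.\<close>
  have "\<forall>W. openin X W \<and> W \<noteq> {} \<longrightarrow> (\<exists>V. openin X V \<and> V \<noteq> {} \<and> V \<subseteq> W \<and>
      (\<forall>\<gamma> \<in> \<A>. src \<G> \<gamma> \<in> V \<longrightarrow> rng \<G> \<gamma> \<in> V \<longrightarrow> \<gamma> \<noteq> unit \<G> (src \<G> \<gamma>) \<longrightarrow> f \<gamma> = fzero \<O> (rng \<G> \<gamma>)))"
    using f
  proof (induction rule: Gamma_induct)
    case zero
    show ?case by auto
  next
    case (germ s K h)
    have K: "compact_open_in X K" "K \<subseteq> D (star s)" using germ by (auto simp: section_data_def)
    have Kcl: "closedin X K" using K(1) Hausdorff_X compactin_imp_closedin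
      by (auto simp: compact_open_in_def)
    show ?case
    proof (intro allI impI, elim conjE)
      fix W assume W: "openin X W" "W \<noteq> {}"
      have vanish: "germ_section s K h \<gamma> = fzero \<O> (rng \<G> \<gamma>)"
        if \<gamma>: "\<gamma> \<in> \<A>" and n: "\<And>x. x \<in> K \<Longrightarrow> \<gamma> \<noteq> germ D s x" for \<gamma>
        using germ_section_outside[OF \<gamma>, of s K h] n by blast
      \<comment> \<open>If \<open>W\<close> leaves \<open>K\<close>, the closed set \<open>K\<close>
        can be removed from it. Otherwise either some point of \<open>W\<close> is moved by
        \<theta>_s, or all of \<open>W\<close> is fixed and topological freeness applies.\<close>
      consider "\<not> W \<subseteq> K" | y where "W \<subseteq> K" "y \<in> W" "\<theta> s y \<noteq> y" | "W \<subseteq> K" "\<forall>y \<in> W. \<theta> s y = y"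
        by blast
      then show "\<exists>V. openin X V \<and> V \<noteq> {} \<and> V \<subseteq> W \<and> (\<forall>\<gamma> \<in> \<A>. src \<G> \<gamma> \<in> V \<longrightarrow> rng \<G> \<gamma> \<in> V
          \<longrightarrow> \<gamma> \<noteq> unit \<G> (src \<G> \<gamma>) \<longrightarrow> germ_section s K h \<gamma> = fzero \<O> (rng \<G> \<gamma>))"
      proof cases
        case 1
        have "germ_section s K h \<gamma> = fzero \<O> (rng \<G> \<gamma>)" if "\<gamma> \<in> \<A>" "src \<G> \<gamma> \<in> W - K" for \<gamma>
        proof (rule vanish[OF that(1)])
          fix x assume "x \<in> K"
          then show "\<gamma> \<noteq> germ D s x" using that(2) K(2) by (auto simp: src_germ subset_iff)
        qed
        moreover have "openin X (W - K)" using W(1) Kcl by blast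
        ultimately show ?thesis using 1 by (intro exI[of _ "W - K"]) auto
      next
        case 2
        have y: "y \<in> D (star s)" using 2 K by blast
        then have "y \<in> topspace X" "\<theta> s y \<in> topspace X" using act_in_D D_subset by blast+
        then obtain A B where AB: "openin X A" "openin X B" "y \<in> A" "\<theta> s y \<in> B" "disjnt A B"
          using Hausdorff_X 2(3) unfolding Hausdorff_space_def by metis
        \<comment> \<open>\<open>V\<close> lies in \<open>A\<close> and \<theta>_s maps it into the
          disjoint set \<open>B\<close>, so no germ of \<open>s\<close> both starts and ends in
          \<open>V\<close>.\<close>
        define V where "V = W \<inter> A \<inter> {z \<in> D (star s). \<theta> s z \<in> B}"
        have "openin X V" unfolding V_def using W AB openin_act_vimage by blast
        moreover have "y \<in> V" using 2 AB y by (simp add: V_def)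
        moreover have "germ_section s K h \<gamma> = fzero \<O> (rng \<G> \<gamma>)"
          if "\<gamma> \<in> \<A>" "src \<G> \<gamma> \<in> V" "rng \<G> \<gamma> \<in> V" for \<gamma>
        proof (rule vanish[OF that(1)])
          fix x assume x: "x \<in> K"
          show "\<gamma> \<noteq> germ D s x"
          proof
            assume "\<gamma> = germ D s x"
            moreover have "x \<in> D (star s)" using x K by blast
            ultimately have "x \<in> V" "\<theta> s x \<in> V" using that(2,3) by (simp_all add: src_germ rng_germ)
            then show False using AB(5) by (auto simp: V_def disjnt_iff)
          qed
        qed
        ultimately show ?thesis by (intro exI[of _ V]) (auto simp: V_def)
      next
        case 3
        \<comment> \<open>An open set of fixed points lies in the interior, hence by freeness every
          germ of \<open>s\<close> starting in \<open>W\<close> is a unit.\<close>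
        have "W \<subseteq> X interior_of {x \<in> D (star s). \<theta> s x = x}"
          using 3 K W(1) by (intro interior_of_maximal) auto
        then have u: "\<exists>e. idempotent e \<and> natural_le e s \<and> x \<in> D e" if "x \<in> W" for x
          using that free unfolding topologically_free_def by blast
        have "germ_section s K h \<gamma> = fzero \<O> (rng \<G> \<gamma>)"
          if "\<gamma> \<in> \<A>" "src \<G> \<gamma> \<in> W" "\<gamma> \<noteq> unit \<G> (src \<G> \<gamma>)" for \<gamma>
        proof (rule vanish[OF that(1)])
          fix x assume x: "x \<in> K"
          show "\<gamma> \<noteq> germ D s x"
          proof
            assume g: "\<gamma> = germ D s x"
            have xD: "x \<in> D (star s)" using x K by blast
            then have "src \<G> \<gamma> = x" using g src_germ by simp
            then show False using that(2,3) u germ_eq_unit_iff[OF xD] g by simp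
          qed
        qed
        then show ?thesis using W by blast
      qed
    qed
  next
    case (neg f)
    show ?case
    proof (intro allI impI)
      fix W assume "openin X W \<and> W \<noteq> {}"
      then obtain V where V: "openin X V" "V \<noteq> {}" "V \<subseteq> W" "\<forall>\<gamma> \<in> \<A>. src \<G> \<gamma> \<in> V \<longrightarrow> rng \<G> \<gamma> \<in> V
          \<longrightarrow> \<gamma> \<noteq> unit \<G> (src \<G> \<gamma>) \<longrightarrow> f \<gamma> = fzero \<O> (rng \<G> \<gamma>)"
        using neg(2) by meson
      have "\<forall>\<gamma> \<in> \<A>. src \<G> \<gamma> \<in> V \<longrightarrow> rng \<G> \<gamma> \<in> V
          \<longrightarrow> \<gamma> \<noteq> unit \<G> (src \<G> \<gamma>) \<longrightarrow> (\<ominus>\<^bsub>\<M>\<^esub> f) \<gamma> = fzero \<O> (rng \<G> \<gamma>)"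
        using V(4) Gamma_subset[OF neg(1)] by (simp add: a_inv_fzero)
      then show "\<exists>V. openin X V \<and> V \<noteq> {} \<and> V \<subseteq> W \<and> (\<forall>\<gamma> \<in> \<A>. src \<G> \<gamma> \<in> V \<longrightarrow> rng \<G> \<gamma> \<in> V
          \<longrightarrow> \<gamma> \<noteq> unit \<G> (src \<G> \<gamma>) \<longrightarrow> (\<ominus>\<^bsub>\<M>\<^esub> f) \<gamma> = fzero \<O> (rng \<G> \<gamma>))"
        using V(1-3) by blast
    qed
  next
    case (add f g)
    show ?case
    proof (intro allI impI)
      fix W assume "openin X W \<and> W \<noteq> {}"
      then obtain V where V: "openin X V" "V \<noteq> {}" "V \<subseteq> W" "\<forall>\<gamma> \<in> \<A>. src \<G> \<gamma> \<in> V \<longrightarrow> rng \<G> \<gamma> \<in> V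
          \<longrightarrow> \<gamma> \<noteq> unit \<G> (src \<G> \<gamma>) \<longrightarrow> f \<gamma> = fzero \<O> (rng \<G> \<gamma>)"
        using add(3) by meson
      then obtain V' where V': "openin X V'" "V' \<noteq> {}" "V' \<subseteq> V" "\<forall>\<gamma> \<in> \<A>. src \<G> \<gamma> \<in> V' \<longrightarrow> rng \<G> \<gamma> \<in> V'
          \<longrightarrow> \<gamma> \<noteq> unit \<G> (src \<G> \<gamma>) \<longrightarrow> g \<gamma> = fzero \<O> (rng \<G> \<gamma>)"
        using add(4) by meson
      have "\<forall>\<gamma> \<in> \<A>. src \<G> \<gamma> \<in> V' \<longrightarrow> rng \<G> \<gamma> \<in> V'
          \<longrightarrow> \<gamma> \<noteq> unit \<G> (src \<G> \<gamma>) \<longrightarrow> (f \<oplus>\<^bsub>\<M>\<^esub> g) \<gamma> = fzero \<O> (rng \<G> \<gamma>)"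
        using V(4) V'(3,4) by (simp add: subset_iff)
      moreover have "V' \<subseteq> W" using V(3) V'(3) by blast
      ultimately show "\<exists>V. openin X V \<and> V \<noteq> {} \<and> V \<subseteq> W \<and> (\<forall>\<gamma> \<in> \<A>. src \<G> \<gamma> \<in> V \<longrightarrow> rng \<G> \<gamma> \<in> V
          \<longrightarrow> \<gamma> \<noteq> unit \<G> (src \<G> \<gamma>) \<longrightarrow> (f \<oplus>\<^bsub>\<M>\<^esub> g) \<gamma> = fzero \<O> (rng \<G> \<gamma>))"
        using V'(1,2) by blast
    qed
  qed
  then show thesis using that assms(3,4) by meson
qed

end

locale germ_field_sheaf = germ_sheaf X D \<theta> \<O> + groupoid_sheaf_of_fields "germ_groupoid X D \<theta>" \<O>
  for X :: "'x topology"
    and D :: "'s::inverse_semigroup \<Rightarrow> 'x set"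
    and \<theta> :: "'s \<Rightarrow> 'x \<Rightarrow> 'x"
    and \<O> :: "(('s \<times> 'x) set, 'x, 'e, 'm) ring_gsheaf_scheme"
begin

section \<open>Field stalks and inversion of local sections\<close>

lemma fone_neq_fzero: "x \<in> topspace X \<Longrightarrow> fone \<O> x \<noteq> fzero \<O> x"
  using domain.one_not_zero[OF field.axioms(1)[OF stalk_field], of x] by (simp add: stalk_simps)

lemma fmult_inverse:
  assumes "x \<in> topspace X" "a \<in> \<S> x" "a \<noteq> fzero \<O> x"
  obtains b where "b \<in> \<S> x" "fmult \<O> b a = fone \<O> x"
proof -
  interpret field "stalk \<O> x" using stalk_field assms(1) by simp
  have "a \<in> Units (stalk \<O> x)" using assms field_Units by (simp add: stalk_simps)
  then obtain b where "b \<in> Units (stalk \<O> x)" "b \<otimes>\<^bsub>stalk \<O> x\<^esub> a = \<one>\<^bsub>stalk \<O> x\<^esub>"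
    using Units_l_inv Units_inv_Units by blast
  then show thesis using that[of b] Units_closed by (simp add: stalk_simps)
qed

text \<open>Take a local section \<tau> through an inverse of \<sigma>(x) in the stalk;
  \<tau>\<sigma> and the continuous unit section agree at \<open>x\<close>, hence on a
  neighbourhood.\<close>

lemma local_section_inverse:
  assumes "local_section V \<sigma>" "x \<in> V" "\<sigma> x \<noteq> fzero \<O> x"
  obtains N \<tau> where "local_section N \<tau>" "x \<in> N" "N \<subseteq> V"
    "\<And>y. y \<in> N \<Longrightarrow> fmult \<O> (\<tau> y) (\<sigma> y) = fone \<O> y"
proof -
  have x: "x \<in> topspace X" "\<sigma> x \<in> \<S> x"
    using assms local_section_stalk local_section_topspace by auto
  obtain b where b: "b \<in> \<S> x" "fmult \<O> b (\<sigma> x) = fone \<O> x"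
    using fmult_inverse[OF x assms(3)] .
  obtain W \<tau> where W: "local_section W \<tau>" "x \<in> W" "\<tau> x = b"
    using local_section_exists[OF b(1)] .
  have o: "openin X (V \<inter> W)" using assms W by (auto simp: local_section_def)
  have s: "local_section (V \<inter> W) \<tau>" "local_section (V \<inter> W) \<sigma>"
    using local_section_mono[OF W(1) o] local_section_mono[OF assms(1) o] by auto
  obtain N where N: "openin X N" "x \<in> N" "N \<subseteq> V \<inter> W"
    "\<And>y. y \<in> N \<Longrightarrow> fmult \<O> (\<tau> y) (\<sigma> y) = fone \<O> y"
    by (rule local_section_agree[OF local_section_fmult[OF s] local_section_fone[OF o], of x])
      (use assms(2) W b in auto)
  have "local_section N \<tau>" using local_section_mono[OF W(1) N(1)] N(3) by blast
  then show thesis using that N by blast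
qed

section \<open>From simplicity to minimality\<close>

text \<open>A local unit around a point of \<open>U\<close> shows that the ideal is nonzero; one
  around a point outside \<open>U\<close> is not in it, so it is proper. Both facts rest on 1
  \<noteq> 0 in the stalks.\<close>

lemma simple_imp_minimal:
  assumes simple: "simple_ring \<Gamma>"
  shows "minimal_action X D \<theta>"
  unfolding minimal_action_def
proof (intro allI impI, elim conjE)
  fix U assume U: "openin X U" and inv: "\<forall>s. \<theta> s ` (U \<inter> D (star s)) \<subseteq> U"
  have rng_U: "rng \<G> \<gamma> \<in> U" if "\<gamma> \<in> \<A>" "src \<G> \<gamma> \<in> U" for \<gamma>
    using that inv by (elim arrowE) (auto simp: src_germ rng_germ)
  have src_U: "src \<G> \<gamma> \<in> U" if "\<gamma> \<in> \<A>" "rng \<G> \<gamma> \<in> U" for \<gamma>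
    using that rng_U[of "ginv \<G> \<gamma>"] by simp
  define I where "I = {f \<in> carrier \<Gamma>. \<forall>\<gamma> \<in> \<A>. rng \<G> \<gamma> \<notin> U \<longrightarrow> f \<gamma> = fzero \<O> (rng \<G> \<gamma>)}"
  have "subgroup I (add_monoid \<M>)"
  proof (rule group.subgroupI[OF sections.a_group])
    show "I \<subseteq> carrier (add_monoid \<M>)" using Gamma_subset by (auto simp: I_def)
    have "\<zero>\<^bsub>\<M>\<^esub> \<in> I" using Gamma_zero by (simp add: I_def)
    then show "I \<noteq> {}" by blast
    show "inv\<^bsub>add_monoid \<M>\<^esub> f \<in> I" if "f \<in> I" for f
      using that Gamma_subset Gamma_neg unfolding a_inv_def[symmetric]
      by (simp add: I_def a_inv_fzero)
    show "f \<otimes>\<^bsub>add_monoid \<M>\<^esub> g \<in> I" if "f \<in> I" "g \<in> I" for f g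
      using that Gamma_add by (simp add: I_def)
  qed
  moreover have "g \<star> f \<in> I \<and> f \<star> g \<in> I" if f: "f \<in> I" and g: "g \<in> carrier \<Gamma>" for f g
  proof -
    have fg: "f \<in> carrier \<Gamma>" "f \<in> carrier \<M>" "g \<in> carrier \<M>"
      using f g Gamma_subset by (auto simp: I_def)
    \<comment> \<open>Left multiplication is where invariance enters: a left factor \<beta> ending
      outside \<open>U\<close> also starts outside \<open>U\<close>, and the argument of
      \<open>f\<close> ends at the source of \<beta>. For right multiplication \<beta> and \<gamma>
      simply have the same range.\<close>
    have "(g \<star> f) \<gamma> = fzero \<O> (rng \<G> \<gamma>)" if \<gamma>: "\<gamma> \<in> \<A>" "rng \<G> \<gamma> \<notin> U" for \<gamma>
    proof (rule convolution_eq_zero[OF fg(3,2) \<gamma>(1)], rule disjI2)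
      fix \<beta> assume b: "\<beta> \<in> \<A>" "rng \<G> \<beta> = rng \<G> \<gamma>"
      then have "src \<G> \<beta> \<notin> U" using rng_U \<gamma>(2) by metis
      then show "f (comp \<G> (ginv \<G> \<beta>) \<gamma>) = fzero \<O> (src \<G> \<beta>)"
        using f b \<gamma>(1) by (simp add: I_def)
    qed
    moreover have "(f \<star> g) \<gamma> = fzero \<O> (rng \<G> \<gamma>)" if \<gamma>: "\<gamma> \<in> \<A>" "rng \<G> \<gamma> \<notin> U" for \<gamma>
      by (rule convolution_eq_zero[OF fg(2,3) \<gamma>(1)]) (use f \<gamma> in \<open>auto simp: I_def\<close>)
    ultimately show ?thesis using Gamma_convolution fg(1) g by (auto simp: I_def)
  qed
  ultimately have "two_sided_ideal I \<Gamma>"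
    unfolding two_sided_ideal_Gamma_iff by (auto simp: I_def)
  then have I: "I = {\<zero>\<^bsub>\<M>\<^esub>} \<or> I = carrier \<Gamma>"
    using simple unfolding simple_ring_def by simp
  show "U = {} \<or> U = topspace X"
  proof (rule ccontr)
    assume "\<not> (U = {} \<or> U = topspace X)"
    then obtain x y where x: "x \<in> U" and y: "y \<in> topspace X" "y \<notin> U"
      using openin_subset[OF U] by blast
    have xX: "x \<in> topspace X" using x openin_subset[OF U] by blast
    have val: "germ_section e K (fone \<O>) (unit \<G> z) = fone \<O> z"
      if "idempotent e" "section_data e K (fone \<O>)" "K \<subseteq> D e" "z \<in> K" for e K z
      using germ_section_germ[OF that(2,4)] that by (simp add: unit_germ subsetD)
    obtain e K where K: "idempotent e" "x \<in> K" "K \<subseteq> U" "K \<subseteq> D e" "section_data e K (fone \<O>)"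
      by (rule unit_section_exists[OF U x])
    let ?f = "germ_section e K (fone \<O>)"
    have "?f \<gamma> = fzero \<O> (rng \<G> \<gamma>)" if \<gamma>: "\<gamma> \<in> \<A>" "rng \<G> \<gamma> \<notin> U" for \<gamma>
    proof (rule germ_section_outside[OF \<gamma>(1)])
      show "\<gamma> \<notin> germ D e ` K"
      proof
        assume "\<gamma> \<in> germ D e ` K"
        then obtain z where z: "z \<in> K" "\<gamma> = germ D e z" by blast
        then have "src \<G> \<gamma> \<in> U" using K section_data_D[OF K(5)] by (auto simp: src_germ)
        then show False using rng_U \<gamma> by blast
      qed
    qed
    then have "?f \<in> I" using K(5) by (simp add: I_def)
    moreover have "?f \<noteq> \<zero>\<^bsub>\<M>\<^esub>"
    proof
      assume "?f = \<zero>\<^bsub>\<M>\<^esub>"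
      then have "?f (unit \<G> x) = fzero \<O> x" using xX by simp
      then show False using val[OF K(1,5,4,2)] fone_neq_fzero[OF xX] by simp
    qed
    ultimately have "I = carrier \<Gamma>" using I by blast
    moreover obtain e' L where L: "idempotent e'" "y \<in> L" "L \<subseteq> D e'" "section_data e' L (fone \<O>)"
      by (rule unit_section_exists[OF openin_topspace y(1)])
    ultimately have "germ_section e' L (fone \<O>) \<in> I" by simp
    then have "germ_section e' L (fone \<O>) (unit \<G> y) = fzero \<O> y" using y by (simp add: I_def)
    then show False using val[OF L(1,4,3,2)] fone_neq_fzero[OF y(1)] by simp
  qed
qed

section \<open>From minimality to simplicity\<close>

text \<open>On a small compact open set, cutting down an element of the ideal removes everything off the
  units; what remains is a nowhere vanishing section, which is invertible since the stalks are
  fields.\<close>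
lemma ideal_contains_unit_section:
  assumes free: "topologically_free X D \<theta>" and I: "two_sided_ideal I \<Gamma>" and "I \<noteq> {\<zero>\<^bsub>\<M>\<^esub>}"
  obtains e K where "idempotent e" "K \<noteq> {}" "section_data e K (fone \<O>)"
    "germ_section e K (fone \<O>) \<in> I"
proof -
  have Isub: "subgroup I (add_monoid \<M>)" "I \<subseteq> carrier \<Gamma>"
    and Iconv: "\<And>f g. f \<in> I \<Longrightarrow> g \<in> carrier \<Gamma> \<Longrightarrow> g \<star> f \<in> I \<and> f \<star> g \<in> I"
    using I unfolding two_sided_ideal_Gamma_iff by blast+
  obtain f0 where f0: "f0 \<in> I" "f0 \<noteq> \<zero>\<^bsub>\<M>\<^esub>"
    using assms(3) subgroup.one_closed[OF Isub(1)] by auto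
  then have "f0 \<in> carrier \<M>" using Isub Gamma_subset by blast
  then obtain \<gamma> where \<gamma>: "\<gamma> \<in> \<A>" "f0 \<gamma> \<noteq> fzero \<O> (rng \<G> \<gamma>)"
    using f0(2) sections_eqI[OF _ zero_sections_closed] zero_sections by metis
  define x where "x = rng \<G> \<gamma>"
  have x: "x \<in> topspace X" using \<gamma> by (simp add: x_def)
  obtain f where f: "f \<in> I" "f (unit \<G> x) \<noteq> fzero \<O> x"
    using ideal_nonzero_on_units[OF I f0(1) \<gamma>] unfolding x_def by blast
  have f\<Gamma>: "f \<in> carrier \<Gamma>" "f \<in> carrier \<M>" using f Isub Gamma_subset by auto
  obtain V \<sigma> where V: "local_section V \<sigma>" "x \<in> V" "\<And>y. y \<in> V \<Longrightarrow> f (unit \<G> y) = \<sigma> y"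
    using Gamma_on_units[OF f\<Gamma>(1) x] by blast
  have "\<sigma> x \<noteq> fzero \<O> x" using f(2) V by simp
  then obtain N \<tau> where N: "local_section N \<tau>" "x \<in> N" "N \<subseteq> V"
    "\<And>y. y \<in> N \<Longrightarrow> fmult \<O> (\<tau> y) (\<sigma> y) = fone \<O> y"
    using local_section_inverse[OF V(1,2)] by blast
  have "openin X N" "N \<noteq> {}" using N by (auto simp: local_section_def)
  then obtain W where W: "openin X W" "W \<noteq> {}" "W \<subseteq> N"
    "\<And>\<gamma>. \<lbrakk>\<gamma> \<in> \<A>; src \<G> \<gamma> \<in> W; rng \<G> \<gamma> \<in> W; \<gamma> \<noteq> unit \<G> (src \<G> \<gamma>)\<rbrakk> \<Longrightarrow> f \<gamma> = fzero \<O> (rng \<G> \<gamma>)"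
    using Gamma_off_units[OF free f\<Gamma>(1)] by metis
  \<comment> \<open>\<open>W\<close> need not contain \<open>x\<close>, so a new base point is
    chosen. Since \<open>W\<close> lies in \<open>N\<close>, the inverse \<tau> is still available
    around it.\<close>
  obtain y where "y \<in> W" using W(2) by blast
  then obtain e K where K: "idempotent e" "y \<in> K" "K \<subseteq> W" "K \<subseteq> D e" "compact_open_in X K"
    "section_data e K (fone \<O>)"
    using unit_section_exists[OF W(1)] by metis
  have \<tau>: "section_data e K \<tau>"
    by (rule section_data_idempotent[OF K(1,5,4) N(1)]) (use K W in blast)
  let ?t = "germ_section e K \<tau>" and ?u = "germ_section e K (fone \<O>)"
  have tf: "?t \<star> f \<in> carrier \<M>" using \<tau> f\<Gamma>(2) by (simp add: convolution_closed)
  have "?t \<star> f \<star> ?u = ?u"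
  proof (rule sections_eqI)
    fix \<gamma> assume \<gamma>: "\<gamma> \<in> \<A>"
    \<comment> \<open>The left factor restricts the range to \<open>K\<close> and the right factor
      the source. Arrows with both ends in \<open>K\<close> have both ends in \<open>W\<close>,
      where \<open>f\<close> survives only at units, and there \<tau> normalizes its value to
      1.\<close>
    have eq: "(?t \<star> f \<star> ?u) \<gamma> = (if src \<G> \<gamma> \<in> K \<and> rng \<G> \<gamma> \<in> K
        then fmult \<O> (\<tau> (rng \<G> \<gamma>)) (f \<gamma>) else fzero \<O> (rng \<G> \<gamma>))"
      using mult_idempotent_section[OF K(1,6) tf \<gamma>] idempotent_section_mult[OF K(1) \<tau> f\<Gamma>(2) \<gamma>]
      by simp
    show "(?t \<star> f \<star> ?u) \<gamma> = ?u \<gamma>"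
    proof (cases "\<gamma> \<in> germ D e ` K")
      case True
      then obtain z where z: "z \<in> K" "\<gamma> = germ D e z" by blast
      have zX: "z \<in> topspace X" using z K(4) D_subset by blast
      have \<gamma>z: "\<gamma> = unit \<G> z" using z K by (simp add: unit_germ subsetD)
      have "z \<in> N" "z \<in> V" using z K(3) W(3) N(3) by blast+
      then have "fmult \<O> (\<tau> z) (f \<gamma>) = fone \<O> z" using V(3) N(4) \<gamma>z by simp
      moreover have "?u \<gamma> = fone \<O> z" using z K(6) by simp
      ultimately show ?thesis using eq \<gamma>z zX z(1) by simp
    next
      case False
      have "f \<gamma> = fzero \<O> (rng \<G> \<gamma>)" if s: "src \<G> \<gamma> \<in> K" "rng \<G> \<gamma> \<in> K"
      proof (rule W(4)[OF \<gamma>])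
        show "\<gamma> \<noteq> unit \<G> (src \<G> \<gamma>)"
        proof
          assume "\<gamma> = unit \<G> (src \<G> \<gamma>)"
          also have "\<dots> = germ D e (src \<G> \<gamma>)" using s K by (simp add: unit_germ subsetD)
          finally show False using False s(1) by blast
        qed
      qed (use s K in auto)
      moreover have "\<tau> (rng \<G> \<gamma>) \<in> \<S> (rng \<G> \<gamma>)" if "rng \<G> \<gamma> \<in> K"
        using that K W local_section_stalk[OF N(1)] by blast
      ultimately have "(?t \<star> f \<star> ?u) \<gamma> = fzero \<O> (rng \<G> \<gamma>)"
        using eq \<gamma> by auto
      then show ?thesis using False \<gamma> by simp
    qed
  qed (use tf K(6) in \<open>simp_all add: convolution_closed\<close>)
  moreover have "?t \<star> f \<star> ?u \<in> I"
    using Iconv f(1) germ_section_in_Gamma[OF \<tau>] germ_section_in_Gamma[OF K(6)] by blast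
  ultimately show thesis using that[of e K] K by auto
qed

lemma minimal_imp_simple:
  assumes free: "topologically_free X D \<theta>" and minimal: "minimal_action X D \<theta>"
  shows "simple_ring \<Gamma>"
  unfolding simple_ring_def
proof (intro allI impI)
  fix I assume I: "two_sided_ideal I \<Gamma>"
  show "I = {\<zero>\<^bsub>\<Gamma>\<^esub>} \<or> I = carrier \<Gamma>"
  proof (cases "I = {\<zero>\<^bsub>\<M>\<^esub>}")
    case False
    have Isub: "subgroup I (add_monoid \<M>)" "I \<subseteq> carrier \<Gamma>"
      using I unfolding two_sided_ideal_Gamma_iff by blast+
    define U where "U = \<Union>{K. \<exists>e. idempotent e \<and> section_data e K (fone \<O>)
      \<and> germ_section e K (fone \<O>) \<in> I}"
    have "openin X U"
      unfolding U_def by (rule openin_Union) (auto simp: section_data_def compact_open_in_def)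
    moreover have "\<theta> s ` (U \<inter> D (star s)) \<subseteq> U" for s
    proof
      fix y assume "y \<in> \<theta> s ` (U \<inter> D (star s))"
      then obtain x e K where x: "y = \<theta> s x" "x \<in> K" "x \<in> D (star s)" "idempotent e"
        "section_data e K (fone \<O>)" "germ_section e K (fone \<O>) \<in> I" by (auto simp: U_def)
      obtain f L where "idempotent f" "section_data f L (fone \<O>)" "\<theta> s x \<in> L"
        "germ_section f L (fone \<O>) \<in> I"
        by (rule ideal_translate[OF I x(4-6,2,3)])
      then show "y \<in> U" unfolding U_def x(1) by blast
    qed
    moreover have "U \<noteq> {}"
    proof -
      obtain e K where "idempotent e" "K \<noteq> {}" "section_data e K (fone \<O>)"
        "germ_section e K (fone \<O>) \<in> I"
        by (rule ideal_contains_unit_section[OF free I False])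
      then show ?thesis unfolding U_def by blast
    qed
    ultimately have U: "U = topspace X" using minimal unfolding minimal_action_def by blast
    have "germ_section s L h \<in> I" if h: "section_data s L h" for s L h
    proof (rule ideal_mem_germ_section[OF I h])
      fix x assume "x \<in> L"
      then have "\<theta> s x \<in> U" using section_data_D[OF h] act_in_D D_subset U by blast
      then show "\<exists>e K. idempotent e \<and> section_data e K (fone \<O>) \<and> \<theta> s x \<in> K
          \<and> germ_section e K (fone \<O>) \<in> I" by (auto simp: U_def)
    qed
    then have "germ_sections \<subseteq> I" by (auto simp: germ_sections_def)
    then have "carrier \<Gamma> \<subseteq> I"
      unfolding carrier_Gamma using group.generate_subgroup_incl[OF sections.a_group _ Isub(1)] by blast
    then show ?thesis using Isub(2) by blast
  qed simp
qed

end

theorem theorem5p12: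
  fixes X :: "'x topology"
    and D :: "'s::inverse_semigroup \<Rightarrow> 'x set"
    and \<theta> :: "'s \<Rightarrow> 'x \<Rightarrow> 'x"
    and \<O> :: "(('s \<times> 'x) set, 'x, 'e) ring_gsheaf"
  assumes "locally_compact_space X" and "Hausdorff_space X" and "zero_dimensional X"
    and "inverse_semigroup_action X D \<theta>"
    and "topologically_free X D \<theta>"
    and "groupoid_sheaf_of_fields (germ_groupoid X D \<theta>) \<O>"
    and "Hausdorff_space (arrows (germ_groupoid X D \<theta>))"
  shows "minimal_action X D \<theta> \<longleftrightarrow> simple_ring (Gamma_c (germ_groupoid X D \<theta>) \<O>)"
proof -
  interpret germ_field_sheaf X D \<theta> \<O>
    using assms by (simp add: germ_field_sheaf_def germ_sheaf_def germ_sheaf_axioms_def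
      groupoid_sheaf_of_fields_def)
  show ?thesis using minimal_imp_simple[OF assms(5)] simple_imp_minimal by blast
qed

end
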